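(* Let $V$ be a model of set theory, $\kappa$ an infinite ordinal, $X\in V$ an infinite set, $\mathscr{L}\in V$ a relational language, and let $\mu_0,\mu_1\in V$ be distinct ergodic invariant measures on $[\mathrm{Str}^\kappa_{\mathscr{L}}(X)]^V$. If $G$ is a $\mu_0$-random generic filter over $V$, then $G$ is not a $\mu_1$-random generic filter over $V$.
   Context: A model of set theory is a transitive model of ZFC. Structures and measures: $\mathrm{Str}_{\mathscr{L}}(X)$ is the set of $\mathscr{L}$-structures with underlying set $X$. An $\mathscr{L}$-literal is an atomic formula or a (possibly iterated) negation of one. $\sigma_\kappa(\mathrm{Str}_{\mathscr{L}}(X))$ is the smallest family of subsets of $\mathrm{Str}_{\mathscr{L}}(X)$ closed under complements and under unions of size $\le\kappa$ and containing all sets $\{\mathcal{M}:\mathcal{M}\models\varphi(\bar a)\}$ for $\varphi$ a literal and $\bar a$ a tuple from $X$. $\mathrm{Str}^\kappa_{\mathscr{L}}(X)$ is $\mathrm{Str}_{\mathscr{L}}(X)$ with this family of measurable sets. A probability $\kappa$-measure on it is a probability measure $\mu$ with $\mu(\bigcup_{i\in\kappa}A_i)=\sum_{i\in\kappa}\mu(A_i)$ for pairwise disjoint measurable $A_i$. $\mathrm{Sym}(X)$ acts by $g\mathcal{M}\models R(g(a_0),\dots)$ iff $\mathcal{M}\models R(a_0,\dots)$; $\mu$ is invariant if $\mu(g[A])=\mu(A)$ for all $g\in\mathrm{Sym}(X)$ and measurable $A$. "Invariant measure" means invariant probability $\kappa$-measure. It is ergodic if every measurable $A$ with $\mu(g[A]\triangle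 A)=0$ for all $g\in\mathrm{Sym}(X)$ satisfies $\mu(A)\in\{0,1\}$. Codes: the set $\mathbb{B}^\kappa_{\mathscr{L}:X}$ of $\kappa$-Borel codes is the smallest set containing the basic codes $\langle 0,\varphi,\bar a\rangle$ ($\varphi$ a finite conjunction of $\mathscr{L}$-literals, $\bar a$ a tuple from $X$) and closed under formal negation $\neg\gamma$ and formal $\bigvee\Gamma$, $\bigwedge\Gamma$ for $\Gamma=\{\gamma_i\}_{i\in\kappa}$. The interpretation $\mathrm{Int}(\gamma)\subseteq\mathrm{Str}_{\mathscr{L}}(X)$ interprets basic codes as $\{\mathcal{M}:\mathcal{M}\models\varphi(\bar a)\}$ and $\neg,\bigvee,\bigwedge$ as complement, union, intersection. $\mu(\gamma)=\mu(\mathrm{Int}(\gamma))$. Forcing: $\gamma\preceq_\mu\zeta$ means $\mu(\gamma\wedge\neg\zeta)=0$, and $\mathcal{O}^+(\mu)=(\{\gamma\in\mathbb{B}^\kappa_{\mathscr{L}:X}:\mu(\gamma)>0\},\preceq_\mu)$, a pre-order (smaller is stronger), computed in $V$. A $\mu$-random generic filter over $V$ is a filter on $\mathcal{O}^+(\mu)$ generic over $V$. *)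

theory Defs
  imports "HOL-Analysis.Analysis"
begin

(* The background universe in which V is transitive and in which generic filters live.
   Only what is needed to make "transitive" and "ordered pair" meaningful is assumed.
   Well-foundedness is meant in the sense of HOL, i.e. for arbitrary collections. *)
class set_universe =
  fixes elem :: "'a \<Rightarrow> 'a \<Rightarrow> bool" (infix "\<^bold>\<in>" 50)
  assumes elem_ext: "(\<And>z. z \<^bold>\<in> x \<longleftrightarrow> z \<^bold>\<in> y) \<Longrightarrow> x = y"
    and elem_wf: "wfp (\<^bold>\<in>)"
    and elem_pairing: "\<exists>p. \<forall>z. z \<^bold>\<in> p \<longleftrightarrow> z = x \<or> z = y"

definition elts :: "'u::set_universe \<Rightarrow> 'u set" where
  "elts x = {y. y \<^bold>\<in> x}"

(* Meaningful only if some set of the universe has exactly the members S. *)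
definition the_set :: "'u::set_universe set \<Rightarrow> 'u" where
  "the_set S = (THE x. elts x = S)"


subsection \<open>Transitive models of ZFC\<close>

(* First-order formulas of the language of set theory, with named variables. *)
datatype fm = FMem nat nat | FEq nat nat | FNot fm | FAnd fm fm | FAll nat fm

primrec fsat :: "'u::set_universe set \<Rightarrow> fm \<Rightarrow> (nat \<Rightarrow> 'u) \<Rightarrow> bool" where
  "fsat V (FMem i j) e \<longleftrightarrow> e i \<^bold>\<in> e j"
| "fsat V (FEq i j) e \<longleftrightarrow> e i = e j"
| "fsat V (FNot \<phi>) e \<longleftrightarrow> \<not> fsat V \<phi> e"
| "fsat V (FAnd \<phi> \<psi>) e \<longleftrightarrow> fsat V \<phi> e \<and> fsat V \<psi> e"
| "fsat V (FAll i \<phi>) e \<longleftrightarrow> (\<forall>x\<in>V. fsat V \<phi> (e(i := x)))"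

(* In the two schemes the environment e supplies the parameters of the formula. *)
definition models_ZFC :: "'u::set_universe set \<Rightarrow> bool" where
  "models_ZFC V \<longleftrightarrow>
     \<comment> \<open>extensionality\<close>
     (\<forall>x\<in>V. \<forall>y\<in>V. (\<forall>z\<in>V. z \<^bold>\<in> x \<longleftrightarrow> z \<^bold>\<in> y) \<longrightarrow> x = y) \<and>
     \<comment> \<open>foundation\<close>
     (\<forall>x\<in>V. (\<exists>y\<in>V. y \<^bold>\<in> x) \<longrightarrow> (\<exists>y\<in>V. y \<^bold>\<in> x \<and> \<not> (\<exists>z\<in>V. z \<^bold>\<in> x \<and> z \<^bold>\<in> y))) \<and>
     \<comment> \<open>pairing\<close>
     (\<forall>x\<in>V. \<forall>y\<in>V. \<exists>p\<in>V. \<forall>z\<in>V. z \<^bold>\<in> p \<longleftrightarrow> z = x \<or> z = y) \<and>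
     \<comment> \<open>union\<close>
     (\<forall>x\<in>V. \<exists>u\<in>V. \<forall>z\<in>V. z \<^bold>\<in> u \<longleftrightarrow> (\<exists>y\<in>V. y \<^bold>\<in> x \<and> z \<^bold>\<in> y)) \<and>
     \<comment> \<open>power set\<close>
     (\<forall>x\<in>V. \<exists>p\<in>V. \<forall>y\<in>V. y \<^bold>\<in> p \<longleftrightarrow> (\<forall>z\<in>V. z \<^bold>\<in> y \<longrightarrow> z \<^bold>\<in> x)) \<and>
     \<comment> \<open>infinity\<close>
     (\<exists>w\<in>V. (\<exists>z\<in>V. z \<^bold>\<in> w \<and> (\<forall>y\<in>V. \<not> y \<^bold>\<in> z)) \<and>
        (\<forall>x\<in>V. x \<^bold>\<in> w \<longrightarrow> (\<exists>s\<in>V. s \<^bold>\<in> w \<and> (\<forall>y\<in>V. y \<^bold>\<in> s \<longleftrightarrow> y \<^bold>\<in> x \<or> y = x)))) \<and>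
     \<comment> \<open>separation\<close>
     (\<forall>\<phi> e. range e \<subseteq> V \<longrightarrow>
        (\<forall>a\<in>V. \<exists>b\<in>V. \<forall>x\<in>V. x \<^bold>\<in> b \<longleftrightarrow> x \<^bold>\<in> a \<and> fsat V \<phi> (e(0 := x)))) \<and>
     \<comment> \<open>replacement\<close>
     (\<forall>\<phi> e. range e \<subseteq> V \<longrightarrow>
        (\<forall>a\<in>V. (\<forall>x\<in>V. x \<^bold>\<in> a \<longrightarrow> (\<forall>y\<in>V. \<forall>z\<in>V.
             fsat V \<phi> (e(0 := x, 1 := y)) \<and> fsat V \<phi> (e(0 := x, 1 := z)) \<longrightarrow> y = z)) \<longrightarrow>
           (\<exists>b\<in>V. \<forall>y\<in>V. y \<^bold>\<in> b \<longleftrightarrow> (\<exists>x\<in>V. x \<^bold>\<in> a \<and> fsat V \<phi> (e(0 := x, 1 := y)))))) \<and>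
     \<comment> \<open>choice\<close>
     (\<forall>a\<in>V. (\<forall>x\<in>V. x \<^bold>\<in> a \<longrightarrow> (\<exists>y\<in>V. y \<^bold>\<in> x)) \<and>
          (\<forall>x\<in>V. \<forall>y\<in>V. x \<^bold>\<in> a \<and> y \<^bold>\<in> a \<and> x \<noteq> y \<longrightarrow> \<not> (\<exists>z\<in>V. z \<^bold>\<in> x \<and> z \<^bold>\<in> y)) \<longrightarrow>
        (\<exists>c\<in>V. \<forall>x\<in>V. x \<^bold>\<in> a \<longrightarrow> (\<exists>!y. y \<in> V \<and> y \<^bold>\<in> x \<and> y \<^bold>\<in> c)))"

definition model_of_set_theory :: "'u::set_universe set \<Rightarrow> bool" where
  "model_of_set_theory V \<longleftrightarrow> (\<forall>x\<in>V. elts x \<subseteq> V) \<and> models_ZFC V"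


subsection \<open>Set-theoretic coding\<close>

definition pair :: "'u::set_universe \<Rightarrow> 'u \<Rightarrow> 'u" where
  "pair x y = the_set {the_set {x}, the_set {x, y}}"

definition is_fun :: "'u::set_universe \<Rightarrow> 'u set \<Rightarrow> 'u set \<Rightarrow> bool" where
  "is_fun f A B \<longleftrightarrow> elts f \<subseteq> {pair x y |x y. x \<in> A \<and> y \<in> B} \<and> (\<forall>x\<in>A. \<exists>!y. pair x y \<^bold>\<in> f)"

definition app :: "'u::set_universe \<Rightarrow> 'u \<Rightarrow> 'u" where
  "app f x = (THE y. pair x y \<^bold>\<in> f)"

primrec num :: "nat \<Rightarrow> 'u::set_universe" where
  "num 0 = the_set {}"
| "num (Suc n) = the_set (insert (num n) (elts (num n)))"

(* A finite sequence is a function on a natural number. *)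
definition seq :: "'u::set_universe list \<Rightarrow> 'u" where
  "seq xs = the_set {pair (num i) (xs ! i) |i. i < length xs}"

definition ordinal :: "'u::set_universe \<Rightarrow> bool" where
  "ordinal \<alpha> \<longleftrightarrow> (\<forall>x\<in>elts \<alpha>. elts x \<subseteq> elts \<alpha>) \<and> (\<forall>x\<in>elts \<alpha>. \<forall>y\<in>elts x. elts y \<subseteq> elts x)"

(* Real numbers inside a model are lower Dedekind cuts of rationals, a rational in lowest terms
   being coded by its sign, the absolute value of its numerator, and its denominator. *)
definition rat_code :: "rat \<Rightarrow> 'u::set_universe" where
  "rat_code q = (case quotient_of q of (a, b) \<Rightarrow>
     pair (num (if a < 0 then 1 else 0)) (pair (num (nat \<bar>a\<bar>)) (num (nat b))))"

definition codes_real :: "'u::set_universe \<Rightarrow> real \<Rightarrow> bool" where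
  "codes_real x r \<longleftrightarrow> elts x = rat_code ` {q. real_of_rat q < r}"

definition real_of_set :: "'u::set_universe \<Rightarrow> real" where
  "real_of_set x = (THE r. codes_real x r)"


subsection \<open>Literals\<close>

datatype 'u literal = Atom 'u "nat list" | Equal nat nat | Neg "'u literal"

primrec lit_vars :: "'u literal \<Rightarrow> nat set" where
  "lit_vars (Atom R vs) = set vs"
| "lit_vars (Equal i j) = {i, j}"
| "lit_vars (Neg l) = lit_vars l"

primrec lit_code :: "'u::set_universe literal \<Rightarrow> 'u" where
  "lit_code (Atom R vs) = pair (num 0) (pair R (seq (map num vs)))"
| "lit_code (Equal i j) = pair (num 1) (pair (num i) (num j))"
| "lit_code (Neg l) = pair (num 2) (lit_code l)"

(* A structure is a function M sending each relation symbol to a set of finite sequences. *)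
definition holds :: "'u::set_universe \<Rightarrow> 'u \<Rightarrow> 'u list \<Rightarrow> bool" where
  "holds M R xs \<longleftrightarrow> seq xs \<^bold>\<in> app M R"

primrec sat_lit :: "'u::set_universe \<Rightarrow> 'u list \<Rightarrow> 'u literal \<Rightarrow> bool" where
  "sat_lit M a (Atom R vs) \<longleftrightarrow> holds M R (map ((!) a) vs)"
| "sat_lit M a (Equal i j) \<longleftrightarrow> a ! i = a ! j"
| "sat_lit M a (Neg l) \<longleftrightarrow> \<not> sat_lit M a l"

(* Formal negation, disjunction and conjunction of codes; basic codes carry the tag 0. *)
definition basic_code :: "'u::set_universe literal list \<Rightarrow> 'u list \<Rightarrow> 'u" where
  "basic_code \<phi> a = pair (num 0) (pair (seq (map lit_code \<phi>)) (seq a))"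

definition neg_code :: "'u::set_universe \<Rightarrow> 'u" where
  "neg_code \<gamma> = pair (num 1) \<gamma>"

definition Or_code :: "'u::set_universe \<Rightarrow> 'u" where
  "Or_code \<Gamma> = pair (num 2) \<Gamma>"

definition And_code :: "'u::set_universe \<Rightarrow> 'u" where
  "And_code \<Gamma> = pair (num 3) \<Gamma>"


subsection \<open>Structures, measures and random forcing, computed in a model\<close>

(* Everything below is computed in V: structures, permutations, families, measurable sets, codes,
   measures and dense sets are elements of V.  The two inductively generated collections are least
   fixed points taken in HOL of operations on elements of V; since V is transitive and the universe
   is well-founded, they agree with the least such collections in the sense of V. *)
context
  fixes V :: "'u::set_universe set" and \<kappa> X L :: 'u
begin

(* A relational language is a function from its set of symbols to the natural numbers. *)
definition symbols :: "'u set" where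
  "symbols = {R \<in> V. \<exists>n. pair R (num n) \<^bold>\<in> L}"

definition relational_language :: bool where
  "relational_language \<longleftrightarrow> L \<in> V \<and> is_fun L symbols (range num)"

definition arity :: "'u \<Rightarrow> nat" where
  "arity R = (THE n. app L R = num n)"

definition tuples :: "nat \<Rightarrow> 'u list set" where
  "tuples n = {xs. set xs \<subseteq> elts X \<and> length xs = n}"

definition Str :: "'u set" where
  "Str = {M \<in> V. is_fun M symbols V \<and> (\<forall>R\<in>symbols. elts (app M R) \<subseteq> seq ` tuples (arity R))}"

primrec wf_lit :: "'u literal \<Rightarrow> bool" where
  "wf_lit (Atom R vs) \<longleftrightarrow> R \<in> symbols \<and> length vs = arity R"
| "wf_lit (Equal i j) \<longleftrightarrow> True"
| "wf_lit (Neg l) \<longleftrightarrow> wf_lit l"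

(* The tuple a assigns a ! i to the variable i, so it must be long enough to cover l. *)
definition instance_of :: "'u literal \<Rightarrow> 'u list \<Rightarrow> bool" where
  "instance_of l a \<longleftrightarrow> wf_lit l \<and> lit_vars l \<subseteq> {..<length a} \<and> set a \<subseteq> elts X"

definition card_le_kappa :: "'u \<Rightarrow> bool" where
  "card_le_kappa F \<longleftrightarrow> (\<exists>f\<in>V. is_fun f (elts F) (elts \<kappa>) \<and> inj_on (app f) (elts F))"

inductive_set sigma :: "'u set" where
  basic: "instance_of l a \<Longrightarrow> the_set {M \<in> Str. sat_lit M a l} \<in> sigma"
| compl: "A \<in> sigma \<Longrightarrow> the_set (Str - elts A) \<in> sigma"
| union: "F \<in> V \<Longrightarrow> card_le_kappa F \<Longrightarrow> (\<And>A. A \<^bold>\<in> F \<Longrightarrow> A \<in> sigma) \<Longrightarrow>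
    the_set (\<Union>A\<in>elts F. elts A) \<in> sigma"

definition val :: "'u \<Rightarrow> 'u \<Rightarrow> real" where
  "val \<mu> A = real_of_set (app \<mu> A)"

(* The sum of a family of non-negative reals is the supremum of its finite partial sums, so it does
   not matter that it is evaluated outside V. *)
definition additive_over :: "'u set \<Rightarrow> 'u \<Rightarrow> bool" where
  "additive_over I \<mu> \<longleftrightarrow>
     (\<forall>A\<in>V. is_fun A I sigma \<and> disjoint_family_on (\<lambda>i. elts (app A i)) I \<longrightarrow>
        ((\<lambda>i. val \<mu> (app A i)) has_sum val \<mu> (the_set (\<Union>i\<in>I. elts (app A i)))) I)"

definition probability_kappa_measure :: "'u \<Rightarrow> bool" where
  "probability_kappa_measure \<mu> \<longleftrightarrow>
     \<mu> \<in> V \<and> is_fun \<mu> sigma {x \<in> V. \<exists>r. codes_real x r} \<and>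
     (\<forall>A\<in>sigma. 0 \<le> val \<mu> A) \<and> val \<mu> (the_set Str) = 1 \<and>
     additive_over (range num) \<mu> \<and> additive_over (elts \<kappa>) \<mu>"

definition Sym :: "'u set" where
  "Sym = {g \<in> V. is_fun g (elts X) (elts X) \<and> bij_betw (app g) (elts X) (elts X)}"

definition act :: "'u \<Rightarrow> 'u \<Rightarrow> 'u" where
  "act g M = (THE N. N \<in> Str \<and>
     (\<forall>R\<in>symbols. \<forall>xs\<in>tuples (arity R). holds N R (map (app g) xs) \<longleftrightarrow> holds M R xs))"

definition translate :: "'u \<Rightarrow> 'u \<Rightarrow> 'u" where
  "translate g A = the_set (act g ` elts A)"

definition invariant_measure :: "'u \<Rightarrow> bool" where
  "invariant_measure \<mu> \<longleftrightarrow> probability_kappa_measure \<mu> \<and>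
     (\<forall>g\<in>Sym. \<forall>A\<in>sigma. val \<mu> (translate g A) = val \<mu> A)"

definition ergodic :: "'u \<Rightarrow> bool" where
  "ergodic \<mu> \<longleftrightarrow>
     (\<forall>A\<in>sigma.
        (\<forall>g\<in>Sym. val \<mu> (the_set ((elts (translate g A) - elts A) \<union>
                                     (elts A - elts (translate g A)))) = 0) \<longrightarrow>
        val \<mu> A \<in> {0, 1})"

(* Gamma is the set of values of a family indexed by \<kappa>. *)
definition kappa_indexed :: "'u \<Rightarrow> bool" where
  "kappa_indexed \<Gamma> \<longleftrightarrow> \<Gamma> \<in> V \<and>
     (\<exists>f\<in>V. is_fun f (elts \<kappa>) (elts \<Gamma>) \<and> app f ` elts \<kappa> = elts \<Gamma>)"

inductive_set borel_codes :: "'u set" where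
  basic: "(\<And>l. l \<in> set \<phi> \<Longrightarrow> instance_of l a) \<Longrightarrow> set a \<subseteq> elts X \<Longrightarrow>
    basic_code \<phi> a \<in> borel_codes"
| neg: "\<gamma> \<in> borel_codes \<Longrightarrow> neg_code \<gamma> \<in> borel_codes"
| Or: "kappa_indexed \<Gamma> \<Longrightarrow> (\<And>\<gamma>. \<gamma> \<^bold>\<in> \<Gamma> \<Longrightarrow> \<gamma> \<in> borel_codes) \<Longrightarrow> Or_code \<Gamma> \<in> borel_codes"
| And: "kappa_indexed \<Gamma> \<Longrightarrow> (\<And>\<gamma>. \<gamma> \<^bold>\<in> \<Gamma> \<Longrightarrow> \<gamma> \<in> borel_codes) \<Longrightarrow> And_code \<Gamma> \<in> borel_codes"

(* The graph of the interpretation, defined by recursion on codes. *)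
inductive interprets :: "'u \<Rightarrow> 'u set \<Rightarrow> bool" where
  basic: "(\<And>l. l \<in> set \<phi> \<Longrightarrow> instance_of l a) \<Longrightarrow> set a \<subseteq> elts X \<Longrightarrow>
    interprets (basic_code \<phi> a) {M \<in> Str. \<forall>l\<in>set \<phi>. sat_lit M a l}"
| neg: "\<gamma> \<in> borel_codes \<Longrightarrow> interprets \<gamma> S \<Longrightarrow> interprets (neg_code \<gamma>) (Str - S)"
| Or: "kappa_indexed \<Gamma> \<Longrightarrow>
    (\<And>\<gamma>. \<gamma> \<^bold>\<in> \<Gamma> \<Longrightarrow> \<gamma> \<in> borel_codes) \<Longrightarrow> (\<And>\<gamma>. \<gamma> \<^bold>\<in> \<Gamma> \<Longrightarrow> interprets \<gamma> (S \<gamma>)) \<Longrightarrow>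
    interprets (Or_code \<Gamma>) (\<Union>\<gamma>\<in>elts \<Gamma>. S \<gamma>)"
| And: "kappa_indexed \<Gamma> \<Longrightarrow>
    (\<And>\<gamma>. \<gamma> \<^bold>\<in> \<Gamma> \<Longrightarrow> \<gamma> \<in> borel_codes) \<Longrightarrow> (\<And>\<gamma>. \<gamma> \<^bold>\<in> \<Gamma> \<Longrightarrow> interprets \<gamma> (S \<gamma>)) \<Longrightarrow>
    interprets (And_code \<Gamma>) (\<Inter>\<gamma>\<in>elts \<Gamma>. S \<gamma>)"

definition Int_code :: "'u \<Rightarrow> 'u" where
  "Int_code \<gamma> = the_set (THE S. interprets \<gamma> S)"

definition code_measure :: "'u \<Rightarrow> 'u \<Rightarrow> real" where
  "code_measure \<mu> \<gamma> = val \<mu> (Int_code \<gamma>)"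

definition random_le :: "'u \<Rightarrow> 'u \<Rightarrow> 'u \<Rightarrow> bool" where
  "random_le \<mu> \<gamma> \<zeta> \<longleftrightarrow> code_measure \<mu> (And_code (the_set {\<gamma>, neg_code \<zeta>})) = 0"

definition random_conditions :: "'u \<Rightarrow> 'u set" where
  "random_conditions \<mu> = {\<gamma> \<in> borel_codes. code_measure \<mu> \<gamma> > 0}"

(* Smaller conditions are stronger; G itself need not be in V. *)
definition random_filter :: "'u \<Rightarrow> 'u set \<Rightarrow> bool" where
  "random_filter \<mu> G \<longleftrightarrow>
     G \<subseteq> random_conditions \<mu> \<and> G \<noteq> {} \<and>
     (\<forall>\<gamma>\<in>G. \<forall>\<zeta>\<in>random_conditions \<mu>. random_le \<mu> \<gamma> \<zeta> \<longrightarrow> \<zeta> \<in> G) \<and>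
     (\<forall>\<gamma>\<in>G. \<forall>\<zeta>\<in>G. \<exists>\<xi>\<in>G. random_le \<mu> \<xi> \<gamma> \<and> random_le \<mu> \<xi> \<zeta>)"

definition random_dense :: "'u \<Rightarrow> 'u set \<Rightarrow> bool" where
  "random_dense \<mu> D \<longleftrightarrow>
     D \<subseteq> random_conditions \<mu> \<and> (\<forall>\<gamma>\<in>random_conditions \<mu>. \<exists>\<delta>\<in>D. random_le \<mu> \<delta> \<gamma>)"

definition random_generic :: "'u \<Rightarrow> 'u set \<Rightarrow> bool" where
  "random_generic \<mu> G \<longleftrightarrow>
     random_filter \<mu> G \<and> (\<forall>D\<in>V. random_dense \<mu> (elts D) \<longrightarrow> G \<inter> elts D \<noteq> {})"

end

end

theory Submission
  imports Defs
begin

text \<open>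
  Genericity is not needed. If a measurable set \<open>P\<close> of \<open>V\<close> has \<open>\<mu>\<^sub>0\<close>-measure 1 and \<open>\<mu>\<^sub>1\<close>-measure 0, then every
  \<open>\<mu>\<^sub>0\<close>-condition lies below a code \<open>\<gamma>\<close> of \<open>P\<close>, so \<open>\<gamma>\<close> belongs to every nonempty upward closed set of
  \<open>\<mu>\<^sub>0\<close>-conditions, whereas \<open>\<gamma>\<close> is not a \<open>\<mu>\<^sub>1\<close>-condition.

  To find \<open>P\<close>, call \<open>A\<close> strictly positive if every measurable \<open>B \<subseteq> A\<close> with \<open>\<mu>\<^sub>0 B \<le> \<mu>\<^sub>1 B\<close> is
  \<open>\<mu>\<^sub>1\<close>-null. Let \<open>P\<close> be a maximal strictly positive set. Permutations preserve strict positivity, so \<open>P\<close>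
  is almost invariant for both measures, and ergodicity gives \<open>\<mu>\<^sub>i P \<in> {0, 1}\<close>. If \<open>\<mu>\<^sub>0 P = 0\<close>, the Hahn
  argument yields \<open>\<mu>\<^sub>0 \<le> \<mu>\<^sub>1\<close> and hence equality; if both values are 1, then \<open>P\<close> is not strictly positive.

  The measures are only additive along families in \<open>V\<close>, so the exhaustion arguments are carried out inside
  \<open>V\<close>. They only compare values \<open>\<mu>\<^sub>i A\<close> with each other and with \<open>1 / k\<close>, which is inclusion and
  membership of Dedekind cuts and needs no arithmetic in \<open>V\<close>.
\<close>


subsection \<open>Definability over a transitive model\<close>

text \<open>The obstacle is that V only knows first-order formulas with parameters in V, while the
  argument is phrased with HOL functions and sets. Every auxiliary object has to be brought into V
  by Separation, Replacement or Choice; \<open>definable\<close> and \<open>dterm\<close> turn this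
  into obligations that follow the shape of a HOL term. Some objects resist a direct formula.
  Iteration and recursion are expressed by the existence of a partial computation in V. The family
  of measurable sets is a fixed point taken in HOL; it is an element of V because it is the domain
  of a measure. Borel codes have no such bound, so pairs of a code and its interpretation are built
  in set-sized stages along the ordinals of V. This gives each measurable set a code and each code a
  measurable interpretation. Well-foundedness of the universe makes the omega of V standard, so the
  finite sequences of V are exactly the coded HOL lists, and HOL induction can be used on
  computations in V.\<close>

primrec fv :: "fm \<Rightarrow> nat set" where
  "fv (FMem i j) = {i, j}"
| "fv (FEq i j) = {i, j}"
| "fv (FNot \<phi>) = fv \<phi>"
| "fv (FAnd \<phi> \<psi>) = fv \<phi> \<union> fv \<psi>"
| "fv (FAll i \<phi>) = fv \<phi>"

lemma finite_fv: "finite (fv \<phi>)"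
  by (induction \<phi>) auto

text \<open>\<open>fv\<close> also counts quantified variables; it only has to be a finite set of
  variables on which satisfaction depends.\<close>

lemma fsat_cong: "(\<And>i. i \<in> fv \<phi> \<Longrightarrow> e i = e' i) \<Longrightarrow> fsat V \<phi> e \<longleftrightarrow> fsat V \<phi> e'"
proof (induction \<phi> arbitrary: e e')
  case (FAll i \<phi>)
  have "fsat V \<phi> (e(i := x)) \<longleftrightarrow> fsat V \<phi> (e'(i := x))" for x
    by (rule FAll.IH) (use FAll.prems in auto)
  then show ?case by simp
next
  case (FAnd \<phi> \<psi>)
  have "fsat V \<phi> e \<longleftrightarrow> fsat V \<phi> e'"
    by (rule FAnd.IH(1)) (simp add: FAnd.prems)
  moreover have "fsat V \<psi> e \<longleftrightarrow> fsat V \<psi> e'"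
    by (rule FAnd.IH(2)) (simp add: FAnd.prems)
  ultimately show ?case by simp
next
  case (FNot \<phi>)
  have "fsat V \<phi> e \<longleftrightarrow> fsat V \<phi> e'"
    by (rule FNot.IH) (simp add: FNot.prems)
  then show ?case by simp
qed auto

text \<open>Simultaneous renaming by an arbitrary f that may identify variables. A bound variable is
  moved above all images of \<open>fv\<close> under f, which rules out capture.\<close>

primrec rename_fm :: "fm \<Rightarrow> (nat \<Rightarrow> nat) \<Rightarrow> fm" where
  "rename_fm (FMem i j) f = FMem (f i) (f j)"
| "rename_fm (FEq i j) f = FEq (f i) (f j)"
| "rename_fm (FNot \<phi>) f = FNot (rename_fm \<phi> f)"
| "rename_fm (FAnd \<phi> \<psi>) f = FAnd (rename_fm \<phi> f) (rename_fm \<psi> f)"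
| "rename_fm (FAll i \<phi>) f = FAll (Suc (Max (insert 0 (f ` fv \<phi>))))
     (rename_fm \<phi> (f(i := Suc (Max (insert 0 (f ` fv \<phi>))))))"

lemma fsat_rename_fm: "fsat V (rename_fm \<phi> f) e \<longleftrightarrow> fsat V \<phi> (\<lambda>i. e (f i))"
proof (induction \<phi> arbitrary: f e)
  case (FAll i \<phi>)
  define k where "k = Suc (Max (insert 0 (f ` fv \<phi>)))"
  have fresh: "f j \<noteq> k" if "j \<in> fv \<phi>" for j
  proof -
    have "f j \<le> Max (insert 0 (f ` fv \<phi>))"
      using that finite_fv by (intro Max_ge) auto
    then show ?thesis unfolding k_def by linarith
  qed
  have "fsat V \<phi> (\<lambda>j. (e(k := x)) ((f(i := k)) j)) \<longleftrightarrow> fsat V \<phi> ((\<lambda>i. e (f i))(i := x))" for x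
    by (rule fsat_cong) (use fresh in auto)
  then show ?case
    unfolding rename_fm.simps fsat.simps k_def[symmetric] FAll.IH by simp
qed auto

section \<open>Extensionality, ordered pairs and closure properties of V\<close>

lemma elts_inject: "elts x = elts y \<longleftrightarrow> x = y"
  by (metis elts_def elem_ext mem_Collect_eq)

lemma mem_elts [simp]: "x \<in> elts y \<longleftrightarrow> x \<^bold>\<in> y"
  by (simp add: elts_def)

lemma the_set_elts [simp]: "the_set (elts x) = x"
  by (simp add: the_set_def elts_inject)

lemma the_set_eqI: "elts x = S \<Longrightarrow> the_set S = x"
  by auto

lemma elem_induct [case_names step]:
  assumes "\<And>x. (\<And>y. y \<^bold>\<in> x \<Longrightarrow> P y) \<Longrightarrow> P x"
  shows "P (x :: 'u::set_universe)"
  using elem_wf assms by (rule wfp_induct_rule)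

lemma elem_irrefl: "\<not> x \<^bold>\<in> (x :: 'u::set_universe)"
  by (induction x rule: elem_induct) blast

lemma elem_minimal:
  assumes "x \<in> (S :: 'u::set_universe set)"
  obtains m where "m \<in> S" "\<And>y. y \<^bold>\<in> m \<Longrightarrow> y \<notin> S"
  using assms by (induction x rule: elem_induct) blast

lemma elts_upair [simp]: "elts (the_set {x, y}) = {x, y :: 'u::set_universe}"
proof -
  obtain p :: 'u where "\<forall>z. z \<^bold>\<in> p \<longleftrightarrow> z = x \<or> z = y"
    using elem_pairing[of x y] by (elim exE)
  then have "elts p = {x, y}" unfolding set_eq_iff mem_elts by simp
  then show ?thesis using the_set_eqI[of p] by simp
qed

lemma elts_sing [simp]: "elts (the_set {x :: 'u::set_universe}) = {x}"
  using elts_upair[of x x] by simp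

lemma elts_pair: "elts (pair x y) = {the_set {x}, the_set {x, y :: 'u::set_universe}}"
  by (simp add: pair_def)

lemma pair_inject [simp]: "pair x y = pair x' y' \<longleftrightarrow> x = x' \<and> y = (y' :: 'u::set_universe)"
proof
  assume "pair x y = pair x' y'"
  then have e: "{the_set {x}, the_set {x, y}} = {the_set {x'}, the_set {x', y'}}"
    by (metis elts_pair)
  have u: "the_set {x, y} = the_set {a, b} \<longleftrightarrow> {x, y} = {a, b}" for x y a b :: 'u
    by (metis elts_upair)
  have s: "the_set {x} = the_set {a, b} \<longleftrightarrow> a = x \<and> b = x" for x a b :: 'u
    using u[of x x a b] by auto
  have s1: "the_set {x} = the_set {a} \<longleftrightarrow> a = x" for x a :: 'u
    using u[of x x a a] by auto
  have s2: "the_set {a, b} = the_set {x} \<longleftrightarrow> a = x \<and> b = x" for x a b :: 'u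
    using u[of a b x x] by auto
  show "x = x' \<and> y = y'"
    using e unfolding doubleton_eq_iff s s1 s2 u by auto
qed auto

locale zfc =
  fixes V :: "'u::set_universe set"
  assumes model: "model_of_set_theory V"
begin

lemma model_trans: "x \<in> V \<Longrightarrow> y \<^bold>\<in> x \<Longrightarrow> y \<in> V"
  using model unfolding model_of_set_theory_def by (metis mem_elts subsetD)

lemma elts_subset: "x \<in> V \<Longrightarrow> elts x \<subseteq> V"
  using model unfolding model_of_set_theory_def by blast

lemma ZFC: "models_ZFC V"
  using model unfolding model_of_set_theory_def by auto

text \<open>The bridge between the two levels: for such HOL sets \<open>the_set\<close> is
  meaningful and its value lies in V. The axioms of ZFC are used from here on as closure rules for
  \<open>vset\<close>.\<close>

definition vset :: "'u set \<Rightarrow> bool" where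
  "vset S \<longleftrightarrow> (\<exists>x\<in>V. elts x = S)"

lemma vset_elts_the_set [simp]: "vset S \<Longrightarrow> elts (the_set S) = S"
  unfolding vset_def by auto

lemma vset_in_V: "vset S \<Longrightarrow> the_set S \<in> V"
  unfolding vset_def by auto

lemma vset_elts [intro]: "x \<in> V \<Longrightarrow> vset (elts x)"
  unfolding vset_def by auto

lemma vset_subset: "vset S \<Longrightarrow> S \<subseteq> V"
  unfolding vset_def using elts_subset by blast

lemma vset_upair: assumes "x \<in> V" "y \<in> V" shows "vset {x, y}"
proof -
  have "\<forall>x\<in>V. \<forall>y\<in>V. \<exists>p\<in>V. \<forall>z\<in>V. z \<^bold>\<in> p \<longleftrightarrow> z = x \<or> z = y"
    using ZFC unfolding models_ZFC_def by (elim conjE)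
  then have "\<exists>p\<in>V. \<forall>z\<in>V. z \<^bold>\<in> p \<longleftrightarrow> z = x \<or> z = y" using assms by blast
  then obtain p where "p \<in> V" "\<forall>z\<in>V. z \<^bold>\<in> p \<longleftrightarrow> z = x \<or> z = y" by blast
  then have "elts p = {x, y}" using elts_subset[OF \<open>p \<in> V\<close>] assms by auto
  then show ?thesis using \<open>p \<in> V\<close> unfolding vset_def by blast
qed

lemma vset_sing: "x \<in> V \<Longrightarrow> vset {x}"
  using vset_upair[of x x] by simp

lemma pair_in_V [simp]: "pair x y \<in> V \<longleftrightarrow> x \<in> V \<and> y \<in> V"
proof
  assume p: "pair x y \<in> V"
  have "the_set {x, y} \<^bold>\<in> pair x y" by (simp add: elts_pair flip: mem_elts)
  then have q: "the_set {x, y} \<in> V" using p model_trans by blast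
  have "x \<^bold>\<in> the_set {x, y}" "y \<^bold>\<in> the_set {x, y}" by (simp_all flip: mem_elts)
  then show "x \<in> V \<and> y \<in> V" using q model_trans by blast
next
  assume "x \<in> V \<and> y \<in> V"
  then show "pair x y \<in> V" unfolding pair_def by (intro vset_in_V vset_upair vset_sing) auto
qed

lemma vset_Union: assumes "x \<in> V" shows "vset (\<Union>y\<in>elts x. elts y)"
proof -
  have "\<forall>x\<in>V. \<exists>u\<in>V. \<forall>z\<in>V. z \<^bold>\<in> u \<longleftrightarrow> (\<exists>y\<in>V. y \<^bold>\<in> x \<and> z \<^bold>\<in> y)"
    using ZFC unfolding models_ZFC_def by (elim conjE)
  then obtain p where p: "p \<in> V" "\<forall>z\<in>V. z \<^bold>\<in> p \<longleftrightarrow> (\<exists>y\<in>V. y \<^bold>\<in> x \<and> z \<^bold>\<in> y)"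
    using assms by blast
  have "z \<^bold>\<in> p \<longleftrightarrow> (\<exists>y. y \<^bold>\<in> x \<and> z \<^bold>\<in> y)" for z
    using p(2) model_trans[OF p(1), of z] model_trans[OF assms] model_trans by metis
  then have "elts p = (\<Union>y\<in>elts x. elts y)"
    unfolding set_eq_iff UN_iff mem_elts bex_simps Bex_def by simp
  then show ?thesis using \<open>p \<in> V\<close> unfolding vset_def by blast
qed

lemma vset_Un: assumes "vset S" "vset T" shows "vset (S \<union> T)"
proof -
  have V: "the_set S \<in> V" "the_set T \<in> V" using assms by (auto intro: vset_in_V)
  have "vset (\<Union>y\<in>elts (the_set {the_set S, the_set T}). elts y)"
    by (intro vset_Union vset_in_V vset_upair V)
  then show ?thesis using assms by simp
qed

lemma vset_Pow: assumes "x \<in> V" shows "vset {y \<in> V. elts y \<subseteq> elts x}"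
proof -
  have "\<forall>x\<in>V. \<exists>p\<in>V. \<forall>y\<in>V. y \<^bold>\<in> p \<longleftrightarrow> (\<forall>z\<in>V. z \<^bold>\<in> y \<longrightarrow> z \<^bold>\<in> x)"
    using ZFC unfolding models_ZFC_def by (elim conjE)
  then obtain p where p: "p \<in> V" "\<forall>y\<in>V. y \<^bold>\<in> p \<longleftrightarrow> (\<forall>z\<in>V. z \<^bold>\<in> y \<longrightarrow> z \<^bold>\<in> x)"
    using assms by blast
  have "elts p = {y \<in> V. elts y \<subseteq> elts x}"
  proof (intro set_eqI iffI)
    fix y assume "y \<in> elts p"
    then have y: "y \<^bold>\<in> p" by simp
    then have "y \<in> V" using p(1) model_trans by blast
    then show "y \<in> {y \<in> V. elts y \<subseteq> elts x}" using p y \<open>y \<in> V\<close> elts_subset[OF \<open>y \<in> V\<close>] by auto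
  qed (use p in auto)
  then show ?thesis using \<open>p \<in> V\<close> unfolding vset_def by blast
qed

lemma ex_in_V: "\<exists>z. z \<in> V"
proof -
  have "\<exists>w\<in>V. (\<exists>z\<in>V. z \<^bold>\<in> w \<and> (\<forall>y\<in>V. \<not> y \<^bold>\<in> z)) \<and>
        (\<forall>x\<in>V. x \<^bold>\<in> w \<longrightarrow> (\<exists>s\<in>V. s \<^bold>\<in> w \<and> (\<forall>y\<in>V. y \<^bold>\<in> s \<longleftrightarrow> y \<^bold>\<in> x \<or> y = x)))"
    using ZFC unfolding models_ZFC_def by (elim conjE)
  then show ?thesis by blast
qed


section \<open>Definable predicates\<close>

lemma range_case_nat [simp]: "range (case_nat x e) \<subseteq> S \<longleftrightarrow> x \<in> S \<and> range e \<subseteq> S"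
  by (auto simp: subset_eq split: nat.splits)

text \<open>Even variables carry the arguments of a definable predicate, odd variables its parameters.\<close>

definition interleave :: "(nat \<Rightarrow> 'u) \<Rightarrow> (nat \<Rightarrow> 'u) \<Rightarrow> nat \<Rightarrow> 'u" where
  "interleave e c i = (if even i then e (i div 2) else c (i div 2))"

lemma interleave_simps [simp]: "interleave e c (2 * i) = e i" "interleave e c (Suc (2 * i)) = c i"
  "interleave e c 0 = e 0" "interleave e c (Suc 0) = c 0"
  by (auto simp: interleave_def)

lemma range_interleave: "range e \<subseteq> S \<Longrightarrow> range c \<subseteq> S \<Longrightarrow> range (interleave e c) \<subseteq> S"
  by (auto simp: interleave_def)

text \<open>Definability over V with parameters, for HOL predicates on environments. Binders follow
  de Bruijn: \<open>e 0\<close> is the innermost variable and the shifted e is the surrounding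
  environment. Hiding the parameters in the existential keeps the closure rules free of
  bookkeeping.\<close>

definition definable :: "((nat \<Rightarrow> 'u) \<Rightarrow> bool) \<Rightarrow> bool" where
  "definable P \<longleftrightarrow> (\<exists>\<phi> c. range c \<subseteq> V \<and> (\<forall>e. range e \<subseteq> V \<longrightarrow> (P e \<longleftrightarrow> fsat V \<phi> (interleave e c))))"

lemma definableE:
  assumes "definable P"
  obtains \<phi> c where "range c \<subseteq> V" "\<forall>e. range e \<subseteq> V \<longrightarrow> (P e \<longleftrightarrow> fsat V \<phi> (interleave e c))"
  using assms unfolding definable_def by blast

lemma definable_cong: "(\<And>e. range e \<subseteq> V \<Longrightarrow> P e \<longleftrightarrow> Q e) \<Longrightarrow> definable P \<longleftrightarrow> definable Q"
  unfolding definable_def by (intro ex_cong1 conj_cong refl all_cong) auto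

lemma definable_reindex:
  assumes "definable P" shows "definable (\<lambda>e. P (\<lambda>i. e (h i)))"
proof -
  obtain \<phi> c where c: "range c \<subseteq> V" "\<forall>e. range e \<subseteq> V \<longrightarrow> (P e \<longleftrightarrow> fsat V \<phi> (interleave e c))"
    using assms by (rule definableE)
  define f where "f = (\<lambda>i. if even i then 2 * h (i div 2) else i)"
  have "P (\<lambda>i. e (h i)) \<longleftrightarrow> fsat V (rename_fm \<phi> f) (interleave e c)" if "range e \<subseteq> V" for e
  proof -
    have "(\<lambda>i. interleave e c (f i)) = interleave (\<lambda>i. e (h i)) c"
      by (auto simp: fun_eq_iff f_def interleave_def)
    then show ?thesis using c(2)[rule_format, of "\<lambda>i. e (h i)"] that by (auto simp: fsat_rename_fm)
  qed
  then show ?thesis unfolding definable_def using c(1) by blast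
qed

lemma definable_shift: "definable P \<Longrightarrow> definable (\<lambda>e. P (\<lambda>i. e (Suc i)))"
  by (rule definable_reindex)

lemma definable_not: assumes "definable P" shows "definable (\<lambda>e. \<not> P e)"
proof -
  obtain \<phi> c where c: "range c \<subseteq> V" "\<forall>e. range e \<subseteq> V \<longrightarrow> (P e \<longleftrightarrow> fsat V \<phi> (interleave e c))"
    using assms by (rule definableE)
  then have "\<forall>e. range e \<subseteq> V \<longrightarrow> (\<not> P e \<longleftrightarrow> fsat V (FNot \<phi>) (interleave e c))" by simp
  then show ?thesis using c(1) unfolding definable_def by blast
qed

lemma definable_conj: assumes "definable P" "definable Q" shows "definable (\<lambda>e. P e \<and> Q e)"
proof -
  obtain \<phi> c where c: "range c \<subseteq> V" "\<forall>e. range e \<subseteq> V \<longrightarrow> (P e \<longleftrightarrow> fsat V \<phi> (interleave e c))"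
    using assms(1) by (rule definableE)
  obtain \<psi> d where d: "range d \<subseteq> V" "\<forall>e. range e \<subseteq> V \<longrightarrow> (Q e \<longleftrightarrow> fsat V \<psi> (interleave e d))"
    using assms(2) by (rule definableE)
  \<comment> \<open>Two parameter sequences become one by interleaving: f redirects the parameters
    of the first formula to the even entries of the merged sequence, g those of the second to the
    odd entries.\<close>
  define f where "f = (\<lambda>i::nat. if even i then i else 2 * (2 * (i div 2)) + 1)"
  define g where "g = (\<lambda>i::nat. if even i then i else 2 * (2 * (i div 2) + 1) + 1)"
  have "P e \<and> Q e \<longleftrightarrow> fsat V (FAnd (rename_fm \<phi> f) (rename_fm \<psi> g)) (interleave e (interleave c d))" if "range e \<subseteq> V" for e
  proof -
    have "(\<lambda>i. interleave e (interleave c d) (f i)) = interleave e c" "(\<lambda>i. interleave e (interleave c d) (g i)) = interleave e d"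
      by (auto simp: fun_eq_iff f_def g_def interleave_def elim!: evenE oddE)
    then show ?thesis using c(2)[rule_format, OF that] d(2)[rule_format, OF that] by (simp add: fsat_rename_fm)
  qed
  moreover have "range (interleave c d) \<subseteq> V" using c(1) d(1) by (auto simp: interleave_def)
  ultimately show ?thesis unfolding definable_def by blast
qed

lemma definable_all:
  assumes "definable (\<lambda>e. P (\<lambda>i. e (Suc i)) (e 0))" shows "definable (\<lambda>e. \<forall>x\<in>V. P e x)"
proof -
  obtain \<phi> c where c: "range c \<subseteq> V"
      "\<forall>e. range e \<subseteq> V \<longrightarrow> (P (\<lambda>i. e (Suc i)) (e 0) \<longleftrightarrow> fsat V \<phi> (interleave e c))"
    using assms by (rule definableE)
  \<comment> \<open>The quantifier will bind variable 1, the place of parameter 0. The parameters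
    move up by one, and \<open>c 0\<close> merely fills the place that the quantifier
    overwrites.\<close>
  define d where "d = case_nat (c 0) c"
  define f where "f = (\<lambda>i::nat. if i = 0 then 1 else if even i then i - 2 else i + 2)"
  have "(\<forall>x\<in>V. P e x) \<longleftrightarrow> fsat V (FAll 1 (rename_fm \<phi> f)) (interleave e d)" if "range e \<subseteq> V" for e
  proof -
    have "P e x \<longleftrightarrow> fsat V (rename_fm \<phi> f) ((interleave e d)(1 := x))" if "x \<in> V" for x
    proof -
      have "(\<lambda>i. ((interleave e d)(1 := x)) (f i)) = interleave (case_nat x e) c"
        by (rule ext) (auto simp: f_def d_def interleave_def elim!: evenE oddE split: nat.splits)
      moreover have "P e x \<longleftrightarrow> fsat V \<phi> (interleave (case_nat x e) c)"
        using c(2)[rule_format, of "case_nat x e"] that \<open>range e \<subseteq> V\<close> by simp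
      ultimately show ?thesis by (simp add: fsat_rename_fm)
    qed
    then show ?thesis by simp
  qed
  moreover have "range d \<subseteq> V" using c(1) by (auto simp: d_def split: nat.splits)
  ultimately show ?thesis unfolding definable_def by blast
qed

lemma definable_mem_var: "definable (\<lambda>e. e i \<^bold>\<in> e j)"
proof -
  obtain z where "z \<in> V" using ex_in_V by blast
  then have "range (\<lambda>i::nat. z) \<subseteq> V" by auto
  moreover have "\<forall>e. range e \<subseteq> V \<longrightarrow> (e i \<^bold>\<in> e j \<longleftrightarrow> fsat V (FMem (2*i) (2*j)) (interleave e (\<lambda>i. z)))" by simp
  ultimately show ?thesis unfolding definable_def by blast
qed

lemma definable_eq_var: "definable (\<lambda>e. e i = e j)"
proof -
  obtain z where "z \<in> V" using ex_in_V by blast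
  then have "range (\<lambda>i::nat. z) \<subseteq> V" by auto
  moreover have "\<forall>e. range e \<subseteq> V \<longrightarrow> (e i = e j \<longleftrightarrow> fsat V (FEq (2*i) (2*j)) (interleave e (\<lambda>i. z)))" by simp
  ultimately show ?thesis unfolding definable_def by blast
qed

lemma definable_eq_const: "c \<in> V \<Longrightarrow> definable (\<lambda>e. e i = c)"
  unfolding definable_def
  by (rule exI[of _ "FEq (2*i) 1"], rule exI[of _ "\<lambda>_. c"]) auto

lemma definable_bool: "definable (\<lambda>e. b)"
proof (cases b)
  case True
  show ?thesis by (rule definable_cong[THEN iffD1, OF _ definable_eq_var[of 0 0]]) (simp add: True)
next
  case False
  show ?thesis by (rule definable_cong[THEN iffD1, OF _ definable_not[OF definable_eq_var[of 0 0]]]) (simp add: False)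
qed

lemma definable_disj: assumes "definable P" "definable Q" shows "definable (\<lambda>e. P e \<or> Q e)"
  using definable_not[OF definable_conj[OF definable_not[OF assms(1)] definable_not[OF assms(2)]]] by simp

lemma definable_imp: assumes "definable P" "definable Q" shows "definable (\<lambda>e. P e \<longrightarrow> Q e)"
  using definable_disj[OF definable_not[OF assms(1)] assms(2)] by (simp only: imp_conv_disj)

lemma definable_iff: assumes "definable P" "definable Q" shows "definable (\<lambda>e. P e \<longleftrightarrow> Q e)"
  using definable_conj[OF definable_imp[OF assms] definable_imp[OF assms(2,1)]] by (simp only: iff_conv_conj_imp)

lemma definable_ex:
  assumes "definable (\<lambda>e. P (\<lambda>i. e (Suc i)) (e 0))" shows "definable (\<lambda>e. \<exists>x\<in>V. P e x)"
  using definable_not[OF definable_all[of "\<lambda>e x. \<not> P e x", OF definable_not[OF assms]]] by simp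


text \<open>The language has no function symbols. A term is replaced by a class function of the
  environment that stays in V and whose graph is definable.\<close>

definition dterm :: "((nat \<Rightarrow> 'u) \<Rightarrow> 'u) \<Rightarrow> bool" where
  "dterm t \<longleftrightarrow> (\<forall>e. range e \<subseteq> V \<longrightarrow> t e \<in> V) \<and> definable (\<lambda>e. e 0 = t (\<lambda>i. e (Suc i)))"

lemma dterm_in_V: "dterm t \<Longrightarrow> range e \<subseteq> V \<Longrightarrow> t e \<in> V"
  unfolding dterm_def by blast

lemma dterm_var: "dterm (\<lambda>e. e i)"
  unfolding dterm_def by (auto intro: definable_eq_var)

lemma dterm_const: "c \<in> V \<Longrightarrow> dterm (\<lambda>e. c)"
  unfolding dterm_def by (auto intro: definable_eq_const)

text \<open>The value of the term is quantified over V and pinned down by its graph.\<close>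

lemma definable_subst:
  assumes t: "dterm t" and P: "definable (\<lambda>e. P (\<lambda>i. e (Suc i)) (e 0))"
  shows "definable (\<lambda>e. P e (t e))"
proof -
  have "definable (\<lambda>e. \<exists>x\<in>V. x = t e \<and> P e x)"
    by (rule definable_ex, rule definable_conj[OF _ P]) (use t in \<open>simp add: dterm_def\<close>)
  then show ?thesis
    by (rule definable_cong[THEN iffD1, rotated]) (use t dterm_in_V in blast)
qed

lemma dterm_reindex: assumes "dterm t" shows "dterm (\<lambda>e. t (\<lambda>i. e (h i)))"
proof -
  have "definable (\<lambda>e. e 0 = t (\<lambda>i. e (Suc i)))" using assms unfolding dterm_def by blast
  then have "definable (\<lambda>e. e (case_nat 0 (\<lambda>i. Suc (h i)) 0) = t (\<lambda>i. e (case_nat 0 (\<lambda>i. Suc (h i)) (Suc i))))"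
    by (rule definable_reindex)
  moreover have "t (\<lambda>i. e (h i)) \<in> V" if "range e \<subseteq> V" for e
    using that by (intro dterm_in_V[OF assms]) auto
  ultimately show ?thesis unfolding dterm_def by simp
qed

text \<open>The composition rules allow a defined notion to be unfolded once, at variables, and then
  to be used at arbitrary terms.\<close>

lemma definable_comp1: assumes "definable (\<lambda>e. Q (e 0))" "dterm t" shows "definable (\<lambda>e. Q (t e))"
  by (rule definable_subst[OF assms(2)]) (rule assms(1))

lemma definable_comp2: assumes "definable (\<lambda>e. Q (e 0) (e 1))" "dterm t" "dterm s" shows "definable (\<lambda>e. Q (t e) (s e))"
proof -
  have "definable (\<lambda>e. Q (t (\<lambda>i. e (Suc i))) (e 0))"
    by (rule definable_subst[where t = "\<lambda>e. t (\<lambda>i. e (Suc i))" and P = "\<lambda>e x. Q x (e 0)"])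
      (use dterm_reindex[OF assms(2)] assms(1) in simp_all)
  then show ?thesis
    by (rule definable_subst[where P = "\<lambda>e x. Q (t e) x", OF assms(3)])
qed

lemma definable_comp3:
  assumes "definable (\<lambda>e. Q (e 0) (e 1) (e 2))" "dterm t" "dterm s" "dterm r"
  shows "definable (\<lambda>e. Q (t e) (s e) (r e))"
proof -
  have "definable (\<lambda>e. Q (t (\<lambda>i. e (Suc (Suc i)))) (e (Suc 0)) (e 0))"
    by (rule definable_subst[where t = "\<lambda>e. t (\<lambda>i. e (Suc (Suc i)))" and P = "\<lambda>e x. Q x (e (Suc 0)) (e 0)"])
      (use dterm_reindex[OF assms(2)] definable_reindex[OF assms(1), of "case_nat 0 (case_nat 2 (\<lambda>_. 1))"]
        in \<open>simp_all add: numeral_2_eq_2\<close>)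
  then have "definable (\<lambda>e. Q (t (\<lambda>i. e (Suc i))) (s (\<lambda>i. e (Suc i))) (e 0))"
  proof -
    assume *: "definable (\<lambda>e. Q (t (\<lambda>i. e (Suc (Suc i)))) (e (Suc 0)) (e 0))"
    show ?thesis
      by (rule definable_subst[where t = "\<lambda>e. s (\<lambda>i. e (Suc i))"
            and P = "\<lambda>e x. Q (t (\<lambda>i. e (Suc i))) x (e 0)"])
        (use dterm_reindex[OF assms(3)] definable_reindex[OF *, of "case_nat (Suc 0) (case_nat 0 (\<lambda>i. Suc (Suc i)))"]
          in simp_all)
  qed
  then show ?thesis
    by (rule definable_subst[where P = "\<lambda>e x. Q (t e) (s e) x", OF assms(4)])
qed

lemma dterm_comp1: assumes "dterm (\<lambda>e. f (e 0))" "dterm t" shows "dterm (\<lambda>e. f (t e))"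
proof -
  have "definable (\<lambda>e. e 0 = f (e 1))" using assms(1) unfolding dterm_def by simp
  then have "definable (\<lambda>e. e 0 = f (t (\<lambda>i. e (Suc i))))"
    by (rule definable_comp2[OF _ dterm_var dterm_reindex[OF assms(2)]])
  moreover have "f (t e) \<in> V" if "range e \<subseteq> V" for e
    using dterm_in_V[OF assms(1), of "\<lambda>_. t e"] dterm_in_V[OF assms(2) that] by auto
  ultimately show ?thesis unfolding dterm_def by blast
qed

lemma dterm_comp2: assumes "dterm (\<lambda>e. f (e 0) (e 1))" "dterm t" "dterm s" shows "dterm (\<lambda>e. f (t e) (s e))"
proof -
  have "definable (\<lambda>e. e 0 = f (e 1) (e 2))" using assms(1) unfolding dterm_def by (simp add: numeral_2_eq_2)
  then have "definable (\<lambda>e. e 0 = f (t (\<lambda>i. e (Suc i))) (s (\<lambda>i. e (Suc i))))"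
    by (rule definable_comp3[OF _ dterm_var dterm_reindex[OF assms(2)] dterm_reindex[OF assms(3)]])
  moreover have "f (t e) (s e) \<in> V" if "range e \<subseteq> V" for e
    using dterm_in_V[OF assms(1), of "case_nat (t e) (\<lambda>_. s e)"] dterm_in_V[OF assms(2) that]
      dterm_in_V[OF assms(3) that] by simp
  ultimately show ?thesis unfolding dterm_def by blast
qed

lemma definable_mem: "dterm t \<Longrightarrow> dterm s \<Longrightarrow> definable (\<lambda>e. t e \<^bold>\<in> s e)"
  by (rule definable_comp2[where Q = "(\<^bold>\<in>)", OF definable_mem_var])

lemma definable_mem_elts: "dterm t \<Longrightarrow> dterm s \<Longrightarrow> definable (\<lambda>e. t e \<in> elts (s e))"
  unfolding mem_elts by (rule definable_mem)

lemma definable_eq: "dterm t \<Longrightarrow> dterm s \<Longrightarrow> definable (\<lambda>e. t e = s e)"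
  by (rule definable_comp2[where Q = "(=)", OF definable_eq_var])

lemma definable_in_V: "dterm t \<Longrightarrow> definable (\<lambda>e. t e \<in> V)"
  by (rule definable_cong[THEN iffD1, OF _ definable_bool[of True]]) (use dterm_in_V in auto)

lemma definable_ball:
  assumes t: "dterm t" and P: "definable (\<lambda>e. P (\<lambda>i. e (Suc i)) (e 0))"
  shows "definable (\<lambda>e. \<forall>x\<in>elts (t e). P e x)"
proof -
  have "definable (\<lambda>e. \<forall>x\<in>V. x \<^bold>\<in> t e \<longrightarrow> P e x)"
    by (intro definable_all definable_imp P definable_mem dterm_var) (rule dterm_reindex[OF t])
  then show ?thesis
  proof (rule definable_cong[THEN iffD1, rotated])
    fix e :: "nat \<Rightarrow> 'u" assume "range e \<subseteq> V"
    then have "x \<in> V" if "x \<^bold>\<in> t e" for x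
      using that model_trans dterm_in_V[OF t] by blast
    then show "(\<forall>x\<in>V. x \<^bold>\<in> t e \<longrightarrow> P e x) \<longleftrightarrow> (\<forall>x\<in>elts (t e). P e x)"
      by auto
  qed
qed

lemma definable_bex:
  assumes t: "dterm t" and P: "definable (\<lambda>e. P (\<lambda>i. e (Suc i)) (e 0))"
  shows "definable (\<lambda>e. \<exists>x\<in>elts (t e). P e x)"
  using definable_not[OF definable_ball[OF t, of "\<lambda>e x. \<not> P e x", OF definable_not[OF P]]] by simp

lemma definable_subset:
  assumes t: "dterm t" and s: "dterm s" shows "definable (\<lambda>e. elts (t e) \<subseteq> elts (s e))"
  unfolding subset_eq
  by (rule definable_ball[OF t], rule definable_mem_elts[OF dterm_var dterm_reindex[OF s]])

text \<open>V is transitive, so the members of the left-hand side and of S all lie in V, and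
  equality with \<open>the_set\<close> becomes one quantifier over V.\<close>

lemma dterm_the_set:
  assumes "\<And>e. range e \<subseteq> V \<Longrightarrow> vset (S e)" and "definable (\<lambda>e. e 0 \<in> S (\<lambda>i. e (Suc i)))"
  shows "dterm (\<lambda>e. the_set (S e))"
proof -
  have "definable (\<lambda>e. \<forall>z\<in>V. z \<^bold>\<in> e 0 \<longleftrightarrow> z \<in> S (\<lambda>i. e (Suc i)))"
  proof (intro definable_all definable_iff definable_mem dterm_var)
    show "definable (\<lambda>e. e 0 \<in> S (\<lambda>i. e (Suc (Suc i))))"
      using definable_reindex[OF assms(2), of "case_nat 0 (\<lambda>i. Suc (Suc i))"] by simp
  qed
  then have "definable (\<lambda>e. e 0 = the_set (S (\<lambda>i. e (Suc i))))"
  proof (rule definable_cong[THEN iffD1, rotated])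
    fix e :: "nat \<Rightarrow> 'u" assume e: "range e \<subseteq> V"
    then have v: "vset (S (\<lambda>i. e (Suc i)))" by (intro assms(1)) auto
    have "e 0 = the_set (S (\<lambda>i. e (Suc i))) \<longleftrightarrow> elts (e 0) = S (\<lambda>i. e (Suc i))"
      using v by (metis the_set_elts vset_elts_the_set)
    also have "\<dots> \<longleftrightarrow> (\<forall>z\<in>V. z \<^bold>\<in> e 0 \<longleftrightarrow> z \<in> S (\<lambda>i. e (Suc i)))"
      using vset_subset[OF v] elts_subset[of "e 0"] e unfolding set_eq_iff mem_elts
      by (metis mem_elts rangeI subsetD)
    finally show "(\<forall>z\<in>V. z \<^bold>\<in> e 0 \<longleftrightarrow> z \<in> S (\<lambda>i. e (Suc i))) \<longleftrightarrow> e 0 = the_set (S (\<lambda>i. e (Suc i)))"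
      by simp
  qed
  then show ?thesis unfolding dterm_def using assms(1) vset_in_V by blast
qed

section \<open>Separation and Replacement for definable predicates\<close>

lemma separation:
  assumes P: "definable P" and e: "range e \<subseteq> V" and A: "vset A"
  shows "vset {x \<in> A. P (case_nat x e)}"
proof -
  obtain a where a: "a \<in> V" "elts a = A" using A unfolding vset_def by blast
  obtain \<phi> c where c: "range c \<subseteq> V" "\<forall>e. range e \<subseteq> V \<longrightarrow> (P e \<longleftrightarrow> fsat V \<phi> (interleave e c))"
    using P by (rule definableE)
  \<comment> \<open>The axiom overwrites variable 0, which is argument 0 of the interleaving; a only
    holds that place.\<close>
  define e' where "e' = interleave (case_nat a e) c"
  have e': "range e' \<subseteq> V" unfolding e'_def using a(1) c(1) e by (simp add: range_interleave)
  have "\<forall>\<phi> e. range e \<subseteq> V \<longrightarrow>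
        (\<forall>a\<in>V. \<exists>b\<in>V. \<forall>x\<in>V. x \<^bold>\<in> b \<longleftrightarrow> x \<^bold>\<in> a \<and> fsat V \<phi> (e(0 := x)))"
    using ZFC unfolding models_ZFC_def by (elim conjE)
  from this[rule_format, OF e' a(1)]
  obtain b where b: "b \<in> V" "\<forall>x\<in>V. x \<^bold>\<in> b \<longleftrightarrow> x \<^bold>\<in> a \<and> fsat V \<phi> (e'(0 := x))"
    by blast
  have "fsat V \<phi> (e'(0 := x)) \<longleftrightarrow> P (case_nat x e)" if "x \<in> V" for x
  proof -
    have "e'(0 := x) = interleave (case_nat x e) c"
      unfolding e'_def by (auto simp: fun_eq_iff interleave_def elim!: evenE split: nat.splits)
    then show ?thesis using c(2)[rule_format, of "case_nat x e"] that e by simp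
  qed
  then have "elts b = {x \<in> A. P (case_nat x e)}"
    using b(2) a(2) elts_subset[OF b(1)] elts_subset[OF a(1)] by auto
  then show ?thesis using b(1) unfolding vset_def by blast
qed

lemma replacement:
  assumes P: "definable P" and e: "range e \<subseteq> V" and A: "vset A"
    and f: "\<And>x y z. x \<in> A \<Longrightarrow> y \<in> V \<Longrightarrow> z \<in> V \<Longrightarrow> P (case_nat y (case_nat x e)) \<Longrightarrow>
      P (case_nat z (case_nat x e)) \<Longrightarrow> y = z"
  shows "vset {y \<in> V. \<exists>x\<in>A. P (case_nat y (case_nat x e))}"
proof -
  obtain a where a: "a \<in> V" "elts a = A" using A unfolding vset_def by blast
  obtain \<phi> c where c: "range c \<subseteq> V" "\<forall>e. range e \<subseteq> V \<longrightarrow> (P e \<longleftrightarrow> fsat V \<phi> (interleave e c))"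
    using P by (rule definableE)
  \<comment> \<open>The axiom overwrites variables 0 and 1, so everything else is shifted up by two
    behind placeholders. The renaming sends argument 0, the value y, to variable 1 and argument 1,
    the point x, to variable 0.\<close>
  define e' where "e' = case_nat a (case_nat a (interleave (case_nat a (case_nat a e)) c))"
  have e': "range e' \<subseteq> V" unfolding e'_def using a(1) c(1) e by (simp add: range_interleave)
  define f where "f = (\<lambda>i::nat. if i = 0 then 1 else if i = 2 then 0 else i + 2)"
  have *: "fsat V (rename_fm \<phi> f) (e'(0 := x, 1 := y)) \<longleftrightarrow> P (case_nat y (case_nat x e))"
    if "x \<in> V" "y \<in> V" for x y
  proof -
    have "(e'(0 := x, 1 := y)) (f i) = interleave (case_nat y (case_nat x e)) c i" for i
    proof -
      consider j where "i = 2 * j" | j where "i = 2 * j + 1" by (metis evenE oddE)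
      then show ?thesis by cases (auto simp: f_def interleave_def e'_def split: nat.splits)
    qed
    then show ?thesis
      using c(2)[rule_format, of "case_nat y (case_nat x e)"] that e by (simp add: fsat_rename_fm)
  qed
  have "\<forall>\<phi> e. range e \<subseteq> V \<longrightarrow> (\<forall>a\<in>V. (\<forall>x\<in>V. x \<^bold>\<in> a \<longrightarrow> (\<forall>y\<in>V. \<forall>z\<in>V.
             fsat V \<phi> (e(0 := x, 1 := y)) \<and> fsat V \<phi> (e(0 := x, 1 := z)) \<longrightarrow> y = z)) \<longrightarrow>
           (\<exists>b\<in>V. \<forall>y\<in>V. y \<^bold>\<in> b \<longleftrightarrow> (\<exists>x\<in>V. x \<^bold>\<in> a \<and> fsat V \<phi> (e(0 := x, 1 := y)))))"
    using ZFC unfolding models_ZFC_def by (elim conjE)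
  from this[rule_format, OF e' a(1), of "rename_fm \<phi> f"]
  have "\<exists>b\<in>V. \<forall>y\<in>V. y \<^bold>\<in> b \<longleftrightarrow> (\<exists>x\<in>V. x \<^bold>\<in> a \<and> fsat V (rename_fm \<phi> f) (e'(0 := x, 1 := y)))"
    using * assms(4) a(2) elts_subset[OF a(1)] by auto
  then obtain b where b: "b \<in> V"
      "\<forall>y\<in>V. y \<^bold>\<in> b \<longleftrightarrow> (\<exists>x\<in>V. x \<^bold>\<in> a \<and> P (case_nat y (case_nat x e)))"
    using * by auto
  then have "elts b = {y \<in> V. \<exists>x\<in>A. P (case_nat y (case_nat x e))}"
    using b(2) a(2) elts_subset[OF b(1)] elts_subset[OF a(1)] unfolding mem_elts[symmetric] by blast
  then show ?thesis using b(1) unfolding vset_def by blast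
qed

lemma vset_sep:
  assumes "definable (\<lambda>e. P (e 0))" "vset A" shows "vset {x \<in> A. P x}"
proof -
  obtain z where "z \<in> V" using ex_in_V by blast
  then show ?thesis using separation[OF assms(1) _ assms(2), of "\<lambda>_. z"] by simp
qed

lemma vset_repl:
  assumes "definable (\<lambda>e. P (e (Suc 0)) (e 0))" "vset A"
    and f: "\<And>x y z. x \<in> A \<Longrightarrow> y \<in> V \<Longrightarrow> z \<in> V \<Longrightarrow> P x y \<Longrightarrow> P x z \<Longrightarrow> y = z"
  shows "vset {y \<in> V. \<exists>x\<in>A. P x y}"
proof -
  obtain z where "z \<in> V" using ex_in_V by blast
  then have "vset {y \<in> V. \<exists>x\<in>A. P (case_nat y (case_nat x (\<lambda>_. z)) (Suc 0)) (case_nat y (case_nat x (\<lambda>_. z)) 0)}"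
    by (intro replacement[OF assms(1) _ assms(2)]) (auto intro: f)
  then show ?thesis by simp
qed

lemma vset_image_env:
  assumes s: "dterm (\<lambda>e. s (\<lambda>i. e (Suc i)) (e 0))" and e: "range e \<subseteq> V" and A: "vset A"
  shows "vset (s e ` A)"
proof -
  have d: "definable (\<lambda>e. e 0 = s (\<lambda>i. e (Suc (Suc i))) (e (Suc 0)))"
    using s unfolding dterm_def by simp
  have "s e x \<in> V" if "x \<in> V" for x
    using dterm_in_V[OF s, of "case_nat x e"] that e by simp
  then have "{y \<in> V. \<exists>x\<in>A. y = s e x} = s e ` A" using vset_subset[OF A] by auto
  moreover have "vset {y \<in> V. \<exists>x\<in>A. y = s e x}" using replacement[OF d e A] by simp
  ultimately show ?thesis by simp
qed

lemma dterm_sep: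
  assumes t: "dterm t" and P: "definable (\<lambda>e. P (\<lambda>i. e (Suc i)) (e 0))"
  shows "dterm (\<lambda>e. the_set {x \<in> elts (t e). P e x})"
proof (rule dterm_the_set)
  fix e :: "nat \<Rightarrow> 'u" assume "range e \<subseteq> V"
  then show "vset {x \<in> elts (t e). P e x}"
    using separation[OF P _ vset_elts[OF dterm_in_V[OF t]]] by simp
next
  show "definable (\<lambda>e. e 0 \<in> {x \<in> elts (t (\<lambda>i. e (Suc i))). P (\<lambda>i. e (Suc i)) x})"
    using definable_conj[OF definable_mem[OF dterm_var dterm_reindex[OF t]] P] by simp
qed

lemma dterm_image:
  assumes t: "dterm t" and s: "dterm (\<lambda>e. s (\<lambda>i. e (Suc i)) (e 0))"
  shows "dterm (\<lambda>e. the_set (s e ` elts (t e)))"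
proof (rule dterm_the_set)
  have d: "definable (\<lambda>e. e 0 = s (\<lambda>i. e (Suc (Suc i))) (e (Suc 0)))"
    using s unfolding dterm_def by simp
  show "vset (s e ` elts (t e))" if e: "range e \<subseteq> V" for e
    by (intro vset_image_env[OF s e] vset_elts dterm_in_V[OF t e])
  have "definable (\<lambda>e. \<exists>x\<in>elts (t (\<lambda>i. e (Suc i))). e 0 = s (\<lambda>i. e (Suc i)) x)"
  proof (rule definable_bex[OF dterm_reindex[OF t]])
    show "definable (\<lambda>e. e (Suc 0) = s (\<lambda>i. e (Suc (Suc i))) (e 0))"
      using definable_reindex[OF d, of "case_nat (Suc 0) (case_nat 0 (\<lambda>i. Suc (Suc i)))"] by simp
  qed
  then show "definable (\<lambda>e. e 0 \<in> s (\<lambda>i. e (Suc i)) ` elts (t (\<lambda>i. e (Suc i))))"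
    by (simp add: image_iff)
qed

lemma dterm_UN:
  assumes t: "dterm t" and s: "dterm (\<lambda>e. s (\<lambda>i. e (Suc i)) (e 0))"
  shows "dterm (\<lambda>e. the_set (\<Union>x\<in>elts (t e). elts (s e x)))"
proof (rule dterm_the_set)
  show "vset (\<Union>x\<in>elts (t e). elts (s e x))" if e: "range e \<subseteq> V" for e
  proof -
    have v: "vset (s e ` elts (t e))"
      by (intro vset_image_env[OF s e] vset_elts dterm_in_V[OF t e])
    have "vset (\<Union>y\<in>elts (the_set (s e ` elts (t e))). elts y)"
      by (intro vset_Union vset_in_V v)
    then show ?thesis using v by simp
  qed
  have "definable (\<lambda>e. \<exists>x\<in>elts (t (\<lambda>i. e (Suc i))). e 0 \<^bold>\<in> s (\<lambda>i. e (Suc i)) x)"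
  proof (rule definable_bex[OF dterm_reindex[OF t]])
    show "definable (\<lambda>e. e (Suc 0) \<^bold>\<in> s (\<lambda>i. e (Suc (Suc i))) (e 0))"
      using definable_mem[OF dterm_var dterm_reindex[OF s, of "case_nat 0 (\<lambda>i. Suc (Suc i))"]] by simp
  qed
  then show "definable (\<lambda>e. e 0 \<in> (\<Union>x\<in>elts (t (\<lambda>i. e (Suc i))). elts (s (\<lambda>i. e (Suc i)) x)))"
    by simp
qed

lemma dterm_Pow:
  assumes t: "dterm t" shows "dterm (\<lambda>e. the_set {y \<in> V. elts y \<subseteq> elts (t e)})"
  by (rule dterm_the_set)
    (auto intro!: vset_Pow dterm_in_V[OF t] definable_conj definable_in_V dterm_var definable_subset dterm_reindex[OF t])

lemma dterm_upair:
  assumes t: "dterm t" and s: "dterm s" shows "dterm (\<lambda>e. the_set {t e, s e})"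
  by (rule dterm_the_set)
    (auto intro!: vset_upair dterm_in_V[OF t] dterm_in_V[OF s] definable_disj definable_eq dterm_var dterm_reindex[OF t] dterm_reindex[OF s])

lemma dterm_sing: "dterm t \<Longrightarrow> dterm (\<lambda>e. the_set {t e})"
  using dterm_upair[of t t] by simp

lemma dterm_pair: "dterm t \<Longrightarrow> dterm s \<Longrightarrow> dterm (\<lambda>e. pair (t e) (s e))"
  unfolding pair_def by (intro dterm_upair dterm_sing)

lemma dterm_Un:
  assumes t: "dterm t" and s: "dterm s" shows "dterm (\<lambda>e. the_set (elts (t e) \<union> elts (s e)))"
  by (rule dterm_the_set)
    (auto intro!: vset_Un vset_elts dterm_in_V[OF t] dterm_in_V[OF s] definable_disj definable_mem dterm_var dterm_reindex[OF t] dterm_reindex[OF s])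

lemma dterm_Diff:
  assumes t: "dterm t" and s: "dterm s" shows "dterm (\<lambda>e. the_set (elts (t e) - elts (s e)))"
proof -
  have "dterm (\<lambda>e. the_set {x \<in> elts (t e). \<not> x \<^bold>\<in> s e})"
    by (intro dterm_sep t definable_not definable_mem dterm_var dterm_reindex[OF s])
  then show ?thesis by (simp add: set_diff_eq)
qed

lemma dterm_If:
  assumes "definable P" and t: "dterm t" and s: "dterm s" shows "dterm (\<lambda>e. if P e then t e else s e)"
  unfolding dterm_def
proof (intro conjI allI impI)
  show "definable (\<lambda>e. e 0 = (if P (\<lambda>i. e (Suc i)) then t (\<lambda>i. e (Suc i)) else s (\<lambda>i. e (Suc i))))"
    unfolding if_split[of "\<lambda>x. _ = x"]
    by (intro definable_conj definable_imp definable_not definable_shift assms(1) definable_eq dterm_var dterm_reindex[OF t] dterm_reindex[OF s])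
qed (use dterm_in_V[OF t] dterm_in_V[OF s] in auto)

text \<open>With these rules \<open>intro\<close> follows a HOL expression and leaves only the
  claims that its parameters lie in V. Most later proofs that a set belongs to V rest on
  them.\<close>

lemmas definable_intros = definable_conj definable_disj definable_imp definable_iff definable_not definable_ball definable_bex definable_all definable_ex
  definable_mem definable_mem_elts definable_eq definable_in_V definable_subset definable_bool

lemmas dterm_intros = dterm_var dterm_const dterm_UN dterm_Un dterm_Diff dterm_upair dterm_sing dterm_pair dterm_Pow dterm_sep
  dterm_image dterm_If

end

text \<open>From here on membership in \<open>elts\<close> is the normal form, so that reasoning
  about HOL sets applies.\<close>

declare mem_elts [simp del] mem_elts [symmetric, simp]

subsection \<open>Finite ordinals, iteration and choice in the model\<close>

lemma ordinal_elem: "ordinal a \<Longrightarrow> b \<in> elts a \<Longrightarrow> ordinal b"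
  unfolding ordinal_def by blast

lemma ordinal_trans: "ordinal a \<Longrightarrow> b \<in> elts a \<Longrightarrow> c \<in> elts b \<Longrightarrow> c \<in> elts a"
  unfolding ordinal_def by blast

text \<open>If a and b were incomparable, the two induction hypotheses would put every member of
  each into the other, and extensionality would make them equal.\<close>

lemma ordinal_linear:
  fixes a b :: "'u::set_universe"
  assumes "ordinal a" "ordinal b"
  shows "a \<in> elts b \<or> a = b \<or> b \<in> elts a"
  using assms
proof (induction a arbitrary: b rule: elem_induct)
  case a: (step a)
  show ?case using a.prems(2)
  proof (induction b rule: elem_induct)
    case b: (step b)
    show ?case
    proof (rule ccontr)
      assume n: "\<not> ?thesis"
      have "x \<in> elts b" if x: "x \<in> elts a" for x
      proof -
        have "x \<in> elts b \<or> x = b \<or> b \<in> elts x"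
          using a.IH[of x b] x ordinal_elem[OF a.prems(1) x] b.prems by simp
        then show ?thesis using n x ordinal_trans[OF a.prems(1) x] by blast
      qed
      moreover have "y \<in> elts a" if y: "y \<in> elts b" for y
      proof -
        have "a \<in> elts y \<or> a = y \<or> y \<in> elts a"
          using b.IH[of y] y ordinal_elem[OF b.prems y] by simp
        then show ?thesis using n y ordinal_trans[OF b.prems y] by blast
      qed
      ultimately have "elts a = elts b" by blast
      then show False using n by (simp add: elts_inject)
    qed
  qed
qed

lemma is_fun_app:
  assumes "is_fun f A B" "x \<in> A"
  shows "pair x (app f x) \<in> elts f" "app f x \<in> B"
proof -
  have ex: "\<exists>!y. pair x y \<^bold>\<in> f" using assms unfolding is_fun_def by blast
  then have "pair x (app f x) \<^bold>\<in> f" unfolding app_def by (rule theI')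
  then show p: "pair x (app f x) \<in> elts f" by simp
  have "elts f \<subseteq> {pair x y |x y. x \<in> A \<and> y \<in> B}" using assms unfolding is_fun_def by blast
  then show "app f x \<in> B" using p by auto
qed

lemma is_fun_mem_iff:
  assumes "is_fun f A B"
  shows "pair x y \<in> elts f \<longleftrightarrow> x \<in> A \<and> y = app f x"
proof
  assume p: "pair x y \<in> elts f"
  then have x: "x \<in> A" using assms unfolding is_fun_def by auto
  then have "\<exists>!y. pair x y \<^bold>\<in> f" using assms unfolding is_fun_def by blast
  then show "x \<in> A \<and> y = app f x" using x p is_fun_app(1)[OF assms x] by auto
qed (use is_fun_app(1)[OF assms] in auto)

lemma is_fun_elts: "is_fun f A B \<Longrightarrow> elts f = (\<lambda>x. pair x (app f x)) ` A"
proof (intro set_eqI iffI)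
  fix p assume f: "is_fun f A B" and p: "p \<in> elts f"
  then obtain x y where "p = pair x y" unfolding is_fun_def by blast
  then show "p \<in> (\<lambda>x. pair x (app f x)) ` A" using p is_fun_mem_iff[OF f, of x y] by auto
qed (auto dest: is_fun_app(1))

lemma is_fun_cong: "is_fun f A B \<Longrightarrow> (\<And>x. x \<in> A \<Longrightarrow> app f x \<in> C) \<Longrightarrow> is_fun f A C"
  using is_fun_elts[of f A B] unfolding is_fun_def by auto

lemma is_fun_ext:
  assumes "is_fun f A B" "is_fun g A C" "\<And>x. x \<in> A \<Longrightarrow> app f x = app g x"
  shows "f = g"
proof -
  have "elts f = elts g" unfolding is_fun_elts[OF assms(1)] is_fun_elts[OF assms(2)]
    using assms(3) by (intro image_cong) auto
  then show ?thesis by (simp add: elts_inject)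
qed

lemma is_fun_graph:
  assumes "elts f = (\<lambda>x. pair x (s x)) ` A" "s ` A \<subseteq> B"
  shows "is_fun f A B" "\<And>x. x \<in> A \<Longrightarrow> app f x = s x"
proof -
  have *: "pair x y \<in> elts f \<longleftrightarrow> x \<in> A \<and> y = s x" for x y unfolding assms(1) by auto
  show f: "is_fun f A B" unfolding is_fun_def using assms * by auto
  show "app f x = s x" if "x \<in> A" for x
    using *[of x "s x"] is_fun_mem_iff[OF f, of x "s x"] that by auto
qed

definition suc :: "'u::set_universe \<Rightarrow> 'u" where
  "suc x = the_set (elts x \<union> elts (the_set {x}))"

text \<open>The double union of a set of Kuratowski pairs contains both components of each pair, so
  it bounds the domain and the range at once.\<close>

definition field_set :: "'u::set_universe \<Rightarrow> 'u" where
  "field_set f = the_set (\<Union>z\<in>elts (the_set (\<Union>w\<in>elts f. elts w)). elts z)"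

text \<open>Unlike \<^const>\<open>app\<close>, this is definable everywhere: off the domain it is the empty set.\<close>

definition tapp :: "'u::set_universe \<Rightarrow> 'u \<Rightarrow> 'u" where
  "tapp f x = the_set (\<Union>y\<in>elts (the_set {y \<in> elts (field_set f). pair x y \<in> elts f}). elts y)"

text \<open>Recursion of cumulative type: T sees only the union of the earlier values. HOL defines
  it on the whole universe; that it can be computed in V, along ordinals and for definable T, is
  proved later.\<close>

function orec :: "('u::set_universe \<Rightarrow> 'u) \<Rightarrow> 'u \<Rightarrow> 'u" where
  "orec T x = T (the_set (\<Union>y\<in>elts x. elts (orec T y)))"
  by pat_completeness auto
termination
proof (relation "inv_image {(y, x). y \<^bold>\<in> x} snd")
  show "wf (inv_image {(y, x). y \<^bold>\<in> x} snd)"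
    using elem_wf by (intro wf_inv_image) (simp add: wfp_def)
qed simp

declare orec.simps [simp del] num.simps [simp del]

context zfc
begin

text \<open>Lets the closure rules for terms prove that a single object lies in V.\<close>

lemma dterm_constD: "dterm (\<lambda>e. t) \<Longrightarrow> t \<in> V"
  using ex_in_V dterm_in_V[of "\<lambda>e. t"] by (metis image_subsetI)

lemma in_V_elts: "x \<in> V \<Longrightarrow> y \<in> elts x \<Longrightarrow> y \<in> V"
  using elts_subset by blast

lemma dterm_suc: "dterm t \<Longrightarrow> dterm (\<lambda>e. suc (t e))"
  unfolding suc_def by (intro dterm_Un dterm_sing)

lemma dterm_field_set: "dterm t \<Longrightarrow> dterm (\<lambda>e. field_set (t e))"
  unfolding field_set_def by (rule dterm_UN, rule dterm_UN) (auto intro: dterm_var)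

lemma dterm_tapp:
  assumes t: "dterm t" and s: "dterm s" shows "dterm (\<lambda>e. tapp (t e) (s e))"
  unfolding tapp_def
  by (intro dterm_UN dterm_sep dterm_field_set definable_mem_elts dterm_pair dterm_var t dterm_reindex[OF t] dterm_reindex[OF s])

lemmas dterm_intros' = dterm_var dterm_tapp dterm_suc dterm_field_set dterm_intros

lemma elts_field_set:
  assumes "f \<in> V" shows "elts (field_set f) = (\<Union>w\<in>elts f. \<Union>z\<in>elts w. elts z)"
proof -
  have v: "vset (\<Union>w\<in>elts f. elts w)" by (rule vset_Union[OF assms])
  show ?thesis unfolding field_set_def
    using vset_Union[OF vset_in_V[OF v]] v by auto
qed

lemma field_setI1: "f \<in> V \<Longrightarrow> pair x y \<in> elts f \<Longrightarrow> x \<in> elts (field_set f)"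
  unfolding elts_field_set by (rule UN_I, assumption) (auto simp: elts_pair)

lemma field_setI2: "f \<in> V \<Longrightarrow> pair x y \<in> elts f \<Longrightarrow> y \<in> elts (field_set f)"
  unfolding elts_field_set by (rule UN_I, assumption) (auto simp: elts_pair)

lemma field_set_in_V: "f \<in> V \<Longrightarrow> field_set f \<in> V"
  by (rule dterm_constD) (intro dterm_field_set dterm_const)

lemma vset_dom: "f \<in> V \<Longrightarrow> vset {x. \<exists>y. pair x y \<in> elts f}"
proof -
  assume f: "f \<in> V"
  have "vset {x \<in> elts (field_set f). \<exists>y\<in>V. pair x y \<in> elts f}"
    by (rule vset_sep) (auto intro!: definable_intros dterm_intros' f field_set_in_V vset_elts)
  moreover have "{x \<in> elts (field_set f). \<exists>y\<in>V. pair x y \<in> elts f} = {x. \<exists>y. pair x y \<in> elts f}"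
    using field_setI1[OF f] in_V_elts[OF f] pair_in_V by blast
  ultimately show ?thesis by simp
qed

lemma tapp_eqI:
  assumes "f \<in> V" "pair x y \<in> elts f" "\<And>z. pair x z \<in> elts f \<Longrightarrow> z = y"
  shows "tapp f x = y"
proof -
  have xy: "x \<in> V" "y \<in> V" using in_V_elts[OF assms(1,2)] by auto
  have "vset {y \<in> elts (field_set f). pair x y \<in> elts f}"
    by (rule vset_sep) (auto intro!: definable_intros dterm_intros' assms(1) xy field_set_in_V vset_elts)
  moreover have "{y \<in> elts (field_set f). pair x y \<in> elts f} = {y}"
    using assms(2,3) field_setI2[OF assms(1,2)] by blast
  ultimately show ?thesis unfolding tapp_def by simp
qed

lemma tapp_empty:
  assumes "f \<in> V" "x \<in> V" "\<And>z. pair x z \<notin> elts f"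
  shows "elts (tapp f x) = {}"
proof -
  have "vset {y \<in> elts (field_set f). pair x y \<in> elts f}"
    by (rule vset_sep) (auto intro!: definable_intros dterm_intros' assms field_set_in_V vset_elts)
  moreover have e: "{y \<in> elts (field_set f). pair x y \<in> elts f} = {}"
    using assms by auto
  ultimately have "vset ({}::'u set)" by simp
  then show ?thesis unfolding tapp_def e by simp
qed

lemma vset_empty: "vset {}"
proof -
  obtain z where z: "z \<in> V" using ex_in_V by blast
  have "vset {x \<in> elts z. False}" by (intro vset_sep definable_bool vset_elts z)
  then show ?thesis by simp
qed

lemma vset_insert: "x \<in> V \<Longrightarrow> vset S \<Longrightarrow> vset (insert x S)"
  using vset_Un[OF vset_sing] by simp

lemma vset_finite: "finite S \<Longrightarrow> S \<subseteq> V \<Longrightarrow> vset S"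
  by (induction rule: finite_induct) (auto intro: vset_empty vset_insert)

lemma vset_Diff: "vset S \<Longrightarrow> vset T \<Longrightarrow> vset (S - T)"
proof -
  assume S: "vset S" and T: "vset T"
  have "vset {x \<in> S. x \<notin> elts (the_set T)}"
    by (rule vset_sep[OF _ S]) (intro definable_intros dterm_var dterm_const vset_in_V T)
  then show ?thesis using T by (simp add: set_diff_eq)
qed

lemma vset_image: "dterm (\<lambda>e. s (e 0)) \<Longrightarrow> vset A \<Longrightarrow> vset (s ` A)"
  using vset_image_env[of "\<lambda>e x. s x" "\<lambda>_. SOME z. z \<in> V" A] ex_in_V by (auto simp: some_in_eq)

lemma vset_graph: "dterm (\<lambda>e. s (e 0)) \<Longrightarrow> vset A \<Longrightarrow> vset ((\<lambda>x. pair x (s x)) ` A)"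
  by (rule vset_image) (auto intro!: dterm_pair dterm_var)

text \<open>The standard way to bring a HOL function into V: its restriction to a set of V is
  obtained by Replacement.\<close>

lemma fun_in_V:
  assumes "dterm (\<lambda>e. s (e 0))" "vset A" "s ` A \<subseteq> B"
  obtains f where "f \<in> V" "is_fun f A B" "\<And>x. x \<in> A \<Longrightarrow> app f x = s x"
proof -
  have v: "vset ((\<lambda>x. pair x (s x)) ` A)" by (rule vset_graph[OF assms(1,2)])
  show thesis
    by (rule that[OF vset_in_V[OF v]]) (use is_fun_graph[OF vset_elts_the_set[OF v] assms(3)] in auto)
qed

lemma elts_suc: "x \<in> V \<Longrightarrow> elts (suc x) = insert x (elts x)"
  unfolding suc_def using vset_Un[OF vset_elts[of x] vset_sing[of x]] by simp

lemma num_in_V: "num n \<in> V" and num_Suc: "num (Suc n) = suc (num n)"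
  and elts_num: "elts (num n :: 'u) = num ` {..<n}"
proof -
  have "num n \<in> V \<and> elts (num n :: 'u) = num ` {..<n}" for n
  proof (induction n)
    case (Suc n)
    then have "vset (insert (num n) (elts (num n)))" by (intro vset_insert vset_elts) auto
    then show ?case using Suc by (simp add: num.simps vset_in_V lessThan_Suc)
  qed (simp add: num.simps vset_empty vset_in_V)
  then show *: "num n \<in> V" "elts (num n :: 'u) = num ` {..<n}" for n by auto
  show "num (Suc n) = suc (num n)" unfolding suc_def by (simp add: num.simps)
qed

lemma num_inject [simp]: "num m = (num n :: 'u) \<longleftrightarrow> m = n"
proof -
  have "num m \<noteq> (num n :: 'u)" if "m < n" for m n
  proof
    assume "num m = (num n :: 'u)"
    moreover have "(num m :: 'u) \<in> elts (num n)" using that elts_num by auto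
    ultimately show False using elem_irrefl[of "num n :: 'u"] by simp
  qed
  then show ?thesis by (metis linorder_neqE_nat)
qed

lemma num_mem_num [simp]: "num m \<in> elts (num n :: 'u) \<longleftrightarrow> m < n"
  by (auto simp: elts_num)

lemma ordinal_num: "ordinal (num n :: 'u)"
  unfolding ordinal_def by (auto simp: elts_num)

text \<open>By linearity of ordinals, the alternatives would place k at or below a numeral and make
  it finite.\<close>

lemma num_in_infinite_ordinal:
  assumes "ordinal k" "infinite (elts k)" shows "num n \<in> elts (k :: 'u)"
proof (rule ccontr)
  assume "num n \<notin> elts k"
  then have "num n = k \<or> k \<in> elts (num n)" using ordinal_linear[OF ordinal_num assms(1)] by blast
  then have "finite (elts k)" by (auto simp: elts_num)
  then show False using assms(2) by blast
qed

text \<open>The omega of V is the standard one. The intersection I of all inductive sets of V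
  contains the numerals, and well-foundedness in the sense of HOL excludes any further
  element.\<close>

lemma vset_range_num: "vset (range num)"
proof -
  have "\<exists>w\<in>V. (\<exists>z\<in>V. z \<^bold>\<in> w \<and> (\<forall>y\<in>V. \<not> y \<^bold>\<in> z)) \<and>
        (\<forall>x\<in>V. x \<^bold>\<in> w \<longrightarrow> (\<exists>s\<in>V. s \<^bold>\<in> w \<and> (\<forall>y\<in>V. y \<^bold>\<in> s \<longleftrightarrow> y \<^bold>\<in> x \<or> y = x)))"
    using ZFC unfolding models_ZFC_def by (elim conjE)
  then obtain w z where w: "w \<in> V" "z \<in> V" "z \<in> elts w" "\<forall>y\<in>V. y \<notin> elts z"
    and s: "\<forall>x\<in>V. x \<in> elts w \<longrightarrow> (\<exists>s\<in>V. s \<in> elts w \<and> (\<forall>y\<in>V. y \<in> elts s \<longleftrightarrow> y \<in> elts x \<or> y = x))"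
    by (auto simp del: bex_simps ball_simps)
  have sucI: "suc x \<in> elts w" if x: "x \<in> elts w" for x
  proof -
    have xV: "x \<in> V" using in_V_elts[OF w(1) x] .
    then obtain t where t: "t \<in> V" "t \<in> elts w" "\<forall>y\<in>V. y \<in> elts t \<longleftrightarrow> y \<in> elts x \<or> y = x"
      using s x by blast
    have "elts t = elts (suc x)"
      using t(3) elts_subset[OF t(1)] elts_subset[OF xV] xV unfolding elts_suc[OF xV] by blast
    then show ?thesis using t(2) by (simp add: elts_inject)
  qed
  have zero: "num 0 \<in> elts w"
  proof -
    have "elts z = {}" using w(4) elts_subset[OF w(2)] by blast
    then have "z = num 0" using elts_num[of 0] by (simp flip: elts_inject)
    then show ?thesis using w(3) by simp
  qed
  define ind where "ind = (\<lambda>v::'u. num 0 \<in> elts v \<and> (\<forall>x\<in>elts v. suc x \<in> elts v))"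
  have ind_num: "num n \<in> elts v" if "ind v" for v n
    by (induction n) (use that in \<open>auto simp only: ind_def num_Suc\<close>)
  define I where "I = {x \<in> elts w. \<forall>v\<in>V. ind v \<longrightarrow> x \<in> elts v}"
  have vI: "vset I" unfolding I_def ind_def
    by (rule vset_sep) (intro definable_intros dterm_var dterm_suc dterm_const num_in_V vset_elts w)+
  have "x \<in> range num" if x: "x \<in> I" for x
  proof (rule ccontr)
    assume "x \<notin> range num"
    \<comment> \<open>A membership-minimal nonstandard element m is not the successor of an element
      of I, since that element would be a numeral. Hence removing m leaves an inductive set of V,
      against the definition of I.\<close>
    then obtain m where m: "m \<in> I - range num" "\<And>y. y \<^bold>\<in> m \<Longrightarrow> y \<notin> I - range num"
      using elem_minimal[of x "I - range num"] x by blast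
    have v: "vset (I - {m})"
      using m vset_subset[OF vI] by (intro vset_Diff vI vset_sing) blast
    have "ind (the_set (I - {m}))"
      unfolding ind_def vset_elts_the_set[OF v]
    proof (intro conjI ballI)
      have "num 0 \<in> I" using zero ind_num[of _ 0] unfolding I_def by auto
      then show "num 0 \<in> I - {m}" using m(1) by auto
      fix y assume y: "y \<in> I - {m}"
      have yV: "y \<in> V" using y vset_subset[OF vI] by blast
      have "suc y \<in> I" using y sucI unfolding I_def ind_def by blast
      moreover have "suc y \<noteq> m"
      proof
        assume e: "suc y = m"
        then have "y \<in> elts m" using elts_suc[OF yV] by auto
        then have "y \<in> range num" using m(2)[of y] y by auto
        then show False using e m(1) num_Suc by (metis DiffD2 imageE rangeI)
      qed
      ultimately show "suc y \<in> I - {m}" by blast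
    qed
    then have "m \<in> elts (the_set (I - {m}))"
      using m(1) vset_in_V[OF v] unfolding I_def by blast
    then show False unfolding vset_elts_the_set[OF v] by blast
  qed
  moreover have "num n \<in> I" for n
    using ind_num[of _ n] ind_num[of w n] zero sucI unfolding I_def ind_def by auto
  ultimately have "I = range num" by blast
  then show ?thesis using vI by simp
qed

definition omega :: 'u where "omega = the_set (range num)"

lemma elts_omega: "elts omega = range num"
  unfolding omega_def using vset_range_num by simp

lemma omega_in_V: "omega \<in> V"
  unfolding omega_def using vset_in_V[OF vset_range_num] .

lemma dterm_comp1_in_V: "dterm (\<lambda>e. H (e 0)) \<Longrightarrow> x \<in> V \<Longrightarrow> H x \<in> V"
  using dterm_in_V[of "\<lambda>e. H (e 0)" "\<lambda>_. x"] by simp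

text \<open>The iteration count n lives in HOL, so the sequence is recovered inside V from partial
  computations: a pair belongs to it if some computation in V contains it.\<close>

lemma vset_iterates:
  assumes H: "dterm (\<lambda>e. H (e 0))" and x0: "x0 \<in> V"
  shows "vset (range (\<lambda>n. pair (num n) ((H ^^ n) x0)))"
proof -
  let ?x = "\<lambda>n. (H ^^ n) x0"
  have xV: "?x n \<in> V" for n by (induction n) (use x0 dterm_comp1_in_V[OF H] in auto)
  \<comment> \<open>Each pair is the initial one or is justified by a predecessor in f.
    Functionality is not demanded; \<open>unique\<close> derives the values by induction on the
    standard n.\<close>
  define attempt where "attempt = (\<lambda>f. \<forall>p\<in>elts f. p = pair (num 0) x0 \<or>
    (\<exists>k\<in>elts omega. \<exists>z\<in>V. pair k z \<in> elts f \<and> p = pair (suc k) (H z)))"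
  have unique: "y = ?x n" if "attempt f" "pair (num n) y \<in> elts f" for f n y
    using that(2)
  proof (induction n arbitrary: y)
    case 0
    have "num 0 \<noteq> suc (num m :: 'u)" for m
      unfolding num_Suc[symmetric] num_inject by simp
    moreover have "pair (num 0) y = pair (num 0) x0 \<or>
        (\<exists>k\<in>elts omega. \<exists>z\<in>V. pair k z \<in> elts f \<and> pair (num 0) y = pair (suc k) (H z))"
      using that(1) 0 unfolding attempt_def by blast
    ultimately show ?case unfolding elts_omega by auto
  next
    case (Suc n)
    have "num (Suc n) = suc (num m :: 'u) \<longleftrightarrow> n = m" "num (Suc n) \<noteq> (num 0 :: 'u)" for m
      unfolding num_Suc[symmetric] num_inject by simp_all
    moreover have "pair (num (Suc n)) y = pair (num 0) x0 \<or>
        (\<exists>k\<in>elts omega. \<exists>z\<in>V. pair k z \<in> elts f \<and> pair (num (Suc n)) y = pair (suc k) (H z))"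
      using that(1) Suc.prems unfolding attempt_def by blast
    ultimately obtain z where "pair (num n) z \<in> elts f" "y = H z"
      unfolding elts_omega by auto
    then show ?case using Suc.IH by simp
  qed
  define Q where "Q = (\<lambda>k p. \<exists>y\<in>V. p = pair k y \<and> (\<exists>f\<in>V. attempt f \<and> p \<in> elts f))"
  have "vset {p \<in> V. \<exists>k\<in>range num. Q k p}"
  proof (rule vset_repl[OF _ vset_range_num])
    show "definable (\<lambda>e. Q (e (Suc 0)) (e 0))"
      unfolding Q_def attempt_def
      by (intro definable_intros dterm_var dterm_pair dterm_suc dterm_const num_in_V omega_in_V x0 dterm_comp1[OF H])
    show "y = z" if "x \<in> range num" "Q x y" "Q x z" for x y z
      using that unique unfolding Q_def by blast
  qed
  moreover have "{p \<in> V. \<exists>k\<in>range num. Q k p} = range (\<lambda>n. pair (num n) (?x n))"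
  proof (intro set_eqI iffI)
    fix p assume "p \<in> {p \<in> V. \<exists>k\<in>range num. Q k p}"
    then show "p \<in> range (\<lambda>n. pair (num n) (?x n))" using unique unfolding Q_def by blast
  next
    fix p assume "p \<in> range (\<lambda>n. pair (num n) (?x n))"
    then obtain n where p: "p = pair (num n) (?x n)" by blast
    \<comment> \<open>A finite initial segment is in V because it is finite, and it is a partial
      computation reaching stage n.\<close>
    define F where "F = (\<lambda>n. pair (num n) (?x n)) ` {..n}"
    have vF: "vset F" unfolding F_def by (rule vset_finite) (auto simp: xV num_in_V)
    have "attempt (the_set F)"
      unfolding attempt_def vset_elts_the_set[OF vF]
    proof
      fix q assume "q \<in> F"
      then obtain i where i: "i \<le> n" "q = pair (num i) (?x i)" unfolding F_def by auto
      show "q = pair (num 0) x0 \<or> (\<exists>k\<in>elts omega. \<exists>z\<in>V. pair k z \<in> F \<and> q = pair (suc k) (H z))"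
      proof (cases i)
        case (Suc j)
        have "pair (num j) (?x j) \<in> F" unfolding F_def using i Suc by auto
        moreover have "q = pair (suc (num j)) (H (?x j))" using i Suc num_Suc by simp
        ultimately show ?thesis unfolding elts_omega using xV by blast
      qed (use i in simp)
    qed
    moreover have "p \<in> F" unfolding F_def p by blast
    ultimately have "Q (num n) p" unfolding Q_def p using xV vset_in_V[OF vF] vset_elts_the_set[OF vF]
      by blast
    then show "p \<in> {p \<in> V. \<exists>k\<in>range num. Q k p}" unfolding p using xV num_in_V by auto
  qed
  ultimately show ?thesis by simp
qed

text \<open>The axiom chooses from pairwise disjoint sets; tagging the members of Y with Y makes the
  subsets of S disjoint. The clause for empty Y gives a harmless default when a construction has no
  candidate left.\<close>

lemma choice:
  assumes S: "S \<in> V"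
  obtains c where "c \<in> V"
    "\<And>Y. Y \<in> V \<Longrightarrow> elts Y \<subseteq> elts S \<Longrightarrow> elts Y \<noteq> {} \<Longrightarrow> tapp c Y \<in> elts Y"
    "\<And>Y. Y \<in> V \<Longrightarrow> elts Y = {} \<Longrightarrow> elts (tapp c Y) = {}"
proof -
  define P where "P = {Y \<in> V. elts Y \<subseteq> elts S \<and> (\<exists>y\<in>elts Y. True)}"
  have "vset {Y \<in> {Y \<in> V. elts Y \<subseteq> elts S}. \<exists>y\<in>elts Y. True}"
    by (rule vset_sep) (intro definable_intros dterm_var vset_Pow S)+
  then have vP: "vset P" unfolding P_def by (rule back_subst) auto
  define col where "col = (\<lambda>Y::'u. the_set ((\<lambda>y. pair Y y) ` elts Y))"
  have tcol: "dterm (\<lambda>e. col (e 0))" unfolding col_def by (intro dterm_image dterm_var dterm_pair)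
  have ecol: "elts (col Y) = (\<lambda>y. pair Y y) ` elts Y" if "Y \<in> V" for Y
    unfolding col_def
    by (intro vset_elts_the_set vset_image vset_elts that dterm_pair dterm_var dterm_const)
  have vA: "vset (col ` P)" by (rule vset_image[OF tcol vP])
  have "\<forall>a\<in>V. (\<forall>x\<in>V. x \<^bold>\<in> a \<longrightarrow> (\<exists>y\<in>V. y \<^bold>\<in> x)) \<and>
          (\<forall>x\<in>V. \<forall>y\<in>V. x \<^bold>\<in> a \<and> y \<^bold>\<in> a \<and> x \<noteq> y \<longrightarrow> \<not> (\<exists>z\<in>V. z \<^bold>\<in> x \<and> z \<^bold>\<in> y)) \<longrightarrow>
        (\<exists>c\<in>V. \<forall>x\<in>V. x \<^bold>\<in> a \<longrightarrow> (\<exists>!y. y \<in> V \<and> y \<^bold>\<in> x \<and> y \<^bold>\<in> c))"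
    using ZFC unfolding models_ZFC_def by (elim conjE)
  from bspec[OF this vset_in_V[OF vA]]
  have AC: "(\<forall>x\<in>V. x \<in> col ` P \<longrightarrow> (\<exists>y\<in>V. y \<in> elts x)) \<Longrightarrow>
          (\<forall>x\<in>V. \<forall>y\<in>V. x \<in> col ` P \<and> y \<in> col ` P \<and> x \<noteq> y \<longrightarrow> \<not> (\<exists>z\<in>V. z \<in> elts x \<and> z \<in> elts y)) \<Longrightarrow>
        (\<exists>c\<in>V. \<forall>x\<in>V. x \<in> col ` P \<longrightarrow> (\<exists>!y. y \<in> V \<and> y \<in> elts x \<and> y \<in> elts c))"
    unfolding mem_elts[symmetric] vset_elts_the_set[OF vA] by blast
  have "\<exists>c\<in>V. \<forall>x\<in>V. x \<in> col ` P \<longrightarrow> (\<exists>!y. y \<in> V \<and> y \<in> elts x \<and> y \<in> elts c)"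
  proof (rule AC; intro ballI impI)
    fix x assume "x \<in> col ` P"
    then obtain Y where Y: "Y \<in> P" "x = col Y" by blast
    then obtain y where "Y \<in> V" "y \<in> elts Y" unfolding P_def by blast
    then show "\<exists>y\<in>V. y \<in> elts x" unfolding Y ecol[OF \<open>Y \<in> V\<close>] using in_V_elts by (intro bexI[of _ "pair Y y"]) auto
  next
    fix x y assume "x \<in> V" "y \<in> V" "x \<in> col ` P \<and> y \<in> col ` P \<and> x \<noteq> y"
    moreover have "Y \<in> V" if "Y \<in> P" for Y using that unfolding P_def by blast
    ultimately show "\<not> (\<exists>z\<in>V. z \<in> elts x \<and> z \<in> elts y)" using ecol by fastforce
  qed
  then obtain t where t: "t \<in> V" "\<forall>x\<in>V. x \<in> col ` P \<longrightarrow> (\<exists>!y. y \<in> V \<and> y \<in> elts x \<and> y \<in> elts t)"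
    by blast
  have vU: "vset (\<Union>x\<in>elts (the_set (col ` P)). elts x)" by (intro vset_Union vset_in_V vA)
  define C where "C = {p \<in> (\<Union>x\<in>elts (the_set (col ` P)). elts x). p \<in> elts t}"
  have vC: "vset C" unfolding C_def by (rule vset_sep[OF _ vU]) (intro definable_intros dterm_var dterm_const t)
  have memC: "pair Y y \<in> C \<longleftrightarrow> Y \<in> P \<and> y \<in> elts Y \<and> pair Y y \<in> elts t" for Y y
  proof -
    have "Y' \<in> P \<Longrightarrow> pair Y y \<in> elts (col Y') \<longleftrightarrow> Y = Y' \<and> y \<in> elts Y" for Y'
      using ecol[of Y'] unfolding P_def by auto
    then show ?thesis unfolding C_def vset_elts_the_set[OF vA] by auto
  qed
  show thesis
  proof (rule that[OF vset_in_V[OF vC]])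
    fix Y assume Y: "Y \<in> V" "elts Y \<subseteq> elts S" "elts Y \<noteq> {}"
    then have YP: "Y \<in> P" unfolding P_def by blast
    then have "\<exists>!p. p \<in> V \<and> p \<in> elts (col Y) \<and> p \<in> elts t"
      using t(2) vset_subset[OF vA] by blast
    then obtain p where p: "p \<in> elts (col Y)" "p \<in> elts t"
      "\<And>q. q \<in> V \<and> q \<in> elts (col Y) \<and> q \<in> elts t \<Longrightarrow> q = p" by blast
    then obtain y where y: "y \<in> elts Y" "p = pair Y y" unfolding ecol[OF Y(1)] by blast
    have y3: "z = y" if "z \<in> elts Y" "pair Y z \<in> elts t" for z
      using p(3)[of "pair Y z"] that in_V_elts[OF Y(1)] Y(1) unfolding y ecol[OF Y(1)] by simp
    have "tapp (the_set C) Y = y"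
    proof (rule tapp_eqI[OF vset_in_V[OF vC]]; unfold vset_elts_the_set[OF vC] memC)
      show "Y \<in> P \<and> y \<in> elts Y \<and> pair Y y \<in> elts t" using YP y p(2) by blast
      show "z = y" if "Y \<in> P \<and> z \<in> elts Y \<and> pair Y z \<in> elts t" for z
        by (rule y3) (use that in blast)+
    qed
    then show "tapp (the_set C) Y \<in> elts Y" using y by simp
  next
    fix Y assume "Y \<in> V" "elts Y = {}"
    then show "elts (tapp (the_set C) Y) = {}"
      by (intro tapp_empty vset_in_V vC) (auto simp: memC vset_elts_the_set[OF vC])
  qed
qed

end

subsection \<open>Finite sequences and ordinal recursion in the model\<close>

context zfc
begin

lemma vset_times: "vset A \<Longrightarrow> vset B \<Longrightarrow> vset {pair x y |x y. x \<in> A \<and> y \<in> B}"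
proof -
  assume A: "vset A" and B: "vset B"
  have im: "vset ((\<lambda>y. pair x y) ` B)" if "x \<in> V" for x
    by (rule vset_image[OF _ B]) (intro dterm_pair dterm_var dterm_const that)
  have "vset ((\<lambda>x. the_set ((\<lambda>y. pair x y) ` elts (the_set B))) ` A)"
    by (rule vset_image[OF _ A]) (intro dterm_image dterm_pair dterm_var dterm_const vset_in_V B)
  from vset_Union[OF vset_in_V[OF this]]
  have "vset (\<Union>x\<in>A. elts (the_set ((\<lambda>y. pair x y) ` B)))"
    using \<open>vset (_ ` A)\<close> B by simp
  moreover have "(\<Union>x\<in>A. elts (the_set ((\<lambda>y. pair x y) ` B))) = {pair x y |x y. x \<in> A \<and> y \<in> B}"
  proof -
    have "elts (the_set ((\<lambda>y. pair x y) ` B)) = (\<lambda>y. pair x y) ` B" if "x \<in> A" for x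
      by (intro vset_elts_the_set im) (use vset_subset[OF A] that in blast)
    then show ?thesis by auto
  qed
  ultimately show ?thesis by simp
qed

lemma definable_is_fun:
  assumes f: "dterm f" and A: "dterm A" and B: "dterm B"
  shows "definable (\<lambda>e. is_fun (f e) (elts (A e)) (elts (B e)))"
proof -
  have "definable (\<lambda>e. (\<forall>p\<in>elts (f e). \<exists>x\<in>elts (A e). \<exists>y\<in>elts (B e). p = pair x y) \<and>
     (\<forall>x\<in>elts (A e). \<exists>y\<in>V. pair x y \<in> elts (f e) \<and> (\<forall>z\<in>V. pair x z \<in> elts (f e) \<longrightarrow> z = y)))"
    by (intro definable_intros dterm_var dterm_pair f A B dterm_reindex[OF f] dterm_reindex[OF A] dterm_reindex[OF B])
  then show ?thesis
  proof (rule definable_cong[THEN iffD1, rotated])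
    fix e :: "nat \<Rightarrow> 'u" assume e: "range e \<subseteq> V"
    have p: "pair x y \<in> elts (f e) \<Longrightarrow> y \<in> V" for x y
      using in_V_elts[OF dterm_in_V[OF f e]] by fastforce
    have "(\<forall>p\<in>elts (f e). \<exists>x\<in>elts (A e). \<exists>y\<in>elts (B e). p = pair x y) \<longleftrightarrow>
       elts (f e) \<subseteq> {pair x y |x y. x \<in> elts (A e) \<and> y \<in> elts (B e)}"
      by blast
    moreover have "(\<exists>y\<in>V. pair x y \<in> elts (f e) \<and> (\<forall>z\<in>V. pair x z \<in> elts (f e) \<longrightarrow> z = y)) \<longleftrightarrow>
        (\<exists>!y. pair x y \<in> elts (f e))" for x
      using p by blast
    ultimately show "(\<forall>p\<in>elts (f e). \<exists>x\<in>elts (A e). \<exists>y\<in>elts (B e). p = pair x y) \<and>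
     (\<forall>x\<in>elts (A e). \<exists>y\<in>V. pair x y \<in> elts (f e) \<and> (\<forall>z\<in>V. pair x z \<in> elts (f e) \<longrightarrow> z = y)) \<longleftrightarrow>
       is_fun (f e) (elts (A e)) (elts (B e))"
      unfolding is_fun_def mem_elts[symmetric] by presburger
  qed
qed

lemma vset_seq: "set xs \<subseteq> V \<Longrightarrow> vset {pair (num i) (xs ! i) |i. i < length xs}"
  by (rule vset_finite) (auto simp: num_in_V subset_eq)

lemma seq_in_V: "set xs \<subseteq> V \<Longrightarrow> seq xs \<in> V"
  unfolding seq_def by (intro vset_in_V vset_seq)

lemma elts_seq: "set xs \<subseteq> V \<Longrightarrow> elts (seq xs) = {pair (num i) (xs ! i) |i. i < length xs}"
  unfolding seq_def by (intro vset_elts_the_set vset_seq)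

lemma seq_is_fun:
  assumes "set xs \<subseteq> V"
  shows "is_fun (seq xs) (elts (num (length xs))) (set xs)"
    "i < length xs \<Longrightarrow> app (seq xs) (num i) = xs ! i"
proof -
  show f: "is_fun (seq xs) (elts (num (length xs))) (set xs)"
    unfolding is_fun_def mem_elts[symmetric] elts_seq[OF assms] elts_num by auto
  show "app (seq xs) (num i) = xs ! i" if "i < length xs"
    using is_fun_mem_iff[OF f, of "num i" "xs ! i"] that unfolding elts_seq[OF assms] by auto
qed

lemma pair_mem_seq: "set xs \<subseteq> V \<Longrightarrow> pair k y \<in> elts (seq xs) \<longleftrightarrow> (\<exists>i<length xs. k = num i \<and> y = xs ! i)"
  unfolding elts_seq by auto

lemma is_fun_num_seq:
  assumes "is_fun (f::'u)  (elts (num n)) B"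
  shows "f = seq (map (\<lambda>i. app f (num i)) [0..<n])" "set (map (\<lambda>i. app f (num i)) [0..<n]) \<subseteq> B"
proof -
  have "elts f = {pair (num i) (app f (num i)) |i. i < n}"
    unfolding is_fun_elts[OF assms] elts_num by auto
  also have "\<dots> = {pair (num i) (map (\<lambda>i. app f (num i)) [0..<n] ! i) |i.
      i < length (map (\<lambda>i. app f (num i)) [0..<n])}"
    by auto
  finally show "f = seq (map (\<lambda>i. app f (num i)) [0..<n])"
    unfolding seq_def by (metis the_set_elts)
  show "set (map (\<lambda>i. app f (num i)) [0..<n]) \<subseteq> B"
    using is_fun_app(2)[OF assms] by auto
qed

lemma seq_inject:
  assumes "set xs \<subseteq> V" "set ys \<subseteq> V"
  shows "seq xs = (seq ys :: 'u) \<longleftrightarrow> xs = ys"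
proof
  assume e: "seq xs = seq ys"
  have *: "i < length xs \<and> y = xs ! i \<longleftrightarrow> i < length ys \<and> y = ys ! i" for i y
    using pair_mem_seq[OF assms(1), of "num i" y] pair_mem_seq[OF assms(2), of "num i" y] e by auto
  then have "i < length xs \<longleftrightarrow> i < length ys" for i by metis
  then have l: "length xs = length ys" by (metis linorder_neqE_nat less_irrefl)
  show "xs = ys" by (rule nth_equalityI[OF l]) (use * in blast)
qed simp

definition Seqs :: "'u \<Rightarrow> 'u" where
  "Seqs Y = the_set (seq ` {xs. set xs \<subseteq> elts Y})"

text \<open>A finite sequence in the sense of V is a function on an element of omega. As omega is
  standard, these are precisely the codes of HOL lists.\<close>

lemma vset_Seqs: assumes Y: "Y \<in> V" shows "vset (seq ` {xs. set xs \<subseteq> elts Y})"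
proof -
  define P where "P = the_set {pair x y |x y. x \<in> elts omega \<and> y \<in> elts Y}"
  have vP: "vset {pair x y |x y. x \<in> elts omega \<and> y \<in> elts Y}"
    by (intro vset_times vset_elts omega_in_V Y)
  then have PV: "P \<in> V" unfolding P_def by (rule vset_in_V)
  have "vset {s \<in> {y \<in> V. elts y \<subseteq> elts P}. \<exists>n\<in>elts omega. is_fun s (elts n) (elts Y)}"
    by (rule vset_sep[OF _ vset_Pow[OF PV]]) (intro definable_intros definable_is_fun dterm_var dterm_const omega_in_V Y)
  moreover have "{s \<in> {y \<in> V. elts y \<subseteq> elts P}. \<exists>n\<in>elts omega. is_fun s (elts n) (elts Y)} =
     seq ` {xs. set xs \<subseteq> elts Y}"
  proof (intro set_eqI iffI)
    fix s assume "s \<in> {s \<in> {y \<in> V. elts y \<subseteq> elts P}. \<exists>n\<in>elts omega. is_fun s (elts n) (elts Y)}"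
    then obtain n where "is_fun s (elts (num n)) (elts Y)" unfolding elts_omega by blast
    from is_fun_num_seq[OF this] show "s \<in> seq ` {xs. set xs \<subseteq> elts Y}" by blast
  next
    fix s assume "s \<in> seq ` {xs. set xs \<subseteq> elts Y}"
    then obtain xs where xs: "set xs \<subseteq> elts Y" "s = seq xs" by blast
    then have xV: "set xs \<subseteq> V" using elts_subset[OF Y] by blast
    have eP: "elts P = {pair x y |x y. x \<in> elts omega \<and> y \<in> elts Y}"
      unfolding P_def by (rule vset_elts_the_set[OF vP])
    have sub: "elts s \<subseteq> elts P"
      unfolding eP xs(2) elts_seq[OF xV] elts_omega using xs(1) nth_mem by fastforce
    have "is_fun s (elts (num (length xs))) (elts Y)"
      unfolding xs(2) by (rule is_fun_cong[OF seq_is_fun(1)[OF xV]])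
        (use seq_is_fun(2)[OF xV] xs(1) in \<open>auto simp: elts_num\<close>)
    then show "s \<in> {s \<in> {y \<in> V. elts y \<subseteq> elts P}. \<exists>n\<in>elts omega. is_fun s (elts n) (elts Y)}"
      using sub seq_in_V[OF xV] unfolding xs(2) elts_omega by blast
  qed
  ultimately show ?thesis by simp
qed

lemma elts_Seqs: "Y \<in> V \<Longrightarrow> elts (Seqs Y) = seq ` {xs. set xs \<subseteq> elts Y}"
  unfolding Seqs_def by (intro vset_elts_the_set vset_Seqs)

lemma Seqs_in_V: "Y \<in> V \<Longrightarrow> Seqs Y \<in> V"
  unfolding Seqs_def by (intro vset_in_V vset_Seqs)

section \<open>Recursion along the ordinals of V\<close>

context
  fixes T :: "'u \<Rightarrow> 'u"
  assumes tT: "dterm (\<lambda>e. T (e 0))"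
begin

text \<open>Only the values of f at members of a are constrained. \<open>tapp\<close> is used in
  place of \<open>app\<close> because it is definable.\<close>

definition attempt :: "'u \<Rightarrow> 'u \<Rightarrow> bool" where
  "attempt f a \<longleftrightarrow> (\<forall>b\<in>elts a. \<exists>y\<in>V. pair b y \<in> elts f) \<and>
     (\<forall>b\<in>elts a. \<forall>y\<in>V. pair b y \<in> elts f \<longrightarrow> y = T (the_set (\<Union>c\<in>elts b. elts (tapp f c))))"

lemma attempt_unique:
  assumes f: "f \<in> V" and a: "ordinal a" and attempt: "attempt f a"
  shows "b \<in> elts a \<Longrightarrow> pair b (orec T b) \<in> elts f \<and> tapp f b = orec T b"
proof (induction b rule: elem_induct)
  case (step b)
  have "tapp f c = orec T c" if "c \<in> elts b" for c
    using step.IH[of c] that ordinal_trans[OF a step.prems] by simp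
  then have "T (the_set (\<Union>c\<in>elts b. elts (tapp f c))) = orec T b"
    by (simp add: orec.simps[of T b])
  then have u: "y = orec T b" if "pair b y \<in> elts f" for y
    using attempt step.prems that in_V_elts[OF f that] unfolding attempt_def by fastforce
  obtain y where "pair b y \<in> elts f" using attempt step.prems unfolding attempt_def by blast
  then have p: "pair b (orec T b) \<in> elts f" using u by blast
  show ?case using p tapp_eqI[OF f p u] by blast
qed

lemma definable_attempt: "dterm t \<Longrightarrow> dterm s \<Longrightarrow> definable (\<lambda>e. attempt (t e) (s e))"
  by (rule definable_comp2[where Q = attempt]) (unfold attempt_def, intro definable_intros dterm_var dterm_pair dterm_comp1[OF tT] dterm_UN dterm_tapp)

lemma attempt_orec:
  assumes a: "a \<in> V" "ordinal a" and v: "vset ((\<lambda>b. pair b (orec T b)) ` elts a)"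
  shows "attempt (the_set ((\<lambda>b. pair b (orec T b)) ` elts a)) a"
proof -
  let ?f = "the_set ((\<lambda>b. pair b (orec T b)) ` elts a)"
  have e: "pair b y \<in> elts ?f \<longleftrightarrow> b \<in> elts a \<and> y = orec T b" for b y
    unfolding vset_elts_the_set[OF v] by auto
  have V: "orec T b \<in> V" if "b \<in> elts a" for b
    using vset_subset[OF v] that by auto
  have t: "tapp ?f b = orec T b" if "b \<in> elts a" for b
    by (rule tapp_eqI[OF vset_in_V[OF v]]) (use e that in auto)
  have "orec T b = T (the_set (\<Union>c\<in>elts b. elts (tapp ?f c)))" if b: "b \<in> elts a" for b
    using t ordinal_trans[OF a(2) b] by (simp add: orec.simps[of T b])
  then show ?thesis unfolding attempt_def e using V by auto
qed

lemma attempt_step_eq_orec: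
  assumes a: "a \<in> V" "ordinal a" and f: "f \<in> V" "attempt f a"
  shows "T (the_set (\<Union>c\<in>elts a. elts (tapp f c))) = orec T a"
  using attempt_unique[OF f(1) a(2) f(2)] by (simp add: orec.simps[of T a])

text \<open>The usual recursion theorem: by induction each b below a has a computation in V, its
  result is the same for all such computations, and Replacement collects the results.\<close>

lemma vset_orec_graph: "a \<in> V \<Longrightarrow> ordinal a \<Longrightarrow> vset ((\<lambda>b. pair b (orec T b)) ` elts a)"
proof (induction a rule: elem_induct)
  case (step a)
  \<comment> \<open>\<open>orec\<close> itself is a HOL function with no formula yet, so the
    relation handed to Replacement speaks of computations only.\<close>
  define Q where "Q = (\<lambda>b p. \<exists>f\<in>V. attempt f b \<and> p = pair b (T (the_set (\<Union>c\<in>elts b. elts (tapp f c)))))"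
  have b: "b \<in> V" "ordinal b" "\<exists>f\<in>V. attempt f b" if "b \<in> elts a" for b
  proof -
    show *: "b \<in> V" "ordinal b"
      using in_V_elts[OF step.prems(1) that] ordinal_elem[OF step.prems(2) that] .
    then have v: "vset ((\<lambda>b. pair b (orec T b)) ` elts b)" using step.IH that by simp
    show "\<exists>f\<in>V. attempt f b" using attempt_orec[OF * v] vset_in_V[OF v] by blast
  qed
  have Q: "Q b p \<longleftrightarrow> p = pair b (orec T b)" if "b \<in> elts a" for b p
    unfolding Q_def using attempt_step_eq_orec[OF b(1,2)[OF that]] b(3)[OF that] by metis
  have "orec T b \<in> V" if "b \<in> elts a" for b
  proof -
    obtain f where f: "f \<in> V" "attempt f b" using b(3)[OF \<open>b \<in> elts a\<close>] by blast
    have "T (the_set (\<Union>c\<in>elts b. elts (tapp f c))) \<in> V"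
      by (rule dterm_comp1_in_V[OF tT], rule dterm_constD) (intro dterm_UN dterm_tapp dterm_const dterm_var f b that)
    then show ?thesis using attempt_step_eq_orec[OF b(1,2)[OF that] f] by simp
  qed
  then have "{p \<in> V. \<exists>b\<in>elts a. Q b p} = (\<lambda>b. pair b (orec T b)) ` elts a"
    using Q b by auto
  moreover have "vset {p \<in> V. \<exists>b\<in>elts a. Q b p}"
  proof (rule vset_repl[OF _ vset_elts[OF step.prems(1)]])
    show "definable (\<lambda>e. Q (e (Suc 0)) (e 0))"
      unfolding Q_def by (intro definable_intros definable_attempt dterm_var dterm_pair dterm_comp1[OF tT] dterm_UN dterm_tapp)
  qed (simp add: Q)
  ultimately show ?case by simp
qed

lemma orec_in_V: assumes a: "a \<in> V" "ordinal a" shows "orec T a \<in> V"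
proof -
  let ?f = "the_set ((\<lambda>b. pair b (orec T b)) ` elts a)"
  have v: "vset ((\<lambda>b. pair b (orec T b)) ` elts a)" by (rule vset_orec_graph[OF a])
  have "T (the_set (\<Union>c\<in>elts a. elts (tapp ?f c))) \<in> V"
    by (rule dterm_comp1_in_V[OF tT], rule dterm_constD) (intro dterm_UN dterm_tapp dterm_const dterm_var vset_in_V v a)
  then show ?thesis using attempt_step_eq_orec[OF a vset_in_V[OF v] attempt_orec[OF a v]] by simp
qed

lemma elts_UN_orec:
  assumes a: "a \<in> V" "ordinal a"
  shows "elts (the_set (\<Union>b\<in>elts a. elts (orec T b))) = (\<Union>b\<in>elts a. elts (orec T b))"
proof -
  let ?f = "the_set ((\<lambda>b. pair b (orec T b)) ` elts a)"
  have v: "vset ((\<lambda>b. pair b (orec T b)) ` elts a)" by (rule vset_orec_graph[OF a])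
  have "vset ((\<lambda>b. tapp ?f b) ` elts a)"
    by (rule vset_image) (intro dterm_tapp dterm_const dterm_var vset_in_V v vset_elts a)+
  moreover have "(\<lambda>b. tapp ?f b) ` elts a = orec T ` elts a"
    using attempt_unique[OF vset_in_V[OF v] a(2) attempt_orec[OF a v]] by auto
  ultimately have "vset (orec T ` elts a)" by simp
  from vset_Union[OF vset_in_V[OF this]] this show ?thesis by simp
qed

lemma definable_ordinal: "dterm t \<Longrightarrow> definable (\<lambda>e. ordinal (t e))"
  by (rule definable_comp1[where Q = ordinal]) (unfold ordinal_def, intro definable_intros dterm_var)

text \<open>The ordinal clause is part of the predicate because computations are known to exist, and
  to agree, only at ordinals.\<close>

lemma definable_orec: "definable (\<lambda>e. ordinal (e 1) \<and> e 0 = orec T (e 1))"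
proof -
  have "definable (\<lambda>e. ordinal (e 1) \<and>
      (\<exists>f\<in>V. attempt f (e 1) \<and> e 0 = T (the_set (\<Union>c\<in>elts (e 1). elts (tapp f c)))))"
    by (intro definable_intros definable_ordinal definable_attempt dterm_var dterm_comp1[OF tT] dterm_UN dterm_tapp)
  then show ?thesis
  proof (rule definable_cong[THEN iffD1, rotated])
    fix e :: "nat \<Rightarrow> 'u" assume "range e \<subseteq> V"
    then have eV: "e 1 \<in> V" by auto
    show "ordinal (e 1) \<and>
      (\<exists>f\<in>V. attempt f (e 1) \<and> e 0 = T (the_set (\<Union>c\<in>elts (e 1). elts (tapp f c)))) \<longleftrightarrow>
      ordinal (e 1) \<and> e 0 = orec T (e 1)"
    proof (intro conj_cong refl)
      assume o: "ordinal (e 1)"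
      have "\<exists>f\<in>V. attempt f (e 1)"
        using attempt_orec[OF eV o vset_orec_graph[OF eV o]] vset_in_V[OF vset_orec_graph[OF eV o]] by blast
      then show "(\<exists>f\<in>V. attempt f (e 1) \<and> e 0 = T (the_set (\<Union>c\<in>elts (e 1). elts (tapp f c)))) \<longleftrightarrow>
          e 0 = orec T (e 1)"
        using attempt_step_eq_orec[OF eV o] by metis
    qed
  qed
qed

text \<open>The least ordinal \<open>a\<close> with \<open>P x (orec T a)\<close> is a definable function of \<open>x\<close>, so Replacement bounds it.\<close>

lemma orec_bound:
  assumes P: "definable (\<lambda>e. P (e 1) (e 0))" and F: "F \<in> V"
    and ex: "\<And>x. x \<in> elts F \<Longrightarrow> \<exists>a\<in>V. ordinal a \<and> P x (orec T a)"
  obtains a where "a \<in> V" "ordinal a" "\<And>x. x \<in> elts F \<Longrightarrow> \<exists>b\<in>elts a. P x (orec T b)"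
proof -
  define R where "R = (\<lambda>x a. \<exists>z\<in>V. (ordinal a \<and> z = orec T a) \<and> P x z)"
  have R: "R x a \<longleftrightarrow> ordinal a \<and> P x (orec T a)" if "a \<in> V" for x a
    unfolding R_def using orec_in_V that by blast
  define Q where "Q = (\<lambda>x a. R x a \<and> (\<forall>b\<in>elts a. \<not> R x b))"
  have unique: "a = b" if "a \<in> V" "b \<in> V" "Q x a" "Q x b" for x a b
    using that ordinal_linear[of a b] R unfolding Q_def by blast
  have exQ: "\<exists>a\<in>V. Q x a" if x: "x \<in> elts F" for x
  proof -
    obtain a where "a \<in> {a \<in> V. R x a}" using ex[OF x] R by blast
    then obtain m where "m \<in> {a \<in> V. R x a}" "\<And>y. y \<^bold>\<in> m \<Longrightarrow> y \<notin> {a \<in> V. R x a}"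
      by (rule elem_minimal) blast
    then show ?thesis unfolding Q_def using in_V_elts by (intro bexI[of _ m]) auto
  qed
  have dR: "definable (\<lambda>e. R (t e) (s e))" if t: "dterm t" and s: "dterm s" for t s
  proof (rule definable_comp2[where Q = R, OF _ t s])
    show "definable (\<lambda>e. R (e 0) (e 1))" unfolding R_def
    proof (rule definable_ex, rule definable_conj)
      show "definable (\<lambda>e. ordinal (e (Suc 1)) \<and> e 0 = orec T (e (Suc 1)))"
        using definable_reindex[OF definable_orec, of "case_nat 0 (\<lambda>_. 2)"] by (simp add: numeral_2_eq_2)
      show "definable (\<lambda>e. P (e (Suc 0)) (e 0))" using P by simp
    qed
  qed
  have v: "vset {a \<in> V. \<exists>x\<in>elts F. Q x a}"
  proof (rule vset_repl[OF _ vset_elts[OF F]])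
    show "definable (\<lambda>e. Q (e (Suc 0)) (e 0))" unfolding Q_def by (intro definable_intros dR dterm_var)
  qed (use unique in blast)
  define S where "S = {a \<in> V. \<exists>x\<in>elts F. Q x a}"
  have vS: "vset S" using v unfolding S_def .
  have SV: "a \<in> V" if "a \<in> S" for a using that unfolding S_def by blast
  have So: "ordinal a" if "a \<in> S" for a using that R unfolding S_def Q_def by blast
  have vsuc: "vset (suc ` S)" by (rule vset_image[OF _ vS]) (intro dterm_suc dterm_var)
  have vU: "vset (\<Union>a\<in>S. insert a (elts a))"
    using vset_Union[OF vset_in_V[OF vsuc]] vsuc elts_suc SV by simp
  \<comment> \<open>The union of the successors, so that each least witness becomes a member of
    m.\<close>
  define m where "m = the_set (\<Union>a\<in>S. insert a (elts a))"
  have em: "elts m = (\<Union>a\<in>S. insert a (elts a))" unfolding m_def using vU by simp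
  show thesis
  proof (rule that[of m])
    show "m \<in> V" unfolding m_def using vset_in_V[OF vU] .
    show "ordinal m" unfolding ordinal_def em
    proof (intro conjI ballI)
      fix x assume "x \<in> (\<Union>a\<in>S. insert a (elts a))"
      then obtain a where a: "a \<in> S" "x = a \<or> x \<in> elts a" by blast
      then show "elts x \<subseteq> (\<Union>a\<in>S. insert a (elts a))" using ordinal_trans[OF So] by blast
      fix y assume "y \<in> elts x"
      moreover have "ordinal x" using a So ordinal_elem by blast
      ultimately show "elts y \<subseteq> elts x" unfolding ordinal_def by blast
    qed
    show "\<exists>b\<in>elts m. P x (orec T b)" if "x \<in> elts F" for x
      using exQ[OF that] that R unfolding em S_def Q_def by blast
  qed
qed

end

end

subsection \<open>Measurable sets and measures\<close>

locale structures = zfc V for V :: "'u::set_universe set" +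
  fixes \<kappa> X L :: 'u
  assumes kappa: "\<kappa> \<in> V" "ordinal \<kappa>" "infinite (elts \<kappa>)"
    and X: "X \<in> V"
    and lang: "relational_language V L"
begin

abbreviation "syms \<equiv> symbols V L"
abbreviation "ar \<equiv> arity L"
abbreviation "Strs \<equiv> Str V X L"
abbreviation "Sig \<equiv> sigma V \<kappa> X L"

lemma L_in_V: "L \<in> V" and L_fun: "is_fun L syms (range num)"
  using lang unfolding relational_language_def by auto

lemma arity_iff: "pair R (num n) \<in> elts L \<longleftrightarrow> R \<in> syms \<and> n = ar R"
proof
  assume "pair R (num n) \<in> elts L"
  then have "R \<in> syms" "app L R = num n" using is_fun_mem_iff[OF L_fun] by auto
  then show "R \<in> syms \<and> n = ar R" unfolding arity_def by simp
next
  assume R: "R \<in> syms \<and> n = ar R"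
  then obtain m where "app L R = num m" using is_fun_app(2)[OF L_fun] by blast
  then have "n = m" using R unfolding arity_def by simp
  then show "pair R (num n) \<in> elts L"
    using is_fun_mem_iff[OF L_fun] R \<open>app L R = num m\<close> by simp
qed

lemma vset_syms: "vset syms"
proof -
  have "syms = {x. \<exists>y. pair x y \<in> elts L}"
    using is_fun_mem_iff[OF L_fun] is_fun_app(1)[OF L_fun] by auto
  then show ?thesis using vset_dom[OF L_in_V] by simp
qed

definition "sym_set = the_set syms"

lemma elts_sym_set: "elts sym_set = syms" and sym_set_in_V: "sym_set \<in> V"
  unfolding sym_set_def using vset_syms vset_in_V by auto

lemma syms_V: "R \<in> syms \<Longrightarrow> R \<in> V"
  using vset_subset[OF vset_syms] by blast

text \<open>Replaces the HOL lists of \<open>tuples\<close> by functions of V, for which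
  \<open>definable_is_fun\<close> applies.\<close>

lemma tuples_iff: "s \<in> seq ` tuples X n \<longleftrightarrow> is_fun s (elts (num n)) (elts X)"
proof
  assume "s \<in> seq ` tuples X n"
  then obtain xs where xs: "set xs \<subseteq> elts X" "length xs = n" "s = seq xs" unfolding tuples_def by blast
  then have xV: "set xs \<subseteq> V" using elts_subset[OF X] by blast
  show "is_fun s (elts (num n)) (elts X)"
    unfolding xs(3) xs(2)[symmetric]
    by (rule is_fun_cong[OF seq_is_fun(1)[OF xV]])
      (use seq_is_fun(2)[OF xV] xs(1) in \<open>auto simp: elts_num\<close>)
next
  assume f: "is_fun s (elts (num n)) (elts X)"
  show "s \<in> seq ` tuples X n"
    unfolding tuples_def
    using is_fun_num_seq[OF f] by (intro image_eqI[where f = seq]) auto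
qed

lemma tuples_subset_V: "xs \<in> tuples X n \<Longrightarrow> set xs \<subseteq> V"
  unfolding tuples_def using elts_subset[OF X] by blast

lemma tuples_Seqs: "xs \<in> tuples X n \<Longrightarrow> seq xs \<in> elts (Seqs X)"
  unfolding tuples_def elts_Seqs[OF X] by blast

lemma vset_Str: "vset Strs"
proof -
  define PS where "PS = the_set {y \<in> V. elts y \<subseteq> elts (Seqs X)}"
  have vPS: "vset {y \<in> V. elts y \<subseteq> elts (Seqs X)}" by (rule vset_Pow[OF Seqs_in_V[OF X]])
  have ePS: "elts PS = {y \<in> V. elts y \<subseteq> elts (Seqs X)}" and PSV: "PS \<in> V"
    unfolding PS_def using vPS vset_in_V by auto
  define Pr where "Pr = the_set {pair x y |x y. x \<in> elts sym_set \<and> y \<in> elts PS}"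
  have vPr: "vset {pair x y |x y. x \<in> elts sym_set \<and> y \<in> elts PS}"
    by (intro vset_times vset_elts sym_set_in_V PSV)
  have ePr: "elts Pr = {pair x y |x y. x \<in> elts sym_set \<and> y \<in> elts PS}" and PrV: "Pr \<in> V"
    unfolding Pr_def using vPr vset_in_V by auto
  \<comment> \<open>The definition of a structure, with \<open>app\<close> and \<open>arity\<close>
    replaced by pairs belonging to M and L, so that the condition is definable.\<close>
  define Q where "Q = (\<lambda>M. is_fun M (elts sym_set) (elts PS) \<and> (\<forall>R\<in>elts sym_set. \<forall>y\<in>elts PS. \<forall>n\<in>elts omega.
     pair R y \<in> elts M \<and> pair R n \<in> elts L \<longrightarrow> (\<forall>s\<in>elts y. is_fun s (elts n) (elts X))))"
  have "vset {M \<in> {y \<in> V. elts y \<subseteq> elts Pr}. Q M}"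
    unfolding Q_def
    by (rule vset_sep[OF _ vset_Pow[OF PrV]])
      (intro definable_intros definable_is_fun dterm_var dterm_pair dterm_const sym_set_in_V PSV omega_in_V L_in_V X)
  moreover have "{M \<in> {y \<in> V. elts y \<subseteq> elts Pr}. Q M} = Strs"
  proof (intro set_eqI iffI)
    fix M assume "M \<in> {M \<in> {y \<in> V. elts y \<subseteq> elts Pr}. Q M}"
    then have M: "M \<in> V" "is_fun M syms (elts PS)" and Q: "Q M"
      unfolding Q_def elts_sym_set by auto
    have "is_fun M syms V" using is_fun_cong[OF M(2)] is_fun_app(2)[OF M(2)] in_V_elts[OF PSV] by blast
    moreover have "elts (app M R) \<subseteq> seq ` tuples X (ar R)" if R: "R \<in> syms" for R
      using Q is_fun_app[OF M(2) R] R arity_iff[of R "ar R"]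
      unfolding Q_def elts_sym_set elts_omega tuples_iff subset_eq by blast
    ultimately show "M \<in> Strs" unfolding Str_def using M(1) by blast
  next
    fix M assume M: "M \<in> Strs"
    then have MV: "M \<in> V" and f: "is_fun M syms V"
      and s: "\<And>R. R \<in> syms \<Longrightarrow> elts (app M R) \<subseteq> seq ` tuples X (ar R)"
      unfolding Str_def by auto
    have PS: "app M R \<in> elts PS" if "R \<in> syms" for R
      using s[OF that] is_fun_app(2)[OF f that] tuples_Seqs unfolding ePS by blast
    have f': "is_fun M (elts sym_set) (elts PS)" unfolding elts_sym_set by (rule is_fun_cong[OF f PS])
    moreover have "elts M \<subseteq> elts Pr" unfolding is_fun_elts[OF f] ePr elts_sym_set using PS by auto
    moreover have "is_fun s (elts n) (elts X)"
      if *: "R \<in> elts sym_set" "n \<in> elts omega" "pair R y \<in> elts M" "pair R n \<in> elts L" "s \<in> elts y" for R n y s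
    proof -
      obtain m where m: "n = num m" using *(2) elts_omega by blast
      then have "m = ar R" "y = app M R" using * arity_iff is_fun_mem_iff[OF f] by auto
      then show ?thesis using s[of R] * tuples_iff m unfolding elts_sym_set by blast
    qed
    ultimately show "M \<in> {M \<in> {y \<in> V. elts y \<subseteq> elts Pr}. Q M}" unfolding Q_def using MV by blast
  qed
  ultimately show ?thesis by simp
qed

definition "Str_set = the_set Strs"

lemma elts_Str_set: "elts Str_set = Strs" and Str_set_in_V: "Str_set \<in> V"
  unfolding Str_set_def using vset_Str vset_in_V by auto

lemma Str_fun: "M \<in> Strs \<Longrightarrow> is_fun M syms V" and Str_in_V: "M \<in> Strs \<Longrightarrow> M \<in> V"
  and Str_tuples: "M \<in> Strs \<Longrightarrow> R \<in> syms \<Longrightarrow> elts (app M R) \<subseteq> seq ` tuples X (ar R)"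
  unfolding Str_def by auto

lemma instance_set_V: "instance_of V X L l a \<Longrightarrow> set a \<subseteq> V"
  unfolding instance_of_def using elts_subset[OF X] by blast

lemma vset_sat_lit: "instance_of V X L l a \<Longrightarrow> vset {M \<in> Strs. sat_lit M a l}"
proof (induction l)
  case (Atom R vs)
  let ?s = "seq (map ((!) a) vs)"
  have R: "R \<in> syms" using Atom unfolding instance_of_def by simp
  have "set (map ((!) a) vs) \<subseteq> V"
    using Atom instance_set_V[OF Atom] unfolding instance_of_def by (auto simp: subset_eq)
  then have sV: "?s \<in> V" by (rule seq_in_V)
  have "vset {M \<in> Strs. \<exists>y\<in>V. pair R y \<in> elts M \<and> ?s \<in> elts y}"
    by (intro vset_sep[OF _ vset_Str] definable_intros dterm_var dterm_pair dterm_const syms_V[OF R] sV)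
  moreover have "(\<exists>y\<in>V. pair R y \<in> elts M \<and> ?s \<in> elts y) \<longleftrightarrow> sat_lit M a (Atom R vs)" if "M \<in> Strs" for M
    using is_fun_mem_iff[OF Str_fun[OF that]] is_fun_app[OF Str_fun[OF that] R] R by (auto simp: holds_def)
  then have "{M \<in> Strs. \<exists>y\<in>V. pair R y \<in> elts M \<and> ?s \<in> elts y} = {M \<in> Strs. sat_lit M a (Atom R vs)}"
    by blast
  ultimately show ?case by simp
next
  case (Equal i j)
  show ?case by (cases "a ! i = a ! j") (auto simp: vset_Str vset_empty)
next
  case (Neg l)
  have "{M \<in> Strs. sat_lit M a (Neg l)} = Strs - {M \<in> Strs. sat_lit M a l}" by auto
  then show ?case using Neg vset_Diff[OF vset_Str] unfolding instance_of_def by simp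
qed

lemma sigma_in_V: "A \<in> Sig \<Longrightarrow> A \<in> V \<and> elts A \<subseteq> Strs"
proof (induction rule: sigma.induct)
  case (basic l a)
  then show ?case using vset_sat_lit[OF basic] vset_in_V by auto
next
  case (compl A)
  then have "vset (Strs - elts A)" by (intro vset_Diff vset_Str vset_elts) auto
  then show ?case using vset_in_V by auto
next
  case (union F)
  then show ?case using vset_Union[OF union(1)] vset_in_V by auto
qed

definition meas :: "'u set \<Rightarrow> bool" where
  "meas S \<longleftrightarrow> vset S \<and> the_set S \<in> Sig"

lemma meas_elts: "A \<in> Sig \<Longrightarrow> meas (elts A)"
  unfolding meas_def using sigma_in_V by auto

lemma measE: assumes "meas S" obtains A where "A \<in> Sig" "elts A = S" "the_set S = A"
  using assms unfolding meas_def by auto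

lemma meas_subset: "meas S \<Longrightarrow> S \<subseteq> Strs"
  unfolding meas_def using sigma_in_V[of "the_set S"] by auto

lemma meas_vset: "meas S \<Longrightarrow> vset S"
  unfolding meas_def by auto

lemma meas_sat_lit: "instance_of V X L l a \<Longrightarrow> meas {M \<in> Strs. sat_lit M a l}"
  unfolding meas_def using vset_sat_lit sigma.basic by blast

lemma meas_compl: assumes "meas S" shows "meas (Strs - S)"
proof -
  obtain A where A: "A \<in> Sig" "elts A = S" using assms by (rule measE)
  then show ?thesis unfolding meas_def using sigma.compl[OF A(1)] vset_Diff[OF vset_Str meas_vset[OF assms]] by simp
qed

text \<open>Sequences of measurable sets that are elements of V; sigma-additivity speaks about these
  alone, so each limit argument has to produce such a sequence.\<close>

definition iseq :: "(nat \<Rightarrow> 'u set) \<Rightarrow> bool" where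
  "iseq A \<longleftrightarrow> (\<exists>f\<in>V. is_fun f (range num) Sig \<and> (\<forall>n. elts (app f (num n)) = A n))"

lemma iseqI:
  assumes "dterm (\<lambda>e. s (e 0))" "\<And>n. s (num n) \<in> Sig" "\<And>n. A n = elts (s (num n))"
  shows "iseq A"
proof -
  have "s ` range num \<subseteq> Sig" using assms(2) by auto
  from fun_in_V[OF assms(1) vset_range_num this] obtain f where
    "f \<in> V" "is_fun f (range num) Sig" "\<And>x. x \<in> range num \<Longrightarrow> app f x = s x" by blast
  then show ?thesis unfolding iseq_def using assms(3) by auto
qed

text \<open>A family enumerated by an ordinal inside kappa embeds into kappa by sending each member
  to its least index.\<close>

lemma card_le_kappa_image:
  assumes a: "a \<in> V" "ordinal a" "elts a \<subseteq> elts \<kappa>" and f: "f \<in> V" "is_fun f (elts a) B"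
  shows "vset (app f ` elts a)" "card_le_kappa V \<kappa> (the_set (app f ` elts a))"
proof -
  have t: "tapp f i = app f i" if "i \<in> elts a" for i
    by (rule tapp_eqI[OF f(1)]) (use is_fun_mem_iff[OF f(2)] that in auto)
  have "vset ((\<lambda>x. tapp f x) ` elts a)"
    by (rule vset_image[OF _ vset_elts[OF a(1)]]) (intro dterm_tapp dterm_const dterm_var f)
  then show v: "vset (app f ` elts a)" using t by simp
  \<comment> \<open>The least index of A as a definable term: an ordinal is the set of its members,
    and m is below the least index exactly when no index up to m gives A.\<close>
  define s where "s = (\<lambda>A. the_set {m \<in> elts a. \<forall>k\<in>elts (suc m). pair k A \<notin> elts f})"
  have s: "\<exists>n\<in>elts a. app f n = A \<and> s A = n" if A: "A \<in> app f ` elts a" for A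
  proof -
    obtain i where "i \<in> {i \<in> elts a. app f i = A}" using A by blast
    then obtain n where n: "n \<in> {i \<in> elts a. app f i = A}"
      and min: "\<And>y. y \<^bold>\<in> n \<Longrightarrow> y \<notin> {i \<in> elts a. app f i = A}"
      by (rule elem_minimal) blast
    have "(\<forall>k\<in>elts (suc m). pair k A \<notin> elts f) \<longleftrightarrow> m \<in> elts n" if m: "m \<in> elts a" for m
    proof
      assume *: "\<forall>k\<in>elts (suc m). pair k A \<notin> elts f"
      have "pair n A \<in> elts f" using n is_fun_mem_iff[OF f(2)] by blast
      then have "n \<notin> elts (suc m)" using * by blast
      then show "m \<in> elts n"
        using ordinal_linear[OF ordinal_elem[OF a(2) m] ordinal_elem[OF a(2)], of n] n
        unfolding elts_suc[OF in_V_elts[OF a(1) m]] by blast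
    next
      assume "m \<in> elts n"
      then have "elts (suc m) \<subseteq> elts n"
        using ordinal_trans[OF ordinal_elem[OF a(2)], of n m] n
        unfolding elts_suc[OF in_V_elts[OF a(1) m]] by blast
      then show "\<forall>k\<in>elts (suc m). pair k A \<notin> elts f"
        using min unfolding is_fun_mem_iff[OF f(2)] by auto
    qed
    moreover have "elts n \<subseteq> elts a" using ordinal_trans[OF a(2)] n by blast
    ultimately have "{m \<in> elts a. \<forall>k\<in>elts (suc m). pair k A \<notin> elts f} = elts n" by blast
    then have "s A = n" unfolding s_def by simp
    then show ?thesis using n by blast
  qed
  have ts: "dterm (\<lambda>e. s (e 0))" unfolding s_def
    by (intro dterm_sep definable_intros dterm_suc dterm_pair dterm_const dterm_var a f)
  have "s ` app f ` elts a \<subseteq> elts \<kappa>"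
    using s a(3) by blast
  then obtain h where h: "h \<in> V" "is_fun h (app f ` elts a) (elts \<kappa>)"
      "\<And>x. x \<in> app f ` elts a \<Longrightarrow> app h x = s x"
    using fun_in_V[OF ts v] by blast
  have "inj_on (app h) (app f ` elts a)"
  proof (rule inj_onI)
    fix A B assume AB: "A \<in> app f ` elts a" "B \<in> app f ` elts a" "app h A = app h B"
    then have "s A = s B" using h(3) by metis
    then show "A = B" using s[OF AB(1)] s[OF AB(2)] by metis
  qed
  then show "card_le_kappa V \<kappa> (the_set (app f ` elts a))"
    unfolding card_le_kappa_def using h(1,2) v by auto
qed

lemma meas_UN_image:
  assumes a: "a \<in> V" "ordinal a" "elts a \<subseteq> elts \<kappa>" and f: "f \<in> V" "is_fun f (elts a) Sig"
  shows "meas (\<Union>i\<in>elts a. elts (app f i))"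
proof -
  note v = card_le_kappa_image[OF a f]
  have U: "(\<Union>b\<in>elts (the_set (app f ` elts a)). elts b) = (\<Union>i\<in>elts a. elts (app f i))"
    using v(1) by auto
  have "the_set (\<Union>b\<in>elts (the_set (app f ` elts a)). elts b) \<in> Sig"
    by (rule sigma.union[OF vset_in_V[OF v(1)] v(2)]) (use v(1) is_fun_app(2)[OF f(2)] in auto)
  then show ?thesis unfolding meas_def using vset_Union[OF vset_in_V[OF v(1)]] U by simp
qed

lemma omega_le_kappa: "ordinal omega" "elts omega \<subseteq> elts \<kappa>"
proof -
  show "ordinal omega" unfolding ordinal_def elts_omega by (auto simp: elts_num)
  show "elts omega \<subseteq> elts \<kappa>" unfolding elts_omega using num_in_infinite_ordinal[OF kappa(2,3)] by blast
qed

lemma meas_UN: assumes "iseq A" shows "meas (\<Union>n. A n)"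
proof -
  obtain f where f: "f \<in> V" "is_fun f (range num) Sig" "\<And>n. elts (app f (num n)) = A n"
    using assms unfolding iseq_def by blast
  have "meas (\<Union>i\<in>elts omega. elts (app f i))"
    by (rule meas_UN_image[OF omega_in_V omega_le_kappa f(1)]) (use f(2) in \<open>simp add: elts_omega\<close>)
  then show ?thesis unfolding elts_omega using f(3) by simp
qed

lemma iseq_meas: "iseq A \<Longrightarrow> meas (A n)"
  unfolding iseq_def using is_fun_app(2) meas_elts by fastforce

text \<open>The sequence A, B, C, C, ... reduces finite unions to countable ones; with C empty it
  also yields finite additivity.\<close>

lemma iseq_three:
  assumes "meas A" "meas B" "meas C"
  shows "iseq (\<lambda>n. if n = 0 then A else if n = 1 then B else C)"
proof -
  obtain a where a: "a \<in> Sig" "elts a = A" using assms(1) by (rule measE)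
  obtain b where b: "b \<in> Sig" "elts b = B" using assms(2) by (rule measE)
  obtain c where c: "c \<in> Sig" "elts c = C" using assms(3) by (rule measE)
  show ?thesis
  proof (rule iseqI[of "\<lambda>x. if x = num 0 then a else if x = num 1 then b else c"])
    show "dterm (\<lambda>e. if e 0 = num 0 then a else if e 0 = num 1 then b else c)"
      using a b c sigma_in_V by (intro dterm_If definable_intros dterm_var dterm_const num_in_V) auto
  qed (use a b c in auto)
qed

lemma iseq_const: assumes "meas A" shows "iseq (\<lambda>n. A)"
proof -
  have "(\<lambda>n::nat. if n = 0 then A else if n = 1 then A else A) = (\<lambda>n. A)"
    by (rule ext) simp
  then show ?thesis using iseq_three[OF assms assms assms] by metis
qed

lemma UN_three: "(\<Union>n::nat. if n = 0 then A else if n = 1 then B else C) = A \<union> B \<union> C"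
proof (intro equalityI subsetI)
  fix x assume "x \<in> A \<union> B \<union> C"
  then consider "x \<in> A" | "x \<in> B" | "x \<in> C" by blast
  then show "x \<in> (\<Union>n::nat. if n = 0 then A else if n = 1 then B else C)"
  proof cases
    case 1 then show ?thesis by (intro UN_I[of 0]) auto
  next
    case 2 then show ?thesis by (intro UN_I[of 1]) auto
  next
    case 3 then show ?thesis by (intro UN_I[of 2]) auto
  qed
qed (auto split: if_splits)

lemma meas_Un: assumes "meas A" "meas B" shows "meas (A \<union> B)"
  using meas_UN[OF iseq_three[OF assms assms(2)]] unfolding UN_three by (simp add: Un_assoc)

lemma meas_Diff: assumes "meas A" "meas B" shows "meas (A - B)"
proof -
  have "A - B = Strs - ((Strs - A) \<union> B)" using meas_subset[OF assms(1)] by blast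
  then show ?thesis using meas_compl[OF meas_Un[OF meas_compl[OF assms(1)] assms(2)]] by simp
qed

lemma meas_Int: assumes "meas A" "meas B" shows "meas (A \<inter> B)"
  using meas_Diff[OF assms(1) meas_Diff[OF assms]] by (simp add: Diff_Diff_Int)

lemma meas_empty: "meas {}"
proof -
  have z: "elts (num 0) = ({} :: 'u set)" using elts_num[of 0] by simp
  \<comment> \<open>The empty set serves both as the family and as its injection into kappa.\<close>
  have "is_fun (num 0) (elts (num 0)) (elts \<kappa>)" unfolding is_fun_def z by simp
  then have "card_le_kappa V \<kappa> (num 0)"
    unfolding card_le_kappa_def using num_in_V[of 0] z by (intro bexI[of _ "num 0"]) auto
  from sigma.union[OF num_in_V this] show ?thesis unfolding meas_def using z vset_empty by simp
qed

lemma meas_Str: "meas Strs"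
  using meas_compl[OF meas_empty] by simp

section \<open>Real numbers as Dedekind cuts\<close>

lemma rat_code_inject: "rat_code p = (rat_code q :: 'u) \<longleftrightarrow> p = q"
proof
  assume e: "rat_code p = (rat_code q :: 'u)"
  obtain a b where p: "quotient_of p = (a, b)" by fastforce
  obtain c d where q: "quotient_of q = (c, d)" by fastforce
  have "b > 0" "d > 0" using quotient_of_denom_pos p q by auto
  then have "a = c" "b = d" using e unfolding rat_code_def p q by (auto split: if_splits)
  then show "p = q" using p q by (metis quotient_of_inject)
qed simp

lemma codes_real_mem: "codes_real (x::'u) r \<Longrightarrow> rat_code q \<in> elts x \<longleftrightarrow> real_of_rat q < r"
  unfolding codes_real_def using rat_code_inject by auto

text \<open>If s < r, a rational strictly between them lies in the cut of r and not in that of s.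
  Comparison of reals thus becomes inclusion of elements of V, which is definable.\<close>

lemma codes_real_le_iff:
  assumes "codes_real (x::'u) r" "codes_real y s"
  shows "elts x \<subseteq> elts y \<longleftrightarrow> r \<le> s"
proof
  assume sub: "elts x \<subseteq> elts y"
  show "r \<le> s"
  proof (rule ccontr)
    assume "\<not> r \<le> s"
    then obtain q where q: "s < real_of_rat q" "real_of_rat q < r" using of_rat_dense[of s r] by auto
    then have "rat_code q \<in> elts y" using codes_real_mem[OF assms(1)] sub by blast
    then show False using codes_real_mem[OF assms(2)] q by simp
  qed
next
  assume "r \<le> s"
  then show "elts x \<subseteq> elts y" using assms unfolding codes_real_def by auto
qed

lemma codes_real_real_of_set: "codes_real (x::'u) r \<Longrightarrow> real_of_set x = r"
  unfolding real_of_set_def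
  by (rule the_equality) (auto intro!: antisym simp flip: codes_real_le_iff)

end

section \<open>Elementary properties of a measure\<close>

locale kmeasure = structures V \<kappa> X L for V :: "'u::set_universe set" and \<kappa> X L +
  fixes \<mu> :: 'u
  assumes prob: "probability_kappa_measure V \<kappa> X L \<mu>"
begin

lemma mu_in_V: "\<mu> \<in> V" and mu_fun: "is_fun \<mu> Sig {x \<in> V. \<exists>r. codes_real x r}"
  using prob unfolding probability_kappa_measure_def by auto

lemma codes_app: "A \<in> Sig \<Longrightarrow> codes_real (app \<mu> A) (val \<mu> A)"
  unfolding val_def using is_fun_app(2)[OF mu_fun] codes_real_real_of_set by force

text \<open>The inductively generated family is a set of V because it is the domain of the function
  \<open>\<mu>\<close>, so Separation can be applied to it.\<close>

lemma vset_Sig: "vset Sig"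
proof -
  have "Sig = {x. \<exists>y. pair x y \<in> elts \<mu>}"
    using is_fun_mem_iff[OF mu_fun] is_fun_app(1)[OF mu_fun] by auto
  then show ?thesis using vset_dom[OF mu_in_V] by simp
qed

definition mu :: "'u set \<Rightarrow> real" where
  "mu S = val \<mu> (the_set S)"

lemma mu_elts [simp]: "mu (elts A) = val \<mu> A"
  unfolding mu_def by simp

lemma mu_nonneg: "meas S \<Longrightarrow> 0 \<le> mu S"
  using prob unfolding probability_kappa_measure_def mu_def meas_def by auto

lemma mu_Str: "mu Strs = 1"
  using prob unfolding probability_kappa_measure_def mu_def by auto

lemma mu_UN:
  assumes "iseq A" "disjoint_family A"
  shows "(\<lambda>n. mu (A n)) sums mu (\<Union>n. A n)"
proof -
  obtain f where f: "f \<in> V" "is_fun f (range num) Sig" "\<And>n. elts (app f (num n)) = A n"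
    using assms(1) unfolding iseq_def by blast
  have "disjoint_family_on (\<lambda>i. elts (app f i)) (range num)"
    using assms(2) f(3) unfolding disjoint_family_on_def by auto
  then have "((\<lambda>i. val \<mu> (app f i)) has_sum val \<mu> (the_set (\<Union>i\<in>range num. elts (app f i)))) (range num)"
    using prob f unfolding probability_kappa_measure_def additive_over_def by blast
  then have "((\<lambda>n. val \<mu> (app f (num n))) has_sum mu (\<Union>n. A n)) UNIV"
    using has_sum_reindex[of "num :: nat \<Rightarrow> 'u" UNIV "\<lambda>i. val \<mu> (app f i)"] f(3)
    unfolding mu_def o_def image_image by (simp add: inj_on_def)
  then have "((\<lambda>n. mu (A n)) has_sum mu (\<Union>n. A n)) UNIV"
    using f(3) by (metis (no_types, lifting) has_sum_cong mu_elts)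
  then show ?thesis by (rule has_sum_imp_sums)
qed

text \<open>The constant empty sequence is disjoint, and a convergent series has terms tending to
  0.\<close>

lemma mu_empty: "mu {} = 0"
proof -
  have "(\<lambda>n. mu {}) sums mu (\<Union>n::nat. {})"
    by (rule mu_UN) (auto intro: iseq_const meas_empty simp: disjoint_family_on_def)
  then have "(\<lambda>n::nat. mu {}) \<longlonglongrightarrow> 0" using sums_summable summable_LIMSEQ_zero by blast
  then show ?thesis by (simp add: LIMSEQ_const_iff)
qed

lemma mu_Un:
  assumes "meas A" "meas B" "A \<inter> B = {}"
  shows "mu (A \<union> B) = mu A + mu B"
proof -
  let ?C = "\<lambda>n::nat. if n = 0 then A else if n = 1 then B else {}"
  have U: "(\<Union>n. ?C n) = A \<union> B" unfolding UN_three by simp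
  have "disjoint_family ?C" using assms(3) unfolding disjoint_family_on_def by auto
  then have "(\<lambda>n. mu (?C n)) sums mu (A \<union> B)"
    using mu_UN[OF iseq_three[OF assms(1,2) meas_empty]] U by simp
  moreover have "(\<lambda>n. mu (?C n)) sums (\<Sum>n\<in>{0,1}. mu (?C n))"
    by (rule sums_finite) (auto simp: mu_empty)
  ultimately show ?thesis using sums_unique2 by fastforce
qed

lemma mu_Diff: assumes "meas A" "meas B" "B \<subseteq> A" shows "mu (A - B) = mu A - mu B"
proof -
  have "A = B \<union> (A - B)" using assms(3) by blast
  then show ?thesis using mu_Un[OF assms(2) meas_Diff[OF assms(1,2)]] by simp
qed

lemma mu_mono: "meas A \<Longrightarrow> meas B \<Longrightarrow> B \<subseteq> A \<Longrightarrow> mu B \<le> mu A"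
  using mu_Diff[of A B] mu_nonneg[OF meas_Diff, of A B] by simp

lemma mu_Int_Diff: "meas A \<Longrightarrow> meas B \<Longrightarrow> mu A = mu (A \<inter> B) + mu (A - B)"
  using mu_Diff[of A "A \<inter> B"] meas_Int[of A B] by (simp add: Diff_Int_distrib2 Diff_Int)

lemma mu_sums_Int:
  assumes "iseq A" "disjoint_family A" "meas B" "B \<subseteq> (\<Union>n. A n)" "iseq (\<lambda>n. A n \<inter> B)"
  shows "(\<lambda>n. mu (A n \<inter> B)) sums mu B"
proof -
  have "(\<Union>n. A n \<inter> B) = B" using assms(4) by blast
  moreover have "disjoint_family (\<lambda>n. A n \<inter> B)"
    using assms(2) unfolding disjoint_family_on_def by blast
  ultimately show ?thesis using mu_UN[OF assms(5)] by simp
qed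

end

subsection \<open>The action of permutations\<close>

context structures
begin

abbreviation "Syms \<equiv> Sym V X"

lemma Sym_in_V: "g \<in> Syms \<Longrightarrow> g \<in> V" and Sym_fun: "g \<in> Syms \<Longrightarrow> is_fun g (elts X) (elts X)"
  and Sym_bij: "g \<in> Syms \<Longrightarrow> bij_betw (app g) (elts X) (elts X)"
  unfolding Sym_def by auto

lemma Sym_inverse:
  assumes g: "g \<in> Syms"
  obtains h where "h \<in> Syms" "\<forall>x\<in>elts X. app h (app g x) = x"
    "\<forall>x\<in>elts X. app g (app h x) = x"
proof -
  let ?s = "inv_into (elts X) (app g)"
  note bij = Sym_bij[OF g]
  note s = bij_betw_inv_into[OF bij]
  have "vset {p \<in> {pair x y |x y. x \<in> elts X \<and> y \<in> elts X}.
      \<exists>x\<in>elts X. \<exists>y\<in>elts X. p = pair y x \<and> pair x y \<in> elts g}"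
    by (rule vset_sep[OF _ vset_times[OF vset_elts vset_elts]])
      (intro definable_intros dterm_var dterm_pair dterm_const X Sym_in_V[OF g])+
  moreover have "{p \<in> {pair x y |x y. x \<in> elts X \<and> y \<in> elts X}.
      \<exists>x\<in>elts X. \<exists>y\<in>elts X. p = pair y x \<and> pair x y \<in> elts g} = (\<lambda>y. pair y (?s y)) ` elts X"
    unfolding is_fun_mem_iff[OF Sym_fun[OF g]]
    using bij_betw_inv_into_left[OF bij] bij_betw_inv_into_right[OF bij] bij_betwE[OF bij] bij_betwE[OF s]
    by fastforce
  ultimately have v: "vset ((\<lambda>y. pair y (?s y)) ` elts X)" by simp
  define h where "h = the_set ((\<lambda>y. pair y (?s y)) ` elts X)"
  have h: "is_fun h (elts X) (elts X)" "\<And>x. x \<in> elts X \<Longrightarrow> app h x = ?s x"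
    using is_fun_graph[of h ?s "elts X" "elts X"] s v unfolding h_def bij_betw_def by auto
  have "bij_betw (app h) (elts X) (elts X)"
    using s by (rule bij_betw_cong[THEN iffD1, rotated]) (simp add: h(2))
  then have "h \<in> Syms" unfolding Sym_def using h(1) vset_in_V[OF v] h_def by blast
  then show thesis
    using that h(2) bij_betw_inv_into_left[OF bij] bij_betw_inv_into_right[OF bij] bij_betwE[OF bij]
    by metis
qed

lemma map_app_tuples: "g \<in> Syms \<Longrightarrow> xs \<in> tuples X n \<Longrightarrow> map (app g) xs \<in> tuples X n"
  unfolding tuples_def using is_fun_app(2)[OF Sym_fun] by auto

lemma map_app_inverse:
  "\<forall>x\<in>S. app g (app h x) = x \<Longrightarrow> set ys \<subseteq> S \<Longrightarrow> map (app g) (map (app h) ys) = ys"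
  by (induction ys) auto

text \<open>The action prescribes relations on translated tuples; as g is surjective on X, every
  tuple is of this form.\<close>

lemma Str_eqI:
  assumes g: "g \<in> Syms" and M: "M \<in> Strs" and N: "N \<in> Strs"
    and eq: "\<And>R xs. R \<in> syms \<Longrightarrow> xs \<in> tuples X (ar R) \<Longrightarrow>
      holds M R (map (app g) xs) \<longleftrightarrow> holds N R (map (app g) xs)"
  shows "M = N"
proof (rule is_fun_ext[OF Str_fun[OF M] Str_fun[OF N]])
  fix R assume R: "R \<in> syms"
  obtain h where h: "h \<in> Syms" "\<forall>x\<in>elts X. app g (app h x) = x"
    by (rule Sym_inverse[OF g])
  have *: "seq ys \<in> elts (app M R) \<longleftrightarrow> seq ys \<in> elts (app N R)" if ys: "ys \<in> tuples X (ar R)" for ys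
  proof -
    have "map (app g) (map (app h) ys) = ys"
      using ys unfolding tuples_def by (intro map_app_inverse[OF h(2)]) auto
    then show ?thesis
      using eq[OF R map_app_tuples[OF h(1) ys]] unfolding holds_def by simp
  qed
  have "elts (app M R) = elts (app N R)"
    using Str_tuples[OF M R] Str_tuples[OF N R] * by blast
  then show "app M R = app N R" by (simp add: elts_inject)
qed

definition pair_space :: 'u where "pair_space = the_set {pair x y |x y. x \<in> elts omega \<and> y \<in> elts X}"

lemma pair_space: "elts pair_space = {pair x y |x y. x \<in> elts omega \<and> y \<in> elts X}" "pair_space \<in> V"
  using vset_times[OF vset_elts[OF omega_in_V] vset_elts[OF X]] vset_in_V unfolding pair_space_def by auto

definition push_seq :: "'u \<Rightarrow> 'u \<Rightarrow> 'u" where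
  "push_seq g s = the_set {q \<in> elts pair_space. \<exists>i\<in>elts omega. \<exists>x\<in>elts X. pair i x \<in> elts s \<and> q = pair i (tapp g x)}"

text \<open>An explicit formula for \<open>act\<close>, which is a definite description and as such
  gives no term definable over V.\<close>

definition push :: "'u \<Rightarrow> 'u \<Rightarrow> 'u" where
  "push g M = the_set ((\<lambda>R. pair R (the_set (push_seq g ` elts (tapp M R)))) ` elts sym_set)"

lemma dterm_push_seq: "g \<in> V \<Longrightarrow> dterm t \<Longrightarrow> dterm (\<lambda>e. push_seq g (t e))"
  by (rule dterm_comp1[of "push_seq g"])
    (unfold push_seq_def, intro dterm_sep definable_intros dterm_var dterm_pair dterm_tapp dterm_const pair_space omega_in_V X)

lemma dterm_push: "g \<in> V \<Longrightarrow> dterm t \<Longrightarrow> dterm (\<lambda>e. push g (t e))"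
  by (rule dterm_comp1[of "push g"])
    (unfold push_def, intro dterm_image dterm_var dterm_pair dterm_tapp dterm_const dterm_push_seq sym_set_in_V)

lemma push_seq_seq:
  assumes g: "g \<in> Syms" and xs: "xs \<in> tuples X n"
  shows "push_seq g (seq xs) = seq (map (app g) xs)"
proof -
  have t: "tapp g x = app g x" if "x \<in> elts X" for x
    by (rule tapp_eqI[OF Sym_in_V[OF g]]) (use is_fun_mem_iff[OF Sym_fun[OF g]] that in auto)
  note xV = tuples_subset_V[OF xs]
  note gV = tuples_subset_V[OF map_app_tuples[OF g xs]]
  have xX: "xs ! i \<in> elts X" if "i < length xs" for i
    using xs that nth_mem unfolding tuples_def by blast
  have "{q \<in> elts pair_space. \<exists>i\<in>elts omega. \<exists>x\<in>elts X. pair i x \<in> elts (seq xs) \<and> q = pair i (tapp g x)} =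
      elts (seq (map (app g) xs))"
    unfolding elts_seq[OF gV] pair_space elts_omega pair_mem_seq[OF xV]
    using xX t is_fun_app(2)[OF Sym_fun[OF g]] by fastforce
  then show ?thesis unfolding push_seq_def by simp
qed

text \<open>\<open>push g M\<close> satisfies the condition that defines \<open>act\<close>, and
  \<open>Str_eqI\<close> shows that nothing else does.\<close>

lemma act_push:
  assumes g: "g \<in> Syms" and M: "M \<in> Strs"
  shows "act V X L g M = push g M" "push g M \<in> Strs"
    "R \<in> syms \<Longrightarrow> xs \<in> tuples X (ar R) \<Longrightarrow>
      holds (push g M) R (map (app g) xs) \<longleftrightarrow> holds M R xs"
proof -
  note MV = Str_in_V[OF M]
  have t: "tapp M R = app M R" if "R \<in> syms" for R
    by (rule tapp_eqI[OF MV]) (use is_fun_mem_iff[OF Str_fun[OF M]] that in auto)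
  have v: "vset ((\<lambda>R. pair R (the_set (push_seq g ` elts (tapp M R)))) ` elts sym_set)"
    by (rule vset_image)
      (intro dterm_image dterm_var dterm_pair dterm_tapp dterm_const dterm_push_seq Sym_in_V g vset_elts sym_set_in_V MV)+
  have vR: "vset (push_seq g ` elts (app M R))" if "R \<in> syms" for R
    by (rule vset_image)
      (intro dterm_var dterm_push_seq Sym_in_V g vset_elts is_fun_app(2)[OF Str_fun[OF M]] that)+
  have V: "the_set (push_seq g ` elts (tapp M R)) \<in> V" if "R \<in> syms" for R
    using vset_in_V[OF vR[OF that]] t[OF that] by simp
  have f: "is_fun (push g M) syms V"
    and app: "\<And>R. R \<in> syms \<Longrightarrow> app (push g M) R = the_set (push_seq g ` elts (tapp M R))"
    using is_fun_graph[of "push g M" _ "elts sym_set" V, OF vset_elts_the_set[OF v, folded push_def]] V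
    unfolding elts_sym_set by auto
  have mem: "elts (app (push g M) R) = {seq (map (app g) xs) |xs. xs \<in> tuples X (ar R) \<and> holds M R xs}"
    if R: "R \<in> syms" for R
  proof -
    have "elts (app (push g M) R) = push_seq g ` elts (app M R)"
      unfolding app[OF R] t[OF R] by (rule vset_elts_the_set[OF vR[OF R]])
    moreover have "elts (app M R) = seq ` {xs \<in> tuples X (ar R). holds M R xs}"
      using Str_tuples[OF M R] unfolding holds_def by auto
    moreover have "push_seq g ` seq ` {xs \<in> tuples X (ar R). holds M R xs} =
        (\<lambda>xs. seq (map (app g) xs)) ` {xs \<in> tuples X (ar R). holds M R xs}"
      unfolding image_image using push_seq_seq[OF g] by (intro image_cong) auto
    ultimately show ?thesis by auto
  qed
  show S: "push g M \<in> Strs"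
    unfolding Str_def using f v vset_in_V[OF v] mem map_app_tuples[OF g] by (auto simp flip: push_def)
  have inj: "map (app g) xs = map (app g) ys \<longleftrightarrow> xs = ys"
    if "xs \<in> tuples X n" "ys \<in> tuples X n" for xs ys n
    using that bij_betw_imp_inj_on[OF Sym_bij[OF g]] unfolding tuples_def
    by (metis (no_types, lifting) inj_on_map_eq_map inj_on_subset mem_Collect_eq sup.boundedI)
  show spec: "holds (push g M) R (map (app g) xs) \<longleftrightarrow> holds M R xs"
    if R: "R \<in> syms" and xs: "xs \<in> tuples X (ar R)" for R xs
  proof -
    have "seq (map (app g) xs) = seq (map (app g) ys) \<longleftrightarrow> xs = ys" if ys: "ys \<in> tuples X (ar R)" for ys
      using seq_inject[OF tuples_subset_V tuples_subset_V] map_app_tuples[OF g] xs ys inj by metis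
    then show ?thesis unfolding holds_def[of "push g M"] mem_elts[symmetric] mem[OF R] using xs by auto
  qed
  show "act V X L g M = push g M"
    unfolding act_def
  proof (rule the_equality)
    show "push g M \<in> Strs \<and> (\<forall>R\<in>syms. \<forall>xs\<in>tuples X (ar R).
        holds (push g M) R (map (app g) xs) \<longleftrightarrow> holds M R xs)"
      using S spec by blast
    fix N assume "N \<in> Strs \<and> (\<forall>R\<in>syms. \<forall>xs\<in>tuples X (ar R). holds N R (map (app g) xs) \<longleftrightarrow> holds M R xs)"
    then show "N = push g M" using Str_eqI[OF g _ S] spec by blast
  qed
qed

lemma push_inverse:
  assumes g: "g \<in> Syms" and h: "h \<in> Syms" and inv: "\<forall>x\<in>elts X. app g (app h x) = x"
    and M: "M \<in> Strs"
  shows "push g (push h M) = M"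
proof (rule Str_eqI[OF g])
  note hM = act_push(2)[OF h M]
  show "push g (push h M) \<in> Strs" by (rule act_push(2)[OF g hM])
  show "M \<in> Strs" by (rule M)
  fix R xs assume R: "R \<in> syms" and xs: "xs \<in> tuples X (ar R)"
  have m: "map (app g) xs \<in> tuples X (ar R)" by (rule map_app_tuples[OF g xs])
  have id: "map (app g) (map (app h) (map (app g) xs)) = map (app g) xs"
    using m unfolding tuples_def by (intro map_app_inverse[OF inv]) auto
  have hm: "map (app h) (map (app g) xs) \<in> tuples X (ar R)" by (rule map_app_tuples[OF h m])
  have "holds (push g (push h M)) R (map (app g) xs) \<longleftrightarrow>
      holds (push h M) R (map (app h) (map (app g) xs))"
    using act_push(3)[OF g hM R hm] unfolding id .
  also have "\<dots> \<longleftrightarrow> holds M R (map (app g) xs)" by (rule act_push(3)[OF h M R m])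
  finally show "holds (push g (push h M)) R (map (app g) xs) \<longleftrightarrow> holds M R (map (app g) xs)" .
qed

lemma sat_lit_push:
  assumes g: "g \<in> Syms" and M: "M \<in> Strs"
  shows "instance_of V X L l a \<Longrightarrow> sat_lit (push g M) (map (app g) a) l \<longleftrightarrow> sat_lit M a l"
proof (induction l)
  case (Atom R vs)
  then have R: "R \<in> syms" "length vs = ar R" and vs: "set vs \<subseteq> {..<length a}" and a: "set a \<subseteq> elts X"
    unfolding instance_of_def by auto
  have t: "map ((!) a) vs \<in> tuples X (ar R)" unfolding tuples_def using R vs a by (auto simp: subset_eq)
  have e: "map ((!) (map (app g) a)) vs = map (app g) (map ((!) a) vs)" using vs by auto
  show ?case unfolding sat_lit.simps e by (rule act_push(3)[OF g M R(1) t])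
next
  case (Equal i j)
  then have "i < length a" "j < length a" "a ! i \<in> elts X" "a ! j \<in> elts X"
    unfolding instance_of_def by auto
  then show ?case using bij_betw_imp_inj_on[OF Sym_bij[OF g]] by (auto dest: inj_onD)
next
  case (Neg l)
  then show ?case unfolding instance_of_def by simp
qed

text \<open>Turns an image into a preimage under the inverse permutation; preimages commute with
  complements and are easy to compute for literals.\<close>

lemma push_image_eq:
  assumes g: "g \<in> Syms" and h: "h \<in> Syms" and inv: "\<forall>x\<in>elts X. app g (app h x) = x"
    "\<forall>x\<in>elts X. app h (app g x) = x" and A: "A \<subseteq> Strs"
  shows "push g ` A = {M \<in> Strs. push h M \<in> A}"
proof (intro set_eqI iffI)
  fix M assume "M \<in> push g ` A"
  then show "M \<in> {M \<in> Strs. push h M \<in> A}"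
    using A act_push(2)[OF g] push_inverse[OF h g inv(2)] by auto
next
  fix M assume "M \<in> {M \<in> Strs. push h M \<in> A}"
  then show "M \<in> push g ` A" using push_inverse[OF g h inv(1)] by (metis (no_types, lifting) image_eqI mem_Collect_eq)
qed

text \<open>Induction over the generation of measurable sets. A literal goes to the same literal at
  the translated tuple. In the union case the translated family must again be a set of V that embeds
  into kappa.\<close>

lemma meas_push:
  assumes g: "g \<in> Syms" and A: "A \<in> Sig"
  shows "meas (push g ` elts A)"
  using A
proof (induction rule: sigma.induct)
  case (basic l a)
  obtain h where h: "h \<in> Syms" "\<forall>x\<in>elts X. app h (app g x) = x"
    "\<forall>x\<in>elts X. app g (app h x) = x" by (rule Sym_inverse[OF g])
  have a: "set a \<subseteq> elts X" using basic unfolding instance_of_def by blast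
  have i: "instance_of V X L l (map (app g) a)"
    using basic is_fun_app(2)[OF Sym_fun[OF g]] unfolding instance_of_def by auto
  have "sat_lit (push h M) a l \<longleftrightarrow> sat_lit M (map (app g) a) l" if "M \<in> Strs" for M
  proof -
    have "map (app h) (map (app g) a) = a" by (rule map_app_inverse[OF h(2) a])
    then show ?thesis using sat_lit_push[OF h(1) that i] by simp
  qed
  then have "push g ` {M \<in> Strs. sat_lit M a l} = {M \<in> Strs. sat_lit M (map (app g) a) l}"
    using push_image_eq[OF g h(1,3,2)] act_push(2)[OF h(1)] by auto
  then show ?case using meas_sat_lit[OF i] vset_sat_lit[OF basic] by simp
next
  case (compl A)
  obtain h where h: "h \<in> Syms" "\<forall>x\<in>elts X. app h (app g x) = x"
    "\<forall>x\<in>elts X. app g (app h x) = x" by (rule Sym_inverse[OF g])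
  have "push g ` (Strs - elts A) = Strs - push g ` elts A"
    using push_image_eq[OF g h(1,3,2)] act_push(2)[OF h(1)] sigma_in_V[OF compl(1)] by auto
  moreover have "vset (Strs - elts A)" using meas_vset[OF meas_compl[OF meas_elts[OF compl(1)]]] .
  ultimately show ?case using meas_compl[OF compl(2)] by simp
next
  case (union F)
  obtain h where h: "h \<in> Syms" "\<forall>x\<in>elts X. app h (app g x) = x"
    "\<forall>x\<in>elts X. app g (app h x) = x" by (rule Sym_inverse[OF g])
  have F: "A \<in> Sig" "meas (push g ` elts A)" if "A \<in> elts F" for A using union that by auto
  define t where "t = (\<lambda>A. the_set (push g ` elts A))"
  \<comment> \<open>Translation by the inverse recovers A from its translate, so composing the
    injection of F with u embeds the translated family into kappa.\<close>
  define u where "u = (\<lambda>A. the_set (push h ` elts A))"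
  have et: "elts (t A) = push g ` elts A" if "A \<in> elts F" for A
    unfolding t_def using meas_vset[OF F(2)[OF that]] by simp
  have tt: "dterm (\<lambda>e. t (e 0))" unfolding t_def by (intro dterm_image dterm_push dterm_var Sym_in_V g)
  have vF: "vset (t ` elts F)" by (intro vset_image tt vset_elts union(1))
  define F' where "F' = the_set (t ` elts F)"
  have F': "F' \<in> V" "elts F' = t ` elts F" unfolding F'_def using vF vset_in_V by auto
  have ut: "u (t A) = A" if "A \<in> elts F" for A
  proof -
    have "push h ` push g ` elts A = elts A"
      using push_inverse[OF h(1) g h(2)] sigma_in_V[OF F(1)[OF that]] by (force simp: image_image)
    then show ?thesis unfolding u_def et[OF that] by simp
  qed
  obtain k where k: "k \<in> V" "is_fun k (elts F) (elts \<kappa>)" "inj_on (app k) (elts F)"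
    using union(2) unfolding card_le_kappa_def by blast
  have kt: "tapp k A = app k A" if "A \<in> elts F" for A
    by (rule tapp_eqI[OF k(1)]) (use is_fun_mem_iff[OF k(2)] that in auto)
  have tk: "dterm (\<lambda>e. tapp k (u (e 0)))"
    unfolding u_def by (intro dterm_tapp dterm_const k dterm_image dterm_push dterm_var Sym_in_V h)
  have sub: "(\<lambda>B. tapp k (u B)) ` elts F' \<subseteq> elts \<kappa>"
    unfolding F'(2) using ut kt is_fun_app(2)[OF k(2)] by auto
  obtain k' where k': "k' \<in> V" "is_fun k' (elts F') (elts \<kappa>)"
      "\<And>x. x \<in> elts F' \<Longrightarrow> app k' x = tapp k (u x)"
    using fun_in_V[OF tk vset_elts[OF F'(1)] sub] by blast
  have "inj_on (app k') (elts F')"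
    using k(3) k'(3) ut kt unfolding F'(2) inj_on_def by auto
  then have "card_le_kappa V \<kappa> F'" unfolding card_le_kappa_def using k' by blast
  moreover have "B \<in> Sig" if "B \<in> elts F'" for B
    using that F(2) unfolding F'(2) t_def meas_def by auto
  ultimately have "the_set (\<Union>A\<in>elts F'. elts A) \<in> Sig" using sigma.union[OF F'(1)] by simp
  moreover have "(\<Union>A\<in>elts F'. elts A) = push g ` (\<Union>A\<in>elts F. elts A)"
    unfolding F'(2) using et by auto
  ultimately have "meas (push g ` (\<Union>A\<in>elts F. elts A))"
    unfolding meas_def using vset_Union[OF F'(1)] by simp
  then show ?case using vset_Union[OF union(1)] by simp
qed

lemma translate_push:
  assumes g: "g \<in> Syms" and A: "A \<in> Sig"
  shows "translate V X L g A = the_set (push g ` elts A)" "elts (translate V X L g A) = push g ` elts A"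
    "translate V X L g A \<in> Sig"
proof -
  have "act V X L g ` elts A = push g ` elts A"
    using act_push(1)[OF g] sigma_in_V[OF A] by (intro image_cong) auto
  then show *: "translate V X L g A = the_set (push g ` elts A)" unfolding translate_def by simp
  show "elts (translate V X L g A) = push g ` elts A" "translate V X L g A \<in> Sig"
    unfolding * using meas_push[OF g A] unfolding meas_def by auto
qed

end

subsection \<open>Exhaustion and mutual singularity\<close>

context zfc
begin

text \<open>For positive k this is the code of the rational 1 / k: sign, numerator 1, denominator.
  As a term in k it lets V test whether a value exceeds 1 / k by membership in a cut.\<close>

definition recip_code :: "'u \<Rightarrow> 'u" where
  "recip_code k = pair (num 0) (pair (num 1) k)"

lemma rat_code_inverse_Suc: "rat_code (1 / of_nat (Suc k)) = recip_code (num (Suc k))"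
proof -
  have "quotient_of (1 / of_nat (Suc k)) = (1, int (Suc k))"
    using quotient_of_Fract[of 1 "int (Suc k)"]
    by (simp add: Fract_of_int_quotient normalize_def)
  then show ?thesis unfolding rat_code_def recip_code_def by (simp del: of_nat_Suc)
qed

text \<open>Denominators are positive, so k = 0 codes no rational and is never met in a cut. A
  search over all of omega therefore cannot stop at 0.\<close>

lemma recip_code_zero_not_rat_code: "recip_code (num 0) \<noteq> rat_code q"
proof
  assume e: "recip_code (num 0) = rat_code q"
  obtain a b where q: "quotient_of q = (a, b)" by fastforce
  have "b > 0" using quotient_of_denom_pos q by auto
  then show False using e unfolding recip_code_def rat_code_def q by simp
qed

lemma dterm_recip_code: "dterm t \<Longrightarrow> dterm (\<lambda>e. recip_code (t e))"
  unfolding recip_code_def by (intro dterm_pair dterm_const num_in_V)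

end

context kmeasure
begin

lemma tapp_mu: "A \<in> Sig \<Longrightarrow> tapp \<mu> A = app \<mu> A"
  by (rule tapp_eqI[OF mu_in_V]) (use is_fun_mem_iff[OF mu_fun] in auto)

lemma recip_code_mem_iff:
  assumes "A \<in> Sig"
  shows "recip_code (num (Suc k)) \<in> elts (app \<mu> A) \<longleftrightarrow> 1 / real (Suc k) < val \<mu> A"
    "recip_code (num 0) \<notin> elts (app \<mu> A)"
proof -
  show "recip_code (num (Suc k)) \<in> elts (app \<mu> A) \<longleftrightarrow> 1 / real (Suc k) < val \<mu> A"
    using codes_real_mem[OF codes_app[OF assms], of "1 / of_nat (Suc k)"]
    unfolding rat_code_inverse_Suc by (simp add: of_rat_divide of_rat_add)
  show "recip_code (num 0) \<notin> elts (app \<mu> A)"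
    using codes_app[OF assms] recip_code_zero_not_rat_code unfolding codes_real_def by blast
qed

text \<open>
  Greedy choice: at every step a set of \<open>S\<close> disjoint from the previous ones is added whose measure
  exceeds \<open>1 / k\<close> for the least possible \<open>k\<close>.
\<close>

lemma exhaustion:
  assumes S: "S \<in> V" "elts S \<subseteq> Sig" "num 0 \<in> elts S"
    and closed: "\<And>f. f \<in> V \<Longrightarrow> is_fun f (range num) (elts S) \<Longrightarrow>
      disjoint_family (\<lambda>n. elts (app f (num n))) \<Longrightarrow>
      the_set (\<Union>n. elts (app f (num n))) \<in> elts S"
  obtains M where "M \<in> elts S" "\<And>B. B \<in> elts S \<Longrightarrow> elts B \<inter> elts M = {} \<Longrightarrow> val \<mu> B = 0"
proof -
  obtain c where c: "c \<in> V"
    "\<And>Y. Y \<in> V \<Longrightarrow> elts Y \<subseteq> elts S \<Longrightarrow> elts Y \<noteq> {} \<Longrightarrow> tapp c Y \<in> elts Y"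
    "\<And>Y. Y \<in> V \<Longrightarrow> elts Y = {} \<Longrightarrow> elts (tapp c Y) = {}"
    using choice[OF S(1)] by metis
  define large where "large = (\<lambda>R k B. (\<forall>x\<in>elts B. x \<notin> elts R) \<and> recip_code k \<in> elts (tapp \<mu> B))"
  \<comment> \<open>Taking k least compares candidates on the scale of the numbers 1 / k only;
    suprema of measures would call for arithmetic in V.\<close>
  define best where "best = (\<lambda>R B. \<exists>k\<in>elts omega. large R k B \<and>
    (\<forall>B'\<in>elts S. \<forall>j\<in>elts k. \<not> large R j B'))"
  define W where "W = (\<lambda>R. the_set {B \<in> elts S. best R B})"
  define H where "H = (\<lambda>R. the_set (elts R \<union> elts (tapp c (W R))))"
  have tW: "dterm (\<lambda>e. W (t e))" if "dterm t" for t
    by (rule dterm_comp1[of W, OF _ that])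
      (unfold W_def best_def large_def, intro dterm_sep definable_intros dterm_var dterm_const dterm_tapp dterm_recip_code S(1) omega_in_V mu_in_V)
  have tH: "dterm (\<lambda>e. H (e 0))" unfolding H_def by (intro dterm_Un dterm_tapp dterm_const dterm_var tW c(1))
  have W: "elts (W R) = {B \<in> elts S. best R B}" "W R \<in> V" if "R \<in> V" for R
  proof -
    have "vset {B \<in> elts S. best R B}"
      unfolding best_def large_def
      by (rule vset_sep)
        (intro definable_intros dterm_var dterm_const dterm_tapp dterm_recip_code S(1) omega_in_V mu_in_V that vset_elts)+
    then show "elts (W R) = {B \<in> elts S. best R B}" "W R \<in> V" unfolding W_def using vset_in_V by auto
  qed
  define R where "R = (\<lambda>n. (H ^^ n) (num 0))"
  have R_Suc: "R (Suc n) = H (R n)" for n unfolding R_def by simp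
  have RV: "R n \<in> V" for n
    by (induction n) (use num_in_V[of 0] dterm_comp1_in_V[OF tH] R_Suc in \<open>auto simp: R_def\<close>)
  define B where "B = (\<lambda>n. tapp c (W (R n)))"
  have z: "elts (num 0) = ({} :: 'u set)" using elts_num[of 0] by simp
  have BW: "B n \<in> elts (W (R n))" if "elts (W (R n)) \<noteq> {}" for n
    unfolding B_def using c(2)[OF W(2)[OF RV] _ that] W(1)[OF RV] by blast
  \<comment> \<open>With no candidate left the choice function returns the empty set; it belongs to
    S, so the construction can run through all n.\<close>
  have B0: "B n = num 0" if "elts (W (R n)) = {}" for n
    using c(3)[OF W(2)[OF RV] that] z unfolding B_def by (metis elts_inject)
  have basic_entries: "B n \<in> elts S" and BR: "elts (B n) \<inter> elts (R n) = {}" for n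
  proof -
    have "B n \<in> elts S \<and> elts (B n) \<inter> elts (R n) = {}"
    proof (cases "elts (W (R n)) = {}")
      case True
      then show ?thesis using B0 S(3) z by simp
    next
      case False
      from BW[OF False] have "B n \<in> elts S" "best (R n) (B n)" using W(1)[OF RV] by blast+
      then show ?thesis unfolding best_def large_def by blast
    qed
    then show "B n \<in> elts S" "elts (B n) \<inter> elts (R n) = {}" by blast+
  qed
  have "elts (H (R n)) = elts (R n) \<union> elts (B n)" for n
  proof -
    have "H (R n) = the_set (elts (R n) \<union> elts (B n))" unfolding H_def B_def ..
    then show ?thesis using vset_Un[OF vset_elts[OF RV] vset_elts[OF in_V_elts[OF S(1) basic_entries]]] by simp
  qed
  then have eR: "elts (R n) = (\<Union>i<n. elts (B i))" for n
    by (induction n) (auto simp: R_Suc lessThan_Suc, simp add: R_def z)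
  have disj: "disjoint_family (\<lambda>n. elts (B n))"
  proof -
    have "elts (B m) \<inter> elts (B n) = {}" if "m < n" for m n
      using BR[of n] eR[of n] that by blast
    then show ?thesis unfolding disjoint_family_on_def by (metis Int_commute linorder_neqE_nat)
  qed
  have vR: "vset (range (\<lambda>n. pair (num n) (R n)))"
    unfolding R_def by (rule vset_iterates[OF tH num_in_V])
  \<comment> \<open>The whole history of the greedy construction is an element of V, and therefore
    so is the sequence of chosen sets computed from it.\<close>
  define g where "g = the_set (range (\<lambda>n. pair (num n) (R n)))"
  have g: "g \<in> V" "elts g = range (\<lambda>n. pair (num n) (R n))"
    unfolding g_def using vR vset_in_V by auto
  have gR: "tapp g (num n) = R n" for n
    by (rule tapp_eqI[OF g(1)]) (auto simp: g(2))
  have tf: "dterm (\<lambda>e. tapp c (W (tapp g (e 0))))" by (intro dterm_tapp dterm_const tW dterm_var g(1) c(1))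
  have "(\<lambda>x. tapp c (W (tapp g x))) ` range num \<subseteq> elts S"
    using basic_entries unfolding B_def by (auto simp: gR)
  then obtain f where f: "f \<in> V" "is_fun f (range num) (elts S)"
      "\<And>x. x \<in> range num \<Longrightarrow> app f x = tapp c (W (tapp g x))"
    using fun_in_V[OF tf vset_range_num] by blast
  have fB: "app f (num n) = B n" for n using f(3) gR unfolding B_def by simp
  have fSig: "is_fun f (range num) Sig" by (rule is_fun_cong[OF f(2)]) (use S(2) fB basic_entries in auto)
  have iB: "iseq (\<lambda>n. elts (B n))" unfolding iseq_def using f(1) fSig fB by auto
  \<comment> \<open>The chosen sets are disjoint, so their measures form a convergent
    series.\<close>
  have lim: "(\<lambda>n. val \<mu> (B n)) \<longlonglongrightarrow> 0"
    using sums_summable[OF mu_UN[OF iB disj]] summable_LIMSEQ_zero by fastforce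
  show thesis
  proof (rule that[of "the_set (\<Union>n. elts (B n))"])
    show "the_set (\<Union>n. elts (B n)) \<in> elts S"
      using closed[OF f(1,2)] disj unfolding fB by blast
    fix D assume D: "D \<in> elts S" "elts D \<inter> elts (the_set (\<Union>n. elts (B n))) = {}"
    have dis: "elts D \<inter> elts (B n) = {}" for n
      using D(2) vset_elts_the_set[OF meas_vset[OF meas_UN[OF iB]]] by auto
    have DSig: "D \<in> Sig" using D(1) S(2) by blast
    show "val \<mu> D = 0"
    proof (rule ccontr)
      assume "val \<mu> D \<noteq> 0"
      then have "0 < val \<mu> D" using mu_nonneg[OF meas_elts[OF DSig]] by simp
      then obtain k0 where k0: "1 / real (Suc k0) < val \<mu> D"
        using reals_Archimedean[of "val \<mu> D"] by (auto simp: inverse_eq_divide)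
      \<comment> \<open>D avoids all chosen sets and so was a candidate at every step. The least k
        was then at most \<open>Suc k0\<close>, and each chosen set exceeds the fixed bound, which
        contradicts \<open>lim\<close>.\<close>
      have lt: "1 / real (Suc k0) < val \<mu> (B n)" for n
      proof -
        have lD: "large (R n) (num (Suc k0)) D"
          unfolding large_def tapp_mu[OF DSig] recip_code_mem_iff(1)[OF DSig]
          using k0 dis unfolding eR by blast
        define Q where "Q = (\<lambda>k. \<exists>B\<in>elts S. large (R n) (num k) B)"
        have "Q (Suc k0)" unfolding Q_def using lD D(1) by blast
        then have "Q (LEAST k. Q k)" by (rule LeastI)
        then obtain B' where B': "B' \<in> elts S" "large (R n) (num (LEAST k. Q k)) B'"
          unfolding Q_def by blast
        have "\<not> Q j" if "j < (LEAST k. Q k)" for j using not_less_Least[OF that] .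
        then have "\<forall>B''\<in>elts S. \<forall>j\<in>elts (num (LEAST k. Q k)). \<not> large (R n) j B''"
          unfolding Q_def elts_num by blast
        then have "best (R n) B'" unfolding best_def elts_omega using B'(2) by blast
        then have "elts (W (R n)) \<noteq> {}" using W(1)[OF RV] B' by auto
        then have "best (R n) (B n)" using BW W(1)[OF RV] by blast
        then obtain k where k: "large (R n) (num k) (B n)"
            "\<forall>B'\<in>elts S. \<forall>j\<in>elts (num k). \<not> large (R n) j B'"
          unfolding best_def elts_omega by blast
        have "\<not> Suc k0 < k" using k(2) lD D(1) unfolding elts_num by auto
        moreover have BSig: "B n \<in> Sig" using basic_entries S(2) by blast
        have rk: "recip_code (num k) \<in> elts (app \<mu> (B n))"
          using k(1) unfolding large_def tapp_mu[OF BSig] by blast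
        then obtain k' where k': "k = Suc k'" using recip_code_mem_iff(2)[OF BSig] by (cases k) auto
        ultimately have "1 / real (Suc k0) \<le> 1 / real (Suc k')" by (auto simp: frac_le)
        also have "\<dots> < val \<mu> (B n)" using rk unfolding k' recip_code_mem_iff(1)[OF BSig] .
        finally show ?thesis .
      qed
      have "eventually (\<lambda>n. val \<mu> (B n) < 1 / real (Suc k0)) sequentially"
        using order_tendstoD(2)[OF lim] by simp
      then obtain n where "val \<mu> (B n) < 1 / real (Suc k0)"
        unfolding eventually_sequentially by blast
      then show False using lt[of n] by simp
    qed
  qed
qed

end

section \<open>Comparison of two measures\<close>

locale two_measures = M: kmeasure V \<kappa> X L \<mu> + N: kmeasure V \<kappa> X L \<nu>
  for V :: "'u::set_universe set" and \<kappa> X L \<mu> \<nu>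
begin

lemma cut_subset_iff:
  assumes "A \<in> M.Sig" "B \<in> M.Sig"
  shows "elts (tapp \<mu> A) \<subseteq> elts (tapp \<nu> B) \<longleftrightarrow> val \<mu> A \<le> val \<nu> B"
    "elts (tapp \<nu> A) \<subseteq> elts (tapp \<nu> B) \<longleftrightarrow> val \<nu> A \<le> val \<nu> B"
  unfolding M.tapp_mu[OF assms(1)] N.tapp_mu[OF assms(1)] N.tapp_mu[OF assms(2)]
  by (rule M.codes_real_le_iff[OF M.codes_app[OF assms(1)] N.codes_app[OF assms(2)]],
      rule M.codes_real_le_iff[OF N.codes_app[OF assms(1)] N.codes_app[OF assms(2)]])

text \<open>A value is literally a Dedekind cut, so equal reals give equal elements of V and the two
  functions coincide as sets.\<close>

lemma measure_eqI:
  assumes "\<And>A. A \<in> M.Sig \<Longrightarrow> val \<mu> A = val \<nu> A" shows "\<mu> = \<nu>"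
proof (rule is_fun_ext[OF M.mu_fun N.mu_fun])
  fix A assume A: "A \<in> M.Sig"
  have "elts (app \<mu> A) = elts (app \<nu> A)"
    using M.codes_app[OF A] N.codes_app[OF A] assms[OF A] unfolding codes_real_def by simp
  then show "app \<mu> A = app \<nu> A" by (simp add: elts_inject)
qed

text \<open>
  A substitute for the set where \<open>d\<mu>/d\<nu> > 1\<close>: unlike a Hahn set of \<open>\<mu> - \<nu>\<close>, a maximal strictly
  positive set is unique up to null sets of both measures, hence almost invariant.
\<close>

definition strictly_pos :: "'u set \<Rightarrow> bool" where
  "strictly_pos P \<longleftrightarrow> M.meas P \<and> (\<forall>B. M.meas B \<longrightarrow> B \<subseteq> P \<longrightarrow> M.mu B \<le> N.mu B \<longrightarrow> N.mu B = 0)"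

lemma strictly_pos_le: "strictly_pos P \<Longrightarrow> M.meas B \<Longrightarrow> B \<subseteq> P \<Longrightarrow> N.mu B \<le> M.mu B"
  unfolding strictly_pos_def using M.mu_nonneg by (metis linear)

text \<open>Exhaust A, with respect to \<open>\<nu>\<close>, by sets on which \<open>\<mu>\<close>
  is at most \<open>\<nu>\<close>. Any further set of this kind in the remainder is
  \<open>\<nu>\<close>-null, so the remainder is strictly positive. Subtracting the exhausted part
  keeps the strict inequality between the two measures, so the remainder has positive
  \<open>\<mu>\<close>-measure.\<close>

lemma hahn:
  assumes A: "M.meas A" and less: "N.mu A < M.mu A"
  obtains P where "strictly_pos P" "P \<subseteq> A" "0 < M.mu P"
proof -
  obtain a where a: "a \<in> M.Sig" "elts a = A" using A by (rule M.measE)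
  have aV: "a \<in> V" using M.sigma_in_V[OF a(1)] by blast
  define S' where "S' = {B \<in> M.Sig. elts B \<subseteq> elts a \<and> elts (tapp \<mu> B) \<subseteq> elts (tapp \<nu> B)}"
  have v: "M.vset S'" unfolding S'_def
    by (rule M.vset_sep[OF _ M.vset_Sig])
      (intro M.definable_intros M.dterm_var M.dterm_const M.dterm_tapp aV M.mu_in_V N.mu_in_V)
  define S where "S = the_set S'"
  have SV: "S \<in> V" unfolding S_def using M.vset_in_V[OF v] .
  have eS: "B \<in> elts S \<longleftrightarrow> B \<in> M.Sig \<and> elts B \<subseteq> A \<and> val \<mu> B \<le> val \<nu> B" for B
  proof -
    have "elts S = S'" unfolding S_def by (rule M.vset_elts_the_set[OF v])
    then show ?thesis unfolding S'_def a(2) using cut_subset_iff(1)[of B B] by simp blast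
  qed
  have z: "elts (num 0) = ({} :: 'u set)" using M.elts_num[of 0] by simp
  have zS: "num 0 \<in> elts S"
    unfolding eS
    using M.meas_empty M.mu_empty N.mu_empty by (simp add: M.meas_def M.mu_def N.mu_def z the_set_eqI[OF z])
  obtain m where m: "m \<in> elts S" "\<And>B. B \<in> elts S \<Longrightarrow> elts B \<inter> elts m = {} \<Longrightarrow> val \<nu> B = 0"
  proof (rule N.exhaustion[OF SV _ zS])
    show "elts S \<subseteq> M.Sig" using eS by blast
    fix f assume f: "f \<in> V" "is_fun f (range num) (elts S)" "disjoint_family (\<lambda>n. elts (app f (num n)))"
    have fS: "app f (num n) \<in> elts S" for n using is_fun_app(2)[OF f(2)] by blast
    have "is_fun f (range num) M.Sig" by (rule is_fun_cong[OF f(2)]) (use fS eS in auto)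
    then have i: "M.iseq (\<lambda>n. elts (app f (num n)))" unfolding M.iseq_def using f(1) by auto
    have "M.mu (\<Union>n. elts (app f (num n))) \<le> N.mu (\<Union>n. elts (app f (num n)))"
      using fS eS by (intro sums_le[OF _ M.mu_UN[OF i f(3)] N.mu_UN[OF i f(3)]]) simp
    then show "the_set (\<Union>n. elts (app f (num n))) \<in> elts S"
      using M.meas_UN[OF i] fS eS unfolding eS M.meas_def M.mu_def N.mu_def by auto
  qed blast
  have mm: "M.meas (elts m)" "elts m \<subseteq> A" "M.mu (elts m) \<le> N.mu (elts m)"
    using m(1) M.meas_elts unfolding eS by auto
  show thesis
  proof (rule that[of "A - elts m"])
    show "strictly_pos (A - elts m)" unfolding strictly_pos_def
    proof (intro conjI allI impI)
      show "M.meas (A - elts m)" by (rule M.meas_Diff[OF A mm(1)])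
      fix B assume B: "M.meas B" "B \<subseteq> A - elts m" "M.mu B \<le> N.mu B"
      then have "the_set B \<in> elts S" unfolding eS M.meas_def M.mu_def N.mu_def by auto
      then show "N.mu B = 0" using m(2)[of "the_set B"] B M.meas_vset[OF B(1)] unfolding N.mu_def by auto
    qed
    show "0 < M.mu (A - elts m)"
      using M.mu_Diff[OF A mm(1,2)] N.mu_Diff[OF A mm(1,2)] N.mu_nonneg[OF M.meas_Diff[OF A mm(1)]] mm(3) less
      by linarith
  qed blast
qed

text \<open>Cut B into its pieces in the sets A n. On each piece \<open>\<nu>\<close> is at most
  \<open>\<mu>\<close>, while the sums are ordered the other way; hence the values agree on every
  piece, and strict positivity makes each piece \<open>\<nu>\<close>-null.\<close>

lemma strictly_pos_UN:
  assumes i: "M.iseq A" and d: "disjoint_family A" and pos: "\<And>n. strictly_pos (A n)"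
  shows "strictly_pos (\<Union>n. A n)"
  unfolding strictly_pos_def
proof (intro conjI allI impI)
  show "M.meas (\<Union>n. A n)" by (rule M.meas_UN[OF i])
  fix B assume B: "M.meas B" "B \<subseteq> (\<Union>n. A n)" "M.mu B \<le> N.mu B"
  obtain b where b: "b \<in> M.Sig" "elts b = B" using B(1) by (rule M.measE)
  obtain f where f: "f \<in> V" "is_fun f (range num) M.Sig" "\<And>n. elts (app f (num n)) = A n"
    using i unfolding M.iseq_def by blast
  have bV: "b \<in> V" using M.sigma_in_V[OF b(1)] by blast
  have t: "tapp f (num n) = app f (num n)" for n
    by (rule M.tapp_eqI[OF f(1)]) (use is_fun_mem_iff[OF f(2)] in auto)
  have mA: "M.meas (A n \<inter> B)" "M.meas (B - A n)" for n
    using M.meas_Int[OF M.iseq_meas[OF i] B(1)] M.meas_Diff[OF B(1) M.iseq_meas[OF i]] .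
  have iB: "M.iseq (\<lambda>n. A n \<inter> B)"
  \<comment> \<open>The intersection is written as a double difference, for which
    \<open>dterm_Diff\<close> shows definability.\<close>
  proof (rule M.iseqI[of "\<lambda>x. the_set (elts b - elts (the_set (elts b - elts (tapp f x))))"])
    show "M.dterm (\<lambda>e. the_set (elts b - elts (the_set (elts b - elts (tapp f (e 0))))))"
      by (intro M.dterm_Diff M.dterm_const M.dterm_tapp M.dterm_var bV f(1))
    have e: "elts b - elts (the_set (elts b - elts (tapp f (num n)))) = A n \<inter> B" for n
      unfolding t f(3) b(2) M.vset_elts_the_set[OF M.meas_vset[OF mA(2)]] by blast
    show "the_set (elts b - elts (the_set (elts b - elts (tapp f (num n))))) \<in> M.Sig" for n
      unfolding e using mA(1) unfolding M.meas_def by blast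
    show "A n \<inter> B = elts (the_set (elts b - elts (the_set (elts b - elts (tapp f (num n))))))" for n
      unfolding e using M.meas_vset[OF mA(1)] by simp
  qed
  have sM: "(\<lambda>n. M.mu (A n \<inter> B)) sums M.mu B" by (rule M.mu_sums_Int[OF i d B(1,2) iB])
  have sN: "(\<lambda>n. N.mu (A n \<inter> B)) sums N.mu B" by (rule N.mu_sums_Int[OF i d B(1,2) iB])
  have le: "N.mu (A n \<inter> B) \<le> M.mu (A n \<inter> B)" for n
    using strictly_pos_le[OF pos mA(1)] by blast
  have s: "(\<lambda>n. M.mu (A n \<inter> B) - N.mu (A n \<inter> B)) sums (M.mu B - N.mu B)"
    by (rule sums_diff[OF sM sN])
  have "M.mu B - N.mu B = 0" using sums_le[OF le sN sM] B(3) by simp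
  then have "M.mu (A n \<inter> B) - N.mu (A n \<inter> B) = 0" for n
    using suminf_eq_zero_iff[OF sums_summable[OF s]] le sums_unique[OF s] by simp
  then have "N.mu (A n \<inter> B) = 0" for n
    using pos[of n] mA(1)[of n] unfolding strictly_pos_def by simp
  then show "N.mu B = 0" using sN sums_unique2[OF _ sums_zero] by simp
qed

text \<open>Exhaustion with respect to \<open>\<mu>\<close> in the family of strictly positive sets,
  which is closed under disjoint unions of sequences in V. A measurable part of a strictly positive
  set is strictly positive, so what A has outside P was a candidate and is null.\<close>

lemma maximal_strictly_pos:
  obtains P where "strictly_pos P" "\<And>A. strictly_pos A \<Longrightarrow> M.mu (A - P) = 0"
proof -
  have zV: "(num 0 :: 'u) \<in> V" by (rule M.num_in_V)
  have z: "elts (num 0) = ({} :: 'u set)" using M.elts_num[of 0] by simp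
  have zSig: "num 0 \<in> M.Sig" using M.meas_empty unfolding M.meas_def z[symmetric] by simp
  have vz: "val \<nu> (num 0) = 0" using N.mu_empty unfolding N.mu_def z[symmetric] by simp
  define sg where "sg = the_set M.Sig"
  have sg: "sg \<in> V" "elts sg = M.Sig" unfolding sg_def using M.vset_Sig M.vset_in_V by auto
  \<comment> \<open>Being \<open>\<nu>\<close>-null is expressed by comparison with the value at the
    empty set, again an inclusion of cuts.\<close>
  define S' where "S' = {A \<in> M.Sig. \<forall>B\<in>elts sg. elts B \<subseteq> elts A \<longrightarrow>
    elts (tapp \<mu> B) \<subseteq> elts (tapp \<nu> B) \<longrightarrow> elts (tapp \<nu> B) \<subseteq> elts (tapp \<nu> (num 0))}"
  have v: "M.vset S'" unfolding S'_def
    by (rule M.vset_sep[OF _ M.vset_Sig])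
      (intro M.definable_intros M.dterm_var M.dterm_const M.dterm_tapp sg(1) zV M.mu_in_V N.mu_in_V)
  define S where "S = the_set S'"
  have SV: "S \<in> V" unfolding S_def using M.vset_in_V[OF v] .
  have eS: "A \<in> elts S \<longleftrightarrow> A \<in> M.Sig \<and> strictly_pos (elts A)" for A
  proof -
    have "A \<in> elts S \<longleftrightarrow> A \<in> M.Sig \<and> (\<forall>B\<in>M.Sig. elts B \<subseteq> elts A \<longrightarrow>
        val \<mu> B \<le> val \<nu> B \<longrightarrow> val \<nu> B \<le> 0)"
    proof -
      have "elts S = S'" unfolding S_def by (rule M.vset_elts_the_set[OF v])
      moreover have "elts (tapp \<mu> B) \<subseteq> elts (tapp \<nu> B) \<longleftrightarrow> val \<mu> B \<le> val \<nu> B"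
          "elts (tapp \<nu> B) \<subseteq> elts (tapp \<nu> (num 0)) \<longleftrightarrow> val \<nu> B \<le> 0" if "B \<in> M.Sig" for B
        using cut_subset_iff(1)[OF that that] cut_subset_iff(2)[OF that zSig] vz by simp_all
      ultimately show ?thesis unfolding S'_def sg(2) by simp
    qed
    also have "\<dots> \<longleftrightarrow> A \<in> M.Sig \<and> (\<forall>B\<in>M.Sig. elts B \<subseteq> elts A \<longrightarrow>
        val \<mu> B \<le> val \<nu> B \<longrightarrow> val \<nu> B = 0)"
      using N.mu_nonneg[OF M.meas_elts] by (auto intro: antisym)
    also have "\<dots> \<longleftrightarrow> A \<in> M.Sig \<and> strictly_pos (elts A)"
    proof -
      have "M.meas B \<longleftrightarrow> (\<exists>b\<in>M.Sig. elts b = B)" for B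
        using M.meas_elts M.measE by metis
      then show ?thesis unfolding strictly_pos_def by auto
    qed
    finally show ?thesis .
  qed
  have zS: "num 0 \<in> elts S"
    unfolding eS strictly_pos_def using zSig M.meas_elts[OF zSig] N.mu_empty by (simp add: z)
  obtain m where m: "m \<in> elts S" "\<And>B. B \<in> elts S \<Longrightarrow> elts B \<inter> elts m = {} \<Longrightarrow> val \<mu> B = 0"
  proof (rule M.exhaustion[OF SV _ zS])
    show "elts S \<subseteq> M.Sig" using eS by blast
    fix f assume f: "f \<in> V" "is_fun f (range num) (elts S)" "disjoint_family (\<lambda>n. elts (app f (num n)))"
    have fS: "app f (num n) \<in> elts S" for n using is_fun_app(2)[OF f(2)] by blast
    have "is_fun f (range num) M.Sig" by (rule is_fun_cong[OF f(2)]) (use fS eS in auto)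
    then have i: "M.iseq (\<lambda>n. elts (app f (num n)))" unfolding M.iseq_def using f(1) by auto
    have "strictly_pos (\<Union>n. elts (app f (num n)))"
      by (rule strictly_pos_UN[OF i f(3)]) (use fS eS in blast)
    then show "the_set (\<Union>n. elts (app f (num n))) \<in> elts S"
      using M.meas_UN[OF i] unfolding eS M.meas_def by simp
  qed blast
  show thesis
  proof (rule that[of "elts m"])
    show P: "strictly_pos (elts m)" using m(1) eS by blast
    fix A assume A: "strictly_pos A"
    have mD: "M.meas (A - elts m)" using M.meas_Diff A P unfolding strictly_pos_def by blast
    then have "strictly_pos (A - elts m)" using A unfolding strictly_pos_def by blast
    then have "the_set (A - elts m) \<in> elts S" using mD unfolding eS M.meas_def by simp
    then show "M.mu (A - elts m) = 0"
      using m(2)[of "the_set (A - elts m)"] M.meas_vset[OF mD] unfolding M.mu_def by auto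
  qed
qed

text \<open>A test set B in the translate is pulled back by the inverse h: it lands in P with both
  measures unchanged.\<close>

lemma strictly_pos_push:
  assumes g: "g \<in> M.Syms" and P: "strictly_pos P"
    and inv: "\<And>A. A \<in> M.Sig \<Longrightarrow> val \<mu> (translate V X L h A) = val \<mu> A"
      "\<And>A. A \<in> M.Sig \<Longrightarrow> val \<nu> (translate V X L h A) = val \<nu> A"
    and h: "h \<in> M.Syms" "\<forall>x\<in>elts X. app h (app g x) = x"
  shows "strictly_pos (M.push g ` P)"
  unfolding strictly_pos_def
proof (intro conjI allI impI)
  have mP: "M.meas P" using P unfolding strictly_pos_def by blast
  then show "M.meas (M.push g ` P)" using M.meas_push[OF g] M.measE by metis
  fix B assume B: "M.meas B" "B \<subseteq> M.push g ` P" "M.mu B \<le> N.mu B"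
  obtain b where b: "b \<in> M.Sig" "elts b = B" "the_set B = b" using B(1) by (rule M.measE)
  note t = M.translate_push[OF h(1) b(1)]
  have "M.push h ` B \<subseteq> P"
    using B(2) M.push_inverse[OF h(1) g h(2)] M.meas_subset[OF mP] by force
  moreover have "M.mu (M.push h ` B) = M.mu B" "N.mu (M.push h ` B) = N.mu B"
    using inv[OF b(1)] b t unfolding M.mu_def N.mu_def by auto
  moreover have "M.meas (M.push h ` B)" using M.meas_push[OF h(1) b(1)] b by simp
  ultimately show "N.mu B = 0" using P B(3) unfolding strictly_pos_def by metis
qed

lemma mutually_singular:
  assumes inv: "invariant_measure V \<kappa> X L \<mu>" "invariant_measure V \<kappa> X L \<nu>"
    and erg: "ergodic V \<kappa> X L \<mu>" "ergodic V \<kappa> X L \<nu>" and ne: "\<mu> \<noteq> \<nu>"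
  obtains P where "P \<in> M.Sig" "val \<mu> P = 1" "val \<nu> P = 0"
proof -
  have invM: "val \<mu> (translate V X L g A) = val \<mu> A" if "g \<in> M.Syms" "A \<in> M.Sig" for g A
    using inv(1) that unfolding invariant_measure_def by blast
  have invN: "val \<nu> (translate V X L g A) = val \<nu> A" if "g \<in> M.Syms" "A \<in> M.Sig" for g A
    using inv(2) that unfolding invariant_measure_def by blast
  obtain P where P: "strictly_pos P" "\<And>A. strictly_pos A \<Longrightarrow> M.mu (A - P) = 0"
    using maximal_strictly_pos by metis
  have mP: "M.meas P" using P(1) unfolding strictly_pos_def by blast
  obtain p where p: "p \<in> M.Sig" "elts p = P" "the_set P = p" using mP by (rule M.measE)
  have almost: "val \<mu> (the_set ((elts (translate V X L g p) - elts p) \<union> (elts p - elts (translate V X L g p)))) = 0"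
    "val \<nu> (the_set ((elts (translate V X L g p) - elts p) \<union> (elts p - elts (translate V X L g p)))) = 0"
    if g: "g \<in> M.Syms" for g
  proof -
    obtain h where h: "h \<in> M.Syms" "\<forall>x\<in>elts X. app h (app g x) = x" by (rule M.Sym_inverse[OF g])
    define Q where "Q = M.push g ` P"
    have pos: "strictly_pos Q"
      unfolding Q_def by (rule strictly_pos_push[OF g P(1) invM[OF h(1)] invN[OF h(1)] h])
    have mQ: "M.meas Q" using pos unfolding strictly_pos_def by blast
    \<comment> \<open>Maximality only makes Q - P null for \<open>\<mu>\<close>. Since
      \<open>\<nu>\<close> is dominated on subsets of Q, it is null for \<open>\<nu>\<close> too,
      and invariance carries both facts over to P - Q.\<close>
    have QP: "M.mu (Q - P) = 0" by (rule P(2)[OF pos])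
    have eq: "M.mu Q = M.mu P" "N.mu Q = N.mu P"
      using invM[OF g p(1)] invN[OF g p(1)] M.translate_push(1)[OF g p(1)]
      unfolding Q_def M.mu_def N.mu_def p(2,3) by simp_all
    have NQP: "N.mu (Q - P) = 0"
      using strictly_pos_le[OF pos M.meas_Diff[OF mQ mP]] QP N.mu_nonneg[OF M.meas_Diff[OF mQ mP]] by auto
    have "M.mu (P - Q) = 0"
      using M.mu_Int_Diff[OF mP mQ] M.mu_Int_Diff[OF mQ mP] QP eq(1) by (simp add: Int_commute)
    moreover have "N.mu (P - Q) = 0"
      using N.mu_Int_Diff[OF mP mQ] N.mu_Int_Diff[OF mQ mP] NQP eq(2) by (simp add: Int_commute)
    moreover have "(Q - P) \<inter> (P - Q) = {}" by blast
    ultimately have "M.mu ((Q - P) \<union> (P - Q)) = 0" "N.mu ((Q - P) \<union> (P - Q)) = 0"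
      using M.mu_Un N.mu_Un M.meas_Diff[OF mQ mP] M.meas_Diff[OF mP mQ] QP NQP by simp_all
    then show "val \<mu> (the_set ((elts (translate V X L g p) - elts p) \<union> (elts p - elts (translate V X L g p)))) = 0"
      "val \<nu> (the_set ((elts (translate V X L g p) - elts p) \<union> (elts p - elts (translate V X L g p)))) = 0"
      unfolding M.translate_push(2)[OF g p(1)] p(2) Q_def M.mu_def N.mu_def .
  qed
  have M01: "val \<mu> p \<in> {0, 1}" using erg(1) p(1) almost(1) unfolding ergodic_def by blast
  have N01: "val \<nu> p \<in> {0, 1}" using erg(2) p(1) almost(2) unfolding ergodic_def by blast
  have pe: "M.mu P = val \<mu> p" "N.mu P = val \<nu> p" unfolding M.mu_def N.mu_def p(3) by auto
  have "val \<mu> p \<noteq> 0"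
  proof
    assume zero: "val \<mu> p = 0"
    \<comment> \<open>If P is \<open>\<mu>\<close>-null, maximality makes all strictly positive sets
      \<open>\<mu>\<close>-null, so \<open>hahn\<close> cannot apply to any set.\<close>
    have le: "M.mu A \<le> N.mu A" if A: "M.meas A" for A
    proof (rule ccontr)
      assume "\<not> M.mu A \<le> N.mu A"
      then obtain Q where Q: "strictly_pos Q" "0 < M.mu Q" using hahn[OF A] by (metis linorder_not_le)
      have mQ: "M.meas Q" using Q(1) unfolding strictly_pos_def by blast
      have "M.mu Q = M.mu (Q \<inter> P)" using M.mu_Int_Diff[OF mQ mP] P(2)[OF Q(1)] by simp
      also have "\<dots> \<le> M.mu P" by (rule M.mu_mono[OF mP M.meas_Int[OF mQ mP]]) blast
      finally show False using zero Q(2) pe by simp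
    qed
    \<comment> \<open>Both measures have total mass 1, so the inequality at A and at its complement
      forces equality.\<close>
    have "val \<mu> A = val \<nu> A" if "A \<in> M.Sig" for A
    proof -
      note mA = M.meas_elts[OF that]
      have "M.mu (M.Strs - elts A) = 1 - M.mu (elts A)" "N.mu (M.Strs - elts A) = 1 - N.mu (elts A)"
        using M.mu_Diff[OF M.meas_Str mA M.meas_subset[OF mA]] N.mu_Diff[OF M.meas_Str mA M.meas_subset[OF mA]]
          M.mu_Str N.mu_Str by auto
      then show ?thesis using le[OF mA] le[OF M.meas_compl[OF mA]] by simp
    qed
    then show False using measure_eqI ne by blast
  qed
  then have one: "val \<mu> p = 1" using M01 by blast
  have "val \<nu> p \<noteq> 1"
  proof
    assume "val \<nu> p = 1"
    then have "M.mu P \<le> N.mu P" using one pe by simp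
    then have "N.mu P = 0" using P(1) mP unfolding strictly_pos_def by blast
    then show False using \<open>val \<nu> p = 1\<close> pe by simp
  qed
  then have "val \<nu> p = 0" using N01 by blast
  then show thesis using that p(1) one by blast
qed

end

subsection \<open>Interpretations of basic codes\<close>

context zfc
begin

lemma lit_code_in_V: "(\<exists>S. instance_of V S L l a) \<Longrightarrow> lit_code l \<in> V"
proof (induction l)
  case (Atom R vs)
  then have "R \<in> V" by (auto simp: instance_of_def symbols_def)
  moreover have "seq (map num vs) \<in> V" by (rule seq_in_V) (auto simp: num_in_V)
  ultimately show ?case by (simp add: num_in_V)
qed (auto simp: num_in_V instance_of_def)

lemma set_map_num: "set (map num vs) \<subseteq> V"
  by (auto simp: num_in_V)

lemma lit_code_inject: "lit_code l = (lit_code l' :: 'u) \<longleftrightarrow> l = l'"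
proof
  assume "lit_code l = (lit_code l' :: 'u)"
  then show "l = l'"
  proof (induction l arbitrary: l')
    case (Atom R vs)
    then show ?case
    proof (cases l')
      case (Atom R' vs')
      have "map num vs = (map num vs' :: 'u list)"
        using Atom.prems Atom seq_inject[OF set_map_num set_map_num] by simp
      then have "vs = vs'" by (metis list.inj_map_strong num_inject)
      then show ?thesis using Atom Atom.prems by simp
    qed auto
  next
    case (Equal i j) then show ?case by (cases l') auto
  next
    case (Neg l) then show ?case by (cases l') auto
  qed
qed simp

lemma vset_UN_iterates:
  assumes H: "dterm (\<lambda>e. H (e 0))" and x0: "x0 \<in> V"
  shows "vset (\<Union>n. elts ((H ^^ n) x0))"
proof -
  have v: "vset (range (\<lambda>n. pair (num n) ((H ^^ n) x0)))" by (rule vset_iterates[OF H x0])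
  define g where "g = the_set (range (\<lambda>n. pair (num n) ((H ^^ n) x0)))"
  have g: "g \<in> V" "elts g = range (\<lambda>n. pair (num n) ((H ^^ n) x0))"
    unfolding g_def using v vset_in_V by auto
  have t: "tapp g (num n) = (H ^^ n) x0" for n
    by (rule tapp_eqI[OF g(1)]) (auto simp: g(2))
  have r: "vset ((\<lambda>x. tapp g x) ` range num)"
    by (rule vset_image[OF _ vset_range_num]) (intro dterm_tapp dterm_const dterm_var g)
  then have "vset (range (\<lambda>n. (H ^^ n) x0))" using t by (simp add: image_image)
  from vset_Union[OF vset_in_V[OF this]] this show ?thesis by simp
qed

end

context structures
begin

text \<open>Composition of coded sequences: the list of variables of an atom followed by the
  assignment, that is, the tuple at which the atom is evaluated.\<close>

definition comp_seq :: "'u \<Rightarrow> 'u \<Rightarrow> 'u" where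
  "comp_seq v s = the_set {q \<in> elts pair_space. \<exists>i\<in>elts omega. \<exists>j\<in>elts omega. \<exists>x\<in>elts X.
     pair i j \<in> elts v \<and> pair j x \<in> elts s \<and> q = pair i x}"

lemma dterm_comp_seq: "dterm t \<Longrightarrow> dterm s \<Longrightarrow> dterm (\<lambda>e. comp_seq (t e) (s e))"
  by (rule dterm_comp2[of comp_seq])
    (unfold comp_seq_def, intro dterm_sep definable_intros dterm_var dterm_pair dterm_const pair_space omega_in_V X)

lemma comp_seq_seq:
  assumes a: "set a \<subseteq> elts X" and vs: "set vs \<subseteq> {..<length a}"
  shows "comp_seq (seq (map num vs)) (seq a) = seq (map ((!) a) vs)"
proof -
  have aV: "set a \<subseteq> V" using a elts_subset[OF X] by blast
  have mX: "set (map ((!) a) vs) \<subseteq> elts X" using a vs by (auto simp: subset_eq)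
  then have mV: "set (map ((!) a) vs) \<subseteq> V" using elts_subset[OF X] by blast
  have vl: "vs ! i < length a" if "i < length vs" for i using vs that nth_mem by fastforce
  have "{q \<in> elts pair_space. \<exists>i\<in>elts omega. \<exists>j\<in>elts omega. \<exists>x\<in>elts X.
     pair i j \<in> elts (seq (map num vs)) \<and> pair j x \<in> elts (seq a) \<and> q = pair i x} =
     {pair (num i) (a ! (vs ! i)) |i. i < length vs}"
    (is "?l = ?r")
  proof (intro equalityI subsetI)
    fix q assume "q \<in> ?l"
    then show "q \<in> ?r" unfolding pair_mem_seq[OF set_map_num] pair_mem_seq[OF aV] by auto
  next
    fix q assume "q \<in> ?r"
    then obtain i where i: "i < length vs" "q = pair (num i) (a ! (vs ! i))" by blast
    have x: "a ! (vs ! i) \<in> elts X" using a vl[OF i(1)] nth_mem by blast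
    have "pair (num i) (num (vs ! i)) \<in> elts (seq (map num vs) :: 'u)"
      "pair (num (vs ! i)) (a ! (vs ! i)) \<in> elts (seq a)"
      unfolding pair_mem_seq[OF set_map_num] pair_mem_seq[OF aV] using i vl by auto
    then show "q \<in> ?l" using i x unfolding pair_space elts_omega by blast
  qed
  also have "\<dots> = elts (seq (map ((!) a) vs))" unfolding elts_seq[OF mV] by auto
  finally show ?thesis unfolding comp_seq_def by simp
qed

abbreviation lit_set :: "'u list \<Rightarrow> 'u literal \<Rightarrow> 'u" where
  "lit_set a l \<equiv> the_set {M \<in> Strs. sat_lit M a l}"

text \<open>A row of a table of literals: code, tuple and interpretation. Satisfaction of literals
  is a HOL recursion; having the table in V makes it available to formulas.\<close>

definition lit_entry :: "'u literal \<Rightarrow> 'u list \<Rightarrow> 'u" where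
  "lit_entry l a = pair (lit_code l) (pair (seq a) (lit_set a l))"

text \<open>Computes the row of an atom from its symbol, variables and tuple without HOL lists. Here
  n is the arity and m the length of the tuple, and the typing of v and s renders
  \<open>instance_of\<close>.\<close>

definition atom_rel :: "'u \<Rightarrow> 'u \<Rightarrow> bool" where
  "atom_rel x p \<longleftrightarrow> (\<exists>R\<in>V. \<exists>v\<in>V. \<exists>s\<in>V. x = pair R (pair v s) \<and>
     (\<exists>n\<in>elts omega. \<exists>m\<in>elts omega. pair R n \<in> elts L \<and> is_fun v (elts n) (elts m) \<and> is_fun s (elts m) (elts X)) \<and>
     p = pair (pair (num 0) (pair R v)) (pair s
       (the_set {M \<in> elts Str_set. \<exists>y\<in>V. pair R y \<in> elts M \<and> comp_seq v s \<in> elts y})))"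

text \<open>Since s is a function, the entries at i and j are equal exactly when every value at i is
  also a value at j.\<close>

definition equal_rel :: "'u \<Rightarrow> 'u \<Rightarrow> bool" where
  "equal_rel x p \<longleftrightarrow> (\<exists>i\<in>V. \<exists>j\<in>V. \<exists>s\<in>V. x = pair i (pair j s) \<and>
     (\<exists>m\<in>elts omega. is_fun s (elts m) (elts X) \<and> i \<in> elts m \<and> j \<in> elts m) \<and>
     p = pair (pair (num 1) (pair i j)) (pair s
       (the_set {M \<in> elts Str_set. \<forall>x\<in>elts X. pair i x \<in> elts s \<longrightarrow> pair j x \<in> elts s})))"

definition neg_lit_rel :: "'u \<Rightarrow> 'u \<Rightarrow> bool" where
  "neg_lit_rel q p \<longleftrightarrow> (\<exists>c\<in>V. \<exists>s\<in>V. \<exists>A\<in>V. q = pair c (pair s A) \<and>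
     p = pair (pair (num 2) c) (pair s (the_set (elts Str_set - elts A))))"

lemma definable_atom_rel: "dterm t \<Longrightarrow> dterm s \<Longrightarrow> definable (\<lambda>e. atom_rel (t e) (s e))"
  by (rule definable_comp2[of atom_rel]) (unfold atom_rel_def, intro definable_intros definable_is_fun dterm_var dterm_pair
    dterm_const dterm_sep dterm_comp_seq omega_in_V L_in_V X Str_set_in_V num_in_V)

lemma definable_equal_rel: "dterm t \<Longrightarrow> dterm s \<Longrightarrow> definable (\<lambda>e. equal_rel (t e) (s e))"
  by (rule definable_comp2[of equal_rel]) (unfold equal_rel_def, intro definable_intros definable_is_fun dterm_var dterm_pair
    dterm_const dterm_sep omega_in_V X Str_set_in_V num_in_V)

lemma definable_neg_lit_rel: "dterm t \<Longrightarrow> dterm s \<Longrightarrow> definable (\<lambda>e. neg_lit_rel (t e) (s e))"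
  by (rule definable_comp2[of neg_lit_rel]) (unfold neg_lit_rel_def, intro definable_intros dterm_var dterm_pair
    dterm_const dterm_Diff Str_set_in_V num_in_V)

lemma vset_repl_rel:
  assumes "\<And>t s. dterm t \<Longrightarrow> dterm s \<Longrightarrow> definable (\<lambda>e. P (t e) (s e))" "vset A"
    "\<And>x y z. P x y \<Longrightarrow> P x z \<Longrightarrow> y = z"
  shows "vset {p \<in> V. \<exists>x\<in>A. P x p}"
  by (rule vset_repl[OF _ assms(2)]) (auto intro: assms(1,3) dterm_var)

lemma lit_set_Atom:
  assumes "instance_of V X L (Atom R vs) a"
  shows "the_set {M \<in> elts Str_set. \<exists>y\<in>V. pair R y \<in> elts M \<and> comp_seq (seq (map num vs)) (seq a) \<in> elts y} =
    lit_set a (Atom R vs)"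
proof -
  have R: "R \<in> syms" and vs: "set vs \<subseteq> {..<length a}" "set a \<subseteq> elts X"
    using assms unfolding instance_of_def by auto
  have "(\<exists>y\<in>V. pair R y \<in> elts M \<and> seq (map ((!) a) vs) \<in> elts y) \<longleftrightarrow> sat_lit M a (Atom R vs)"
    if "M \<in> Strs" for M
    using is_fun_mem_iff[OF Str_fun[OF that]] is_fun_app[OF Str_fun[OF that] R] R by (auto simp: holds_def)
  then show ?thesis unfolding comp_seq_seq[OF vs(2,1)] elts_Str_set by (intro arg_cong[where f = the_set]) blast
qed

lemma lit_set_Equal:
  assumes "instance_of V X L (Equal i j) a"
  shows "the_set {M \<in> elts Str_set. \<forall>x\<in>elts X. pair (num i) x \<in> elts (seq a) \<longrightarrow> pair (num j) x \<in> elts (seq a)} =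
    lit_set a (Equal i j)"
proof -
  have i: "i < length a" "j < length a" "set a \<subseteq> elts X" using assms unfolding instance_of_def by auto
  then have "a ! i \<in> elts X" using nth_mem by blast
  then have "(\<forall>x\<in>elts X. pair (num i) x \<in> elts (seq a) \<longrightarrow> pair (num j) x \<in> elts (seq a)) \<longleftrightarrow> a ! i = a ! j"
    using i unfolding pair_mem_seq[OF instance_set_V[OF assms]] by auto
  then show ?thesis unfolding elts_Str_set by simp
qed

lemma lit_set_Neg:
  assumes "instance_of V X L l a"
  shows "the_set (elts Str_set - elts (lit_set a l)) = lit_set a (Neg l)"
  unfolding elts_Str_set vset_elts_the_set[OF vset_sat_lit[OF assms]]
  by (intro arg_cong[where f = the_set]) auto

lemma lit_set_in_V: "instance_of V X L l a \<Longrightarrow> lit_set a l \<in> V"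
  using vset_sat_lit vset_in_V by blast

lemma seq_instance_in_V: "instance_of V X L l a \<Longrightarrow> seq a \<in> V"
  using instance_set_V seq_in_V by blast

lemma lit_entry_in_V: "instance_of V X L l a \<Longrightarrow> lit_entry l a \<in> V"
  unfolding lit_entry_def using lit_set_in_V seq_instance_in_V lit_code_in_V by (auto; blast)

text \<open>Atoms and equations are obtained by Replacement. Iterated negations have unbounded depth
  and are added by iterating one definable step along omega.\<close>

lemma vset_lit_entries: "vset {lit_entry l a |l a. instance_of V X L l a}"
proof -
  have vtr: "vset {pair x y |x y. x \<in> A \<and> y \<in> {pair x y |x y. x \<in> B \<and> y \<in> C}}"
    if "vset A" "vset B" "vset C" for A B C by (intro vset_times that)
  define DA where "DA = {pair x y |x y. x \<in> elts sym_set \<and> y \<in> {pair x y |x y. x \<in> elts (Seqs omega) \<and> y \<in> elts (Seqs X)}}"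
  define DE where "DE = {pair x y |x y. x \<in> elts omega \<and> y \<in> {pair x y |x y. x \<in> elts omega \<and> y \<in> elts (Seqs X)}}"
  have vD: "vset DA" "vset DE" unfolding DA_def DE_def
    by (intro vtr vset_elts sym_set_in_V Seqs_in_V omega_in_V X)+
  have vA: "vset {p \<in> V. \<exists>x\<in>DA. atom_rel x p}"
    by (rule vset_repl_rel[OF definable_atom_rel vD(1)]) (auto simp: atom_rel_def)
  have vE: "vset {p \<in> V. \<exists>x\<in>DE. equal_rel x p}"
    by (rule vset_repl_rel[OF definable_equal_rel vD(2)]) (auto simp: equal_rel_def)
  have vN: "vset {p \<in> V. \<exists>q\<in>elts r. neg_lit_rel q p}" if "r \<in> V" for r
    by (rule vset_repl_rel[OF definable_neg_lit_rel vset_elts[OF that]]) (auto simp: neg_lit_rel_def)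
  define b where "b = the_set ({p \<in> V. \<exists>x\<in>DA. atom_rel x p} \<union> {p \<in> V. \<exists>x\<in>DE. equal_rel x p})"
  have b: "b \<in> V" "elts b = {p \<in> V. \<exists>x\<in>DA. atom_rel x p} \<union> {p \<in> V. \<exists>x\<in>DE. equal_rel x p}"
    unfolding b_def using vset_Un[OF vA vE] vset_in_V by auto
  have base: "p \<in> elts b \<longleftrightarrow> (\<exists>l a. instance_of V X L l a \<and> (\<forall>k. l \<noteq> Neg k) \<and> p = lit_entry l a)" for p
  proof
    assume "p \<in> elts b"
    then consider x where "p \<in> V" "atom_rel x p" | x where "p \<in> V" "equal_rel x p" unfolding b(2) by blast
    then show "\<exists>l a. instance_of V X L l a \<and> (\<forall>k. l \<noteq> Neg k) \<and> p = lit_entry l a"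
    proof cases
      case 1
      then obtain R v s n m where *: "pair R (num n) \<in> elts L" "is_fun v (elts (num n)) (elts (num m))"
          "is_fun s (elts (num m)) (elts X)"
          "p = pair (pair (num 0) (pair R v)) (pair s
             (the_set {M \<in> elts Str_set. \<exists>y\<in>V. pair R y \<in> elts M \<and> comp_seq v s \<in> elts y}))"
        unfolding atom_rel_def elts_omega by blast
      obtain a where a: "s = seq a" "set a \<subseteq> elts X" "length a = m"
        using *(3) unfolding tuples_iff[symmetric] tuples_def by blast
      \<comment> \<open>The HOL list behind v: its values are elements of a numeral, hence numerals
        themselves, and can be decoded.\<close>
      define vs where "vs = map (\<lambda>i. inv num (app v (num i))) [0..<n]"
      have av: "\<exists>j<m. app v (num i) = num j" if "i < n" for i
        using is_fun_app(2)[OF *(2), of "num i"] that unfolding elts_num by auto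
      have inv: "inv num (num j :: 'u) = j" for j by (rule inv_f_f) (simp add: inj_on_def)
      have "map num vs = map (\<lambda>i. app v (num i)) [0..<n]"
        unfolding vs_def using av inv by (auto; metis)
      then have v: "v = seq (map num vs)" using is_fun_num_seq(1)[OF *(2)] by simp
      have R: "R \<in> syms" "n = ar R" using *(1) arity_iff by auto
      have i: "instance_of V X L (Atom R vs) a"
        unfolding instance_of_def using R a av inv by (auto simp: vs_def; metis)
      have "p = lit_entry (Atom R vs) a"
        unfolding *(4) a(1) v lit_set_Atom[OF i] lit_entry_def by simp
      then show ?thesis using i by blast
    next
      case 2
      then obtain i j s m where *: "is_fun s (elts (num m)) (elts X)" "i \<in> elts (num m)" "j \<in> elts (num m)"
          "p = pair (pair (num 1) (pair i j)) (pair s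
             (the_set {M \<in> elts Str_set. \<forall>x\<in>elts X. pair i x \<in> elts s \<longrightarrow> pair j x \<in> elts s}))"
        unfolding equal_rel_def elts_omega by blast
      obtain a where a: "s = seq a" "set a \<subseteq> elts X" "length a = m"
        using *(1) unfolding tuples_iff[symmetric] tuples_def by blast
      obtain i' j' where ij: "i = num i'" "j = num j'" "i' < m" "j' < m" using *(2,3) unfolding elts_num by blast
      have i: "instance_of V X L (Equal i' j') a" unfolding instance_of_def using a ij by simp
      have "p = lit_entry (Equal i' j') a"
        unfolding *(4) a(1) ij(1,2) lit_set_Equal[OF i] lit_entry_def by simp
      then show ?thesis using i by blast
    qed
  next
    assume "\<exists>l a. instance_of V X L l a \<and> (\<forall>k. l \<noteq> Neg k) \<and> p = lit_entry l a"
    then obtain l a where l: "instance_of V X L l a" "\<forall>k. l \<noteq> Neg k" "p = lit_entry l a" by blast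
    have pV: "p \<in> V" using lit_entry_in_V l by blast
    have a: "set a \<subseteq> elts X" using l(1) unfolding instance_of_def by blast
    then have sa: "is_fun (seq a) (elts (num (length a))) (elts X)"
      using tuples_iff[of "seq a" "length a"] unfolding tuples_def by blast
    have saV: "seq a \<in> V" by (rule seq_instance_in_V[OF l(1)])
    have saS: "seq a \<in> elts (Seqs X)" unfolding elts_Seqs[OF X] using a by blast
    show "p \<in> elts b"
    proof (cases l)
      case (Atom R vs)
      have R: "R \<in> syms" "length vs = ar R" "set vs \<subseteq> {..<length a}"
        using l(1) unfolding Atom instance_of_def by auto
      have vV: "seq (map num vs) \<in> V" by (rule seq_in_V[OF set_map_num])
      have "is_fun (seq (map num vs) :: 'u) (elts (num (length vs))) (elts (num (length a)))"
        by (rule is_fun_cong[OF seq_is_fun(1)[OF set_map_num, of vs, unfolded length_map]])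
          (use seq_is_fun(2)[OF set_map_num, of _ vs] R(3) in \<open>auto simp: elts_num subset_eq\<close>)
      moreover have "pair R (num (length vs)) \<in> elts L" using arity_iff R by auto
      ultimately have "atom_rel (pair R (pair (seq (map num vs)) (seq a))) p"
        unfolding atom_rel_def using sa saV vV syms_V[OF R(1)] l(1,3)
        unfolding elts_omega Atom lit_entry_def
        by (simp add: lit_set_Atom) blast
      moreover have "pair R (pair (seq (map num vs)) (seq a)) \<in> DA"
      proof -
        have "seq (map num vs) \<in> seq ` {xs. set xs \<subseteq> range (num :: nat \<Rightarrow> 'u)}" by (rule imageI) auto
        then show ?thesis unfolding DA_def elts_sym_set elts_Seqs[OF omega_in_V] elts_omega using R saS by blast
      qed
      ultimately show ?thesis unfolding b(2) using pV by blast
    next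
      case (Equal i j)
      have ij: "i < length a" "j < length a" using l(1) unfolding Equal instance_of_def by auto
      have "equal_rel (pair (num i) (pair (num j) (seq a))) p"
        unfolding equal_rel_def using sa saV num_in_V l(1,3) ij
        unfolding elts_omega Equal lit_entry_def
        by (simp add: lit_set_Equal) (use num_mem_num in blast)
      moreover have "pair (num i) (pair (num j) (seq a)) \<in> DE"
        unfolding DE_def elts_omega using saS by auto
      ultimately show ?thesis unfolding b(2) using pV by blast
    next
      case (Neg k)
      then show ?thesis using l(2) by blast
    qed
  qed
  \<comment> \<open>One more layer of negation; the old rows are kept, so the table is the union of
    the iterates.\<close>
  define H where "H = (\<lambda>r. the_set ({p \<in> V. \<exists>q\<in>elts r. neg_lit_rel q p} \<union> elts r))"
  have eH: "elts (H r) = {p \<in> V. \<exists>q\<in>elts r. neg_lit_rel q p} \<union> elts r" if "r \<in> V" for r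
    unfolding H_def by (intro vset_elts_the_set vset_Un vN vset_elts that)
  have tH: "dterm (\<lambda>e. H (e 0))" unfolding H_def
  proof (rule dterm_the_set)
    show "vset ({p \<in> V. \<exists>q\<in>elts (e 0). neg_lit_rel q p} \<union> elts (e 0))" if "range e \<subseteq> V" for e :: "nat \<Rightarrow> 'u"
      using that by (intro vset_Un vN vset_elts) auto
    show "definable (\<lambda>e. e 0 \<in> {p \<in> V. \<exists>q\<in>elts (e (Suc 0)). neg_lit_rel q p} \<union> elts (e (Suc 0)))"
      unfolding Un_iff mem_Collect_eq by (intro definable_intros definable_neg_lit_rel dterm_var)
  qed
  have HV: "(H ^^ n) b \<in> V" for n by (induction n) (use b dterm_comp1_in_V[OF tH] in auto)
  have step: "neg_lit_rel (lit_entry l a) p \<longleftrightarrow> p = lit_entry (Neg l) a" if "instance_of V X L l a" for l a p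
    using lit_set_in_V[OF that] seq_instance_in_V[OF that] lit_code_in_V that lit_set_Neg[OF that]
    unfolding neg_lit_rel_def lit_entry_def by auto
  have sound: "p \<in> elts ((H ^^ n) b) \<Longrightarrow> \<exists>l a. instance_of V X L l a \<and> p = lit_entry l a" for n p
  proof (induction n arbitrary: p)
    case 0 then show ?case using base by auto
  next
    case (Suc n)
    then have "p \<in> elts (H ((H ^^ n) b))" by simp
    then consider "p \<in> elts ((H ^^ n) b)" | q where "q \<in> elts ((H ^^ n) b)" "neg_lit_rel q p"
      unfolding eH[OF HV] by blast
    then show ?case
    proof cases
      case 1 then show ?thesis by (rule Suc.IH)
    next
      case 2
      obtain l a where l: "instance_of V X L l a" "q = lit_entry l a" using Suc.IH[OF 2(1)] by blast
      then have "p = lit_entry (Neg l) a" using 2(2) step[OF l(1)] by simp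
      moreover have "instance_of V X L (Neg l) a" using l(1) unfolding instance_of_def by simp
      ultimately show ?thesis by blast
    qed
  qed
  have complete: "instance_of V X L l a \<Longrightarrow> \<exists>n. lit_entry l a \<in> elts ((H ^^ n) b)" for l a
  proof (induction l)
    case (Atom R vs)
    have "lit_entry (Atom R vs) a \<in> elts b" unfolding base using Atom by blast
    then show ?case by (intro exI[of _ 0]) simp
  next
    case (Equal i j)
    have "lit_entry (Equal i j) a \<in> elts b" unfolding base using Equal by blast
    then show ?case by (intro exI[of _ 0]) simp
  next
    case (Neg l)
    then have l: "instance_of V X L l a" unfolding instance_of_def by simp
    then obtain n where n: "lit_entry l a \<in> elts ((H ^^ n) b)" using Neg.IH by blast
    have "lit_entry (Neg l) a \<in> elts (H ((H ^^ n) b))"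
      unfolding eH[OF HV] using n step[OF l] lit_entry_in_V[OF Neg.prems] by blast
    then show ?case by (intro exI[of _ "Suc n"]) simp
  qed
  have "{lit_entry l a |l a. instance_of V X L l a} = (\<Union>n. elts ((H ^^ n) b))"
  proof (intro equalityI subsetI)
    fix p assume "p \<in> {lit_entry l a |l a. instance_of V X L l a}"
    then obtain l a where l: "instance_of V X L l a" and p: "p = lit_entry l a" by (elim CollectE exE conjE)
    show "p \<in> (\<Union>n. elts ((H ^^ n) b))" unfolding p UN_iff using complete[OF l] by simp
  next
    fix p assume "p \<in> (\<Union>n. elts ((H ^^ n) b))"
    then obtain n where "p \<in> elts ((H ^^ n) b)" by (elim UN_E)
    from sound[OF this] show "p \<in> {lit_entry l a |l a. instance_of V X L l a}"
      unfolding mem_Collect_eq by (elim exE conjE) (intro exI conjI)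
  qed
  then show ?thesis using vset_UN_iterates[OF tH b(1)] by simp
qed

definition lit_entries :: 'u where "lit_entries = the_set {lit_entry l a |l a. instance_of V X L l a}"

lemma lit_entries: "lit_entries \<in> V" "elts lit_entries = {lit_entry l a |l a. instance_of V X L l a}"
  unfolding lit_entries_def using vset_lit_entries vset_in_V by auto

lemma lit_entries_iff:
  assumes "set a \<subseteq> V"
  shows "pair c (pair (seq a) A) \<in> elts lit_entries \<longleftrightarrow> (\<exists>l. instance_of V X L l a \<and> c = lit_code l \<and> A = lit_set a l)"
proof
  assume "pair c (pair (seq a) A) \<in> elts lit_entries"
  then obtain l a' where "instance_of V X L l a'" "c = lit_code l" "seq a = seq a'" "A = lit_set a' l"
    unfolding lit_entries(2) lit_entry_def by auto
  then show "\<exists>l. instance_of V X L l a \<and> c = lit_code l \<and> A = lit_set a l"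
    using seq_inject[OF assms instance_set_V] by auto
qed (auto simp: lit_entries(2) lit_entry_def)

abbreviation conj_set :: "'u list \<Rightarrow> 'u literal list \<Rightarrow> 'u" where
  "conj_set a \<phi> \<equiv> the_set {M \<in> Strs. \<forall>l\<in>set \<phi>. sat_lit M a l}"

definition basic_ok :: "'u literal list \<Rightarrow> 'u list \<Rightarrow> bool" where
  "basic_ok \<phi> a \<longleftrightarrow> (\<forall>l\<in>set \<phi>. instance_of V X L l a) \<and> set a \<subseteq> elts X"

lemma meas_conj: "basic_ok \<phi> a \<Longrightarrow> meas {M \<in> Strs. \<forall>l\<in>set \<phi>. sat_lit M a l}"
proof (induction \<phi>)
  case Nil then show ?case using meas_Str by simp
next
  case (Cons l \<phi>)
  have "{M \<in> Strs. \<forall>k\<in>set (l # \<phi>). sat_lit M a k} =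
      {M \<in> Strs. sat_lit M a l} \<inter> {M \<in> Strs. \<forall>l\<in>set \<phi>. sat_lit M a l}" by auto
  then show ?case using Cons meas_Int meas_sat_lit unfolding basic_ok_def by simp
qed

text \<open>The existence clause forces every entry of f to be the code of a literal that s can
  instantiate, since only these have rows in \<open>lit_entries\<close>. Intersecting their
  interpretations evaluates the conjunction.\<close>

definition basic_rel :: "'u \<Rightarrow> 'u \<Rightarrow> bool" where
  "basic_rel x p \<longleftrightarrow> (\<exists>f\<in>V. \<exists>s\<in>V. x = pair f s \<and>
     (\<forall>i\<in>elts omega. \<forall>c\<in>V. pair i c \<in> elts f \<longrightarrow> (\<exists>A\<in>V. pair c (pair s A) \<in> elts lit_entries)) \<and>
     p = pair (pair (num 0) (pair f s)) (the_set {M \<in> elts Str_set.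
       \<forall>i\<in>elts omega. \<forall>c\<in>V. \<forall>A\<in>V. pair i c \<in> elts f \<longrightarrow> pair c (pair s A) \<in> elts lit_entries \<longrightarrow> M \<in> elts A}))"

lemma definable_basic_rel: "dterm t \<Longrightarrow> dterm s \<Longrightarrow> definable (\<lambda>e. basic_rel (t e) (s e))"
  by (rule definable_comp2[of basic_rel]) (unfold basic_rel_def, intro definable_intros dterm_var dterm_pair
    dterm_const dterm_sep omega_in_V lit_entries Str_set_in_V num_in_V)

lemma basic_code_in_V: "basic_ok \<phi> a \<Longrightarrow> basic_code \<phi> a \<in> V"
  unfolding basic_ok_def basic_code_def
  using lit_code_in_V elts_subset[OF X] by (auto simp: num_in_V intro!: seq_in_V; blast)

lemma basic_rel_seq:
  assumes ok: "basic_ok \<phi> a"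
  shows "basic_rel (pair (seq (map lit_code \<phi>)) (seq a)) p \<longleftrightarrow> p = pair (basic_code \<phi> a) (conj_set a \<phi>)"
proof -
  have aV: "set a \<subseteq> V" using ok elts_subset[OF X] unfolding basic_ok_def by blast
  have lV: "set (map lit_code \<phi>) \<subseteq> V" using ok lit_code_in_V unfolding basic_ok_def by (auto; blast)
  have sV: "seq a \<in> V" "seq (map lit_code \<phi>) \<in> V" using seq_in_V aV lV by auto
  have "\<exists>A\<in>V. pair c (pair (seq a) A) \<in> elts lit_entries" if ic: "pair i c \<in> elts (seq (map lit_code \<phi>))" for i c
  proof -
    obtain j where j: "j < length \<phi>" "c = lit_code (\<phi> ! j)" using ic unfolding pair_mem_seq[OF lV] by auto
    then have "instance_of V X L (\<phi> ! j) a" using ok nth_mem unfolding basic_ok_def by blast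
    then show ?thesis using lit_set_in_V j(2) unfolding lit_entries_iff[OF aV] by blast
  qed
  moreover have "(\<forall>i\<in>elts omega. \<forall>c\<in>V. \<forall>A\<in>V. pair i c \<in> elts (seq (map lit_code \<phi>)) \<longrightarrow>
       pair c (pair (seq a) A) \<in> elts lit_entries \<longrightarrow> M \<in> elts A) \<longleftrightarrow> (\<forall>l\<in>set \<phi>. sat_lit M a l)"
    if M: "M \<in> Strs" for M
  proof -
    have ok': "instance_of V X L (\<phi> ! j) a" if "j < length \<phi>" for j
      using ok that nth_mem unfolding basic_ok_def by blast
    have mem: "M \<in> elts (lit_set a l) \<longleftrightarrow> sat_lit M a l" if "instance_of V X L l a" for l
      using M vset_elts_the_set[OF vset_sat_lit[OF that]] by auto
    have "(\<forall>i\<in>elts omega. \<forall>c\<in>V. \<forall>A\<in>V. pair i c \<in> elts (seq (map lit_code \<phi>)) \<longrightarrow>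
       pair c (pair (seq a) A) \<in> elts lit_entries \<longrightarrow> M \<in> elts A) \<longleftrightarrow>
      (\<forall>j<length \<phi>. M \<in> elts (lit_set a (\<phi> ! j)))"
    proof (intro iffI allI impI ballI)
      fix j assume *: "\<forall>i\<in>elts omega. \<forall>c\<in>V. \<forall>A\<in>V. pair i c \<in> elts (seq (map lit_code \<phi>)) \<longrightarrow>
       pair c (pair (seq a) A) \<in> elts lit_entries \<longrightarrow> M \<in> elts A" and j: "j < length \<phi>"
      have "pair (num j) (lit_code (\<phi> ! j)) \<in> elts (seq (map lit_code \<phi>))"
        unfolding pair_mem_seq[OF lV] using j by auto
      moreover have "pair (lit_code (\<phi> ! j)) (pair (seq a) (lit_set a (\<phi> ! j))) \<in> elts lit_entries"
        unfolding lit_entries_iff[OF aV] using ok'[OF j] by blast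
      moreover have "lit_code (\<phi> ! j) \<in> V" "lit_set a (\<phi> ! j) \<in> V"
        using ok'[OF j] lit_code_in_V lit_set_in_V by blast+
      ultimately show "M \<in> elts (lit_set a (\<phi> ! j))" using * unfolding elts_omega by blast
    next
      fix i c A assume *: "\<forall>j<length \<phi>. M \<in> elts (lit_set a (\<phi> ! j))"
        "pair i c \<in> elts (seq (map lit_code \<phi>))" "pair c (pair (seq a) A) \<in> elts lit_entries"
      obtain j where j: "j < length \<phi>" "c = lit_code (\<phi> ! j)" using *(2) unfolding pair_mem_seq[OF lV] by auto
      obtain l where l: "c = lit_code l" "A = lit_set a l" using *(3) unfolding lit_entries_iff[OF aV] by blast
      show "M \<in> elts A" using *(1) j l lit_code_inject by metis
    qed
    also have "\<dots> \<longleftrightarrow> (\<forall>l\<in>set \<phi>. sat_lit M a l)"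
      using mem ok' by (auto simp: all_set_conv_all_nth)
    finally show ?thesis .
  qed
  then have "{M \<in> elts Str_set. \<forall>i\<in>elts omega. \<forall>c\<in>V. \<forall>A\<in>V. pair i c \<in> elts (seq (map lit_code \<phi>)) \<longrightarrow>
       pair c (pair (seq a) A) \<in> elts lit_entries \<longrightarrow> M \<in> elts A} = {M \<in> Strs. \<forall>l\<in>set \<phi>. sat_lit M a l}"
    unfolding elts_Str_set by blast
  ultimately show ?thesis unfolding basic_rel_def basic_code_def using sV by auto
qed

definition basic_entries :: 'u where
  "basic_entries = the_set {pair (basic_code \<phi> a) (conj_set a \<phi>) |\<phi> a. basic_ok \<phi> a}"

lemma basic_entries: "basic_entries \<in> V" "elts basic_entries = {pair (basic_code \<phi> a) (conj_set a \<phi>) |\<phi> a. basic_ok \<phi> a}"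
proof -
  \<comment> \<open>The field of the table contains all codes of literals in use, so its finite
    sequences include every coded conjunction; \<open>basic_rel\<close> discards the rest.\<close>
  define D where "D = {pair x y |x y. x \<in> elts (Seqs (field_set lit_entries)) \<and> y \<in> elts (Seqs X)}"
  have vD: "vset D" unfolding D_def by (intro vset_times vset_elts Seqs_in_V field_set_in_V lit_entries X)
  have v: "vset {p \<in> V. \<exists>x\<in>D. basic_rel x p}"
    by (rule vset_repl_rel[OF definable_basic_rel vD]) (auto simp: basic_rel_def)
  have "{p \<in> V. \<exists>x\<in>D. basic_rel x p} = {pair (basic_code \<phi> a) (conj_set a \<phi>) |\<phi> a. basic_ok \<phi> a}"
  proof (intro equalityI subsetI)
    fix p assume "p \<in> {p \<in> V. \<exists>x\<in>D. basic_rel x p}"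
    then obtain cs a where cs: "set cs \<subseteq> elts (field_set lit_entries)" and a: "set a \<subseteq> elts X"
      and p: "basic_rel (pair (seq cs) (seq a)) p"
      unfolding D_def elts_Seqs[OF field_set_in_V[OF lit_entries(1)]] elts_Seqs[OF X] by blast
    have aV: "set a \<subseteq> V" using a elts_subset[OF X] by blast
    have cV: "set cs \<subseteq> V" using cs elts_subset[OF field_set_in_V[OF lit_entries(1)]] by blast
    have "\<exists>l. instance_of V X L l a \<and> c = lit_code l" if "c \<in> set cs" for c
    proof -
      obtain i where i: "i < length cs" "c = cs ! i" using \<open>c \<in> set cs\<close> by (metis in_set_conv_nth)
      have "pair (num i) c \<in> elts (seq cs)" unfolding pair_mem_seq[OF cV] using i by blast
      moreover have "c \<in> V" using cV that by blast
      ultimately have "\<exists>A\<in>V. pair c (pair (seq a) A) \<in> elts lit_entries"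
        using p unfolding basic_rel_def elts_omega by auto
      then show ?thesis unfolding lit_entries_iff[OF aV] by blast
    qed
    then obtain f where f: "\<And>c. c \<in> set cs \<Longrightarrow> instance_of V X L (f c) a \<and> c = lit_code (f c)" by metis
    have eq: "map lit_code (map f cs) = cs" using f by (auto simp: o_def intro!: map_idI)
    have ok: "basic_ok (map f cs) a" unfolding basic_ok_def using f a by auto
    have "p = pair (basic_code (map f cs) a) (conj_set a (map f cs))"
      using basic_rel_seq[OF ok, of p] p unfolding eq by blast
    then show "p \<in> {pair (basic_code \<phi> a) (conj_set a \<phi>) |\<phi> a. basic_ok \<phi> a}" using ok by blast
  next
    fix p assume "p \<in> {pair (basic_code \<phi> a) (conj_set a \<phi>) |\<phi> a. basic_ok \<phi> a}"
    then obtain \<phi> a where p: "p = pair (basic_code \<phi> a) (conj_set a \<phi>)" and ok: "basic_ok \<phi> a" by blast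
    have "lit_code l \<in> elts (field_set lit_entries)" if "l \<in> set \<phi>" for l
      by (rule field_setI1[OF lit_entries(1), of _ "pair (seq a) (lit_set a l)"])
        (use ok that in \<open>auto simp: lit_entries(2) lit_entry_def basic_ok_def\<close>)
    then have "seq (map lit_code \<phi>) \<in> elts (Seqs (field_set lit_entries))"
      unfolding elts_Seqs[OF field_set_in_V[OF lit_entries(1)]] by (intro imageI) auto
    moreover have "seq a \<in> elts (Seqs X)" using ok unfolding basic_ok_def elts_Seqs[OF X] by blast
    ultimately have "pair (seq (map lit_code \<phi>)) (seq a) \<in> D" unfolding D_def by blast
    moreover have "p \<in> V" unfolding p using basic_code_in_V[OF ok] vset_in_V[OF meas_vset[OF meas_conj[OF ok]]] by simp
    ultimately show "p \<in> {p \<in> V. \<exists>x\<in>D. basic_rel x p}" using basic_rel_seq[OF ok] p by blast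
  qed
  then show "basic_entries \<in> V" "elts basic_entries = {pair (basic_code \<phi> a) (conj_set a \<phi>) |\<phi> a. basic_ok \<phi> a}"
    unfolding basic_entries_def using v vset_in_V by auto
qed

end

subsection \<open>The hierarchy of Borel codes\<close>

context structures
begin

abbreviation "Codes \<equiv> borel_codes V \<kappa> X L"
abbreviation "interp \<equiv> interprets V \<kappa> X L"

lemma basic_code_inject:
  assumes "basic_ok \<phi> a" "basic_ok \<psi> b"
  shows "basic_code \<phi> a = basic_code \<psi> b \<longleftrightarrow> \<phi> = \<psi> \<and> a = b"
proof -
  have V: "set a \<subseteq> V" "set b \<subseteq> V" "set (map lit_code \<phi>) \<subseteq> V" "set (map lit_code \<psi>) \<subseteq> V"
    using assms elts_subset[OF X] lit_code_in_V unfolding basic_ok_def by (auto; blast)+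
  have inj: "inj (lit_code :: 'u literal \<Rightarrow> 'u)" unfolding inj_def using lit_code_inject by blast
  show ?thesis
    unfolding basic_code_def pair_inject seq_inject[OF V(1,2)] seq_inject[OF V(3,4)] inj_map_eq_map[OF inj]
    by blast
qed

text \<open>Codes can be read uniquely: the tags 0 to 3 separate the four forms and basic codes are
  injective. Hence \<open>Int_code\<close>, a definite description, is well defined wherever an
  interpretation exists.\<close>

lemma interprets_unique: "interp \<gamma> S \<Longrightarrow> interp \<gamma> S' \<Longrightarrow> S = S'"
proof (induction arbitrary: S' rule: interprets.induct)
  case (basic \<phi> a)
  have ok: "basic_ok \<phi> a" unfolding basic_ok_def using basic(1,2) by blast
  from basic(3) show ?case
  proof (cases rule: interprets.cases)
    case (basic \<psi> b)
    have "basic_ok \<psi> b" unfolding basic_ok_def using basic(3,4) by blast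
    then have "\<phi> = \<psi> \<and> a = b" using basic_code_inject[OF ok] basic(1) by blast
    then show ?thesis using basic(2) by simp
  qed (auto simp: basic_code_def neg_code_def Or_code_def And_code_def)
next
  case (neg \<gamma> S)
  from neg(4) show ?case
    by (cases rule: interprets.cases)
      (use neg(3) in \<open>auto simp: basic_code_def neg_code_def Or_code_def And_code_def\<close>)
next
  case (Or \<Gamma> S)
  note IH = Or.IH
  from Or(5) show ?case
  proof (cases rule: interprets.cases)
    case (Or \<Gamma>' stage)
    then have e: "\<Gamma>' = \<Gamma>" by (simp add: Or_code_def)
    have "S \<gamma> = stage \<gamma>" if "\<gamma> \<in> elts \<Gamma>" for \<gamma>
      using IH[of \<gamma> "stage \<gamma>"] Or(5)[of \<gamma>] that unfolding e by simp
    then show ?thesis unfolding Or(2) e by simp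
  qed (auto simp: basic_code_def neg_code_def Or_code_def And_code_def)
next
  case (And \<Gamma> S)
  note IH = And.IH
  from And(5) show ?case
  proof (cases rule: interprets.cases)
    case (And \<Gamma>' stage)
    then have e: "\<Gamma>' = \<Gamma>" by (simp add: And_code_def)
    have "S \<gamma> = stage \<gamma>" if "\<gamma> \<in> elts \<Gamma>" for \<gamma>
      using IH[of \<gamma> "stage \<gamma>"] And(5)[of \<gamma>] that unfolding e by simp
    then show ?thesis unfolding And(2) e by simp
  qed (auto simp: basic_code_def neg_code_def Or_code_def And_code_def)
qed

text \<open>Replaces the definite description \<open>app\<close> by membership of pairs, which makes
  the notion visibly definable.\<close>

lemma kappa_indexed_iff:
  "kappa_indexed V \<kappa> \<Gamma> \<longleftrightarrow> \<Gamma> \<in> V \<and>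
     (\<exists>f\<in>V. is_fun f (elts \<kappa>) (elts \<Gamma>) \<and> (\<forall>\<gamma>\<in>elts \<Gamma>. \<exists>i\<in>elts \<kappa>. pair i \<gamma> \<in> elts f))"
proof -
  have "app f ` elts \<kappa> = elts \<Gamma> \<longleftrightarrow> (\<forall>\<gamma>\<in>elts \<Gamma>. \<exists>i\<in>elts \<kappa>. pair i \<gamma> \<in> elts f)"
    if "is_fun f (elts \<kappa>) (elts \<Gamma>)" for f
    using is_fun_mem_iff[OF that] is_fun_app(2)[OF that] by fastforce
  then show ?thesis unfolding kappa_indexed_def by blast
qed

lemma kappa_nonempty: "elts \<kappa> \<noteq> {}"
  using kappa(3) by auto

lemma kappa_indexed_nonempty: "kappa_indexed V \<kappa> \<Gamma> \<Longrightarrow> elts \<Gamma> \<noteq> {}"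
  unfolding kappa_indexed_def using kappa_nonempty by auto

definition neg_rel :: "'u \<Rightarrow> 'u \<Rightarrow> bool" where
  "neg_rel q p \<longleftrightarrow> (\<exists>\<gamma>\<in>V. \<exists>A\<in>V. q = pair \<gamma> A \<and>
     p = pair (pair (num 1) \<gamma>) (the_set (elts Str_set - elts A)))"

definition joinable :: "'u \<Rightarrow> 'u \<Rightarrow> bool" where
  "joinable r \<Gamma> \<longleftrightarrow> kappa_indexed V \<kappa> \<Gamma> \<and> (\<forall>\<gamma>\<in>elts \<Gamma>. \<exists>A\<in>V. pair \<gamma> A \<in> elts r)"

definition or_set :: "'u \<Rightarrow> 'u \<Rightarrow> 'u" where
  "or_set r \<Gamma> = the_set {M \<in> elts Str_set. \<exists>\<gamma>\<in>elts \<Gamma>. \<exists>A\<in>V. pair \<gamma> A \<in> elts r \<and> M \<in> elts A}"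

definition and_set :: "'u \<Rightarrow> 'u \<Rightarrow> 'u" where
  "and_set r \<Gamma> = the_set {M \<in> elts Str_set. \<forall>\<gamma>\<in>elts \<Gamma>. \<forall>A\<in>V. pair \<gamma> A \<in> elts r \<longrightarrow> M \<in> elts A}"

lemma definable_neg_rel: "dterm t \<Longrightarrow> dterm s \<Longrightarrow> definable (\<lambda>e. neg_rel (t e) (s e))"
  by (rule definable_comp2[of neg_rel]) (unfold neg_rel_def, intro definable_intros dterm_var dterm_pair
    dterm_const dterm_Diff Str_set_in_V num_in_V)

lemma definable_joinable: "dterm t \<Longrightarrow> dterm s \<Longrightarrow> definable (\<lambda>e. joinable (t e) (s e))"
  by (rule definable_comp2[of joinable]) (unfold joinable_def kappa_indexed_iff, intro definable_intros definable_is_fun dterm_var dterm_pair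
    dterm_const kappa)

lemma dterm_or_set: "dterm t \<Longrightarrow> dterm s \<Longrightarrow> dterm (\<lambda>e. or_set (t e) (s e))"
  by (rule dterm_comp2[of or_set]) (unfold or_set_def, intro dterm_sep definable_intros dterm_var dterm_pair dterm_const Str_set_in_V)

lemma dterm_and_set: "dterm t \<Longrightarrow> dterm s \<Longrightarrow> dterm (\<lambda>e. and_set (t e) (s e))"
  by (rule dterm_comp2[of and_set]) (unfold and_set_def, intro dterm_sep definable_intros dterm_var dterm_pair dterm_const Str_set_in_V)

text \<open>Replacement needs a set of possible families of codes. The power set of the field
  contains every set of codes occurring in r, and \<open>joinable\<close> selects the usable
  ones.\<close>

definition code_sets :: "'u \<Rightarrow> 'u" where
  "code_sets r = the_set {y \<in> V. elts y \<subseteq> elts (field_set r)}"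

lemma dterm_code_sets: "dterm t \<Longrightarrow> dterm (\<lambda>e. code_sets (t e))"
  unfolding code_sets_def by (intro dterm_Pow dterm_field_set)

lemma code_sets: "r \<in> V \<Longrightarrow> code_sets r \<in> V" "r \<in> V \<Longrightarrow> elts (code_sets r) = {y \<in> V. elts y \<subseteq> elts (field_set r)}"
  unfolding code_sets_def using vset_Pow[OF field_set_in_V] vset_in_V by auto

text \<open>
  One step of a cumulative hierarchy of pairs of a code and its interpretation. The codes need not form
  a set of \<open>V\<close>, but every stage does.
\<close>

definition stage_set :: "'u \<Rightarrow> 'u set" where
  "stage_set r = elts basic_entries \<union> {p \<in> V. \<exists>q\<in>elts r. neg_rel q p} \<union>
     {p \<in> V. \<exists>\<Gamma>\<in>elts (code_sets r). joinable r \<Gamma> \<and> p = pair (pair (num 2) \<Gamma>) (or_set r \<Gamma>)} \<union>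
     {p \<in> V. \<exists>\<Gamma>\<in>elts (code_sets r). joinable r \<Gamma> \<and> p = pair (pair (num 3) \<Gamma>) (and_set r \<Gamma>)}"

definition stage :: "'u \<Rightarrow> 'u" where
  "stage r = the_set (stage_set r)"

lemma vset_stage_set: assumes r: "r \<in> V" shows "vset (stage_set r)"
proof -
  have "vset {p \<in> V. \<exists>q\<in>elts r. neg_rel q p}"
    by (rule vset_repl_rel[OF definable_neg_rel vset_elts[OF r]]) (auto simp: neg_rel_def)
  moreover have "vset {p \<in> V. \<exists>\<Gamma>\<in>elts (code_sets r). joinable r \<Gamma> \<and> p = pair (pair (num 2) \<Gamma>) (or_set r \<Gamma>)}"
    by (rule vset_repl[OF _ vset_elts[OF code_sets(1)[OF r]]])
      (intro definable_intros definable_joinable dterm_pair dterm_or_set dterm_const dterm_var num_in_V r, simp)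
  moreover have "vset {p \<in> V. \<exists>\<Gamma>\<in>elts (code_sets r). joinable r \<Gamma> \<and> p = pair (pair (num 3) \<Gamma>) (and_set r \<Gamma>)}"
    by (rule vset_repl[OF _ vset_elts[OF code_sets(1)[OF r]]])
      (intro definable_intros definable_joinable dterm_pair dterm_and_set dterm_const dterm_var num_in_V r, simp)
  ultimately show ?thesis unfolding stage_set_def by (intro vset_Un vset_elts basic_entries(1))
qed

lemma elts_stage: "r \<in> V \<Longrightarrow> elts (stage r) = stage_set r"
  unfolding stage_def by (intro vset_elts_the_set vset_stage_set)

lemma dterm_stage: "dterm (\<lambda>e. stage (e 0))"
  unfolding stage_def
proof (rule dterm_the_set)
  show "vset (stage_set (e 0))" if "range e \<subseteq> V" for e :: "nat \<Rightarrow> 'u" using that by (intro vset_stage_set) auto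
  show "definable (\<lambda>e. e 0 \<in> stage_set (e (Suc 0)))"
    unfolding stage_set_def Un_iff mem_Collect_eq
    by (intro definable_intros definable_neg_rel definable_joinable dterm_code_sets dterm_or_set dterm_and_set dterm_pair dterm_var dterm_const
        num_in_V basic_entries(1))
qed

section \<open>Soundness of the stages\<close>

definition sound :: "'u \<Rightarrow> bool" where
  "sound p \<longleftrightarrow> (\<exists>\<gamma> A. p = pair \<gamma> A \<and> \<gamma> \<in> Codes \<and> A \<in> Sig \<and> interp \<gamma> (elts A))"

lemma sound_pair: "sound (pair \<gamma> A) \<longleftrightarrow> \<gamma> \<in> Codes \<and> A \<in> Sig \<and> interp \<gamma> (elts A)"
  unfolding sound_def by auto

text \<open>Uniqueness of interpretations makes r functional on codes, so \<open>tapp r\<close>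
  reads it off. Composed with the enumeration of the family, it gives a sequence of length kappa in
  V, whose union is measurable.\<close>

lemma joinable_sound:
  assumes r: "r \<in> V" "\<forall>p\<in>elts r. sound p" and j: "joinable r \<Gamma>"
  defines "a \<equiv> tapp r"
  shows "\<And>\<gamma> A. \<gamma> \<in> elts \<Gamma> \<Longrightarrow> pair \<gamma> A \<in> elts r \<longleftrightarrow> A = a \<gamma>"
    "\<And>\<gamma>. \<gamma> \<in> elts \<Gamma> \<Longrightarrow> sound (pair \<gamma> (a \<gamma>)) \<and> a \<gamma> \<in> V"
    "meas (\<Union>\<gamma>\<in>elts \<Gamma>. elts (a \<gamma>))" "meas (\<Inter>\<gamma>\<in>elts \<Gamma>. elts (a \<gamma>))"
proof -
  have u: "A = B" if "pair \<gamma> A \<in> elts r" "pair \<gamma> B \<in> elts r" for \<gamma> A B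
  proof -
    have "interp \<gamma> (elts A)" "interp \<gamma> (elts B)" using r(2) that unfolding sound_def by auto
    then show ?thesis using interprets_unique elts_inject by metis
  qed
  have ex: "\<exists>A. pair \<gamma> A \<in> elts r" if "\<gamma> \<in> elts \<Gamma>" for \<gamma> using j that unfolding joinable_def by blast
  have a: "pair \<gamma> A \<in> elts r \<Longrightarrow> a \<gamma> = A" for \<gamma> A
    unfolding a_def by (rule tapp_eqI[OF r(1)]) (use u in blast)+
  show mem: "pair \<gamma> A \<in> elts r \<longleftrightarrow> A = a \<gamma>" if "\<gamma> \<in> elts \<Gamma>" for \<gamma> A
    using a ex[OF that] by blast
  show g: "sound (pair \<gamma> (a \<gamma>)) \<and> a \<gamma> \<in> V" if "\<gamma> \<in> elts \<Gamma>" for \<gamma>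
  proof -
    have "pair \<gamma> (a \<gamma>) \<in> elts r" using mem[OF that] by simp
    then show ?thesis using r in_V_elts[OF r(1)] pair_in_V by blast
  qed
  have Sig: "a \<gamma> \<in> Sig" if "\<gamma> \<in> elts \<Gamma>" for \<gamma> using g[OF that] unfolding sound_pair by blast
  obtain f where f: "f \<in> V" "is_fun f (elts \<kappa>) (elts \<Gamma>)" "app f ` elts \<kappa> = elts \<Gamma>"
    using j unfolding joinable_def kappa_indexed_def by blast
  have tf: "tapp f i = app f i" if "i \<in> elts \<kappa>" for i
    by (rule tapp_eqI[OF f(1)]) (use is_fun_mem_iff[OF f(2)] that in auto)
  have fG: "app f i \<in> elts \<Gamma>" if "i \<in> elts \<kappa>" for i using is_fun_app(2)[OF f(2) that] .
  have t1: "dterm (\<lambda>e. tapp r (tapp f (e 0)))" by (intro dterm_tapp dterm_const dterm_var r f)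
  have s1: "(\<lambda>i. tapp r (tapp f i)) ` elts \<kappa> \<subseteq> Sig"
    using tf fG Sig unfolding a_def by auto
  obtain h where h: "h \<in> V" "is_fun h (elts \<kappa>) Sig" "\<And>i. i \<in> elts \<kappa> \<Longrightarrow> app h i = tapp r (tapp f i)"
    using fun_in_V[OF t1 vset_elts[OF kappa(1)] s1] by blast
  have "(\<Union>i\<in>elts \<kappa>. elts (app h i)) = (\<Union>\<gamma>\<in>elts \<Gamma>. elts (a \<gamma>))"
    unfolding f(3)[symmetric] a_def using h(3) tf by auto
  then show "meas (\<Union>\<gamma>\<in>elts \<Gamma>. elts (a \<gamma>))"
    using meas_UN_image[OF kappa(1,2) subset_refl h(1,2)] by simp
  \<comment> \<open>Intersections are reduced to unions of the complements, so the same indexing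
    argument is run for these.\<close>
  have t2: "dterm (\<lambda>e. the_set (elts Str_set - elts (tapp r (tapp f (e 0)))))"
    by (intro dterm_Diff dterm_tapp dterm_const dterm_var r f Str_set_in_V)
  have mc: "meas (Strs - elts (a \<gamma>))" if "\<gamma> \<in> elts \<Gamma>" for \<gamma> by (rule meas_compl[OF meas_elts[OF Sig[OF that]]])
  have s2: "(\<lambda>i. the_set (elts Str_set - elts (tapp r (tapp f i)))) ` elts \<kappa> \<subseteq> Sig"
    using tf fG mc unfolding a_def elts_Str_set meas_def by auto
  obtain k where k: "k \<in> V" "is_fun k (elts \<kappa>) Sig"
      "\<And>i. i \<in> elts \<kappa> \<Longrightarrow> app k i = the_set (elts Str_set - elts (tapp r (tapp f i)))"
    using fun_in_V[OF t2 vset_elts[OF kappa(1)] s2] by blast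
  have "elts (app k i) = Strs - elts (a (app f i))" if "i \<in> elts \<kappa>" for i
    unfolding k(3)[OF that] tf[OF that] elts_Str_set a_def[symmetric]
    by (rule vset_elts_the_set[OF meas_vset[OF mc[OF fG[OF that]]]])
  then have "(\<Union>i\<in>elts \<kappa>. elts (app k i)) = (\<Union>\<gamma>\<in>elts \<Gamma>. Strs - elts (a \<gamma>))"
    unfolding f(3)[symmetric] by auto
  then have "meas (\<Union>\<gamma>\<in>elts \<Gamma>. Strs - elts (a \<gamma>))"
    using meas_UN_image[OF kappa(1,2) subset_refl k(1,2)] by simp
  \<comment> \<open>Nonemptiness of the family matters here: an empty HOL intersection would be the
    whole type and not the set of structures.\<close>
  moreover have "(\<Inter>\<gamma>\<in>elts \<Gamma>. elts (a \<gamma>)) = Strs - (\<Union>\<gamma>\<in>elts \<Gamma>. Strs - elts (a \<gamma>))"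
    using kappa_indexed_nonempty[of \<Gamma>] j Sig sigma_in_V unfolding joinable_def by blast
  ultimately show "meas (\<Inter>\<gamma>\<in>elts \<Gamma>. elts (a \<gamma>))" using meas_compl by metis
qed

lemma or_set_eq:
  assumes r: "r \<in> V" "\<forall>p\<in>elts r. sound p" and j: "joinable r \<Gamma>"
  shows "elts (or_set r \<Gamma>) = (\<Union>\<gamma>\<in>elts \<Gamma>. elts (tapp r \<gamma>))" "or_set r \<Gamma> \<in> Sig"
    "interp (Or_code \<Gamma>) (elts (or_set r \<Gamma>))" "Or_code \<Gamma> \<in> Codes"
proof -
  note G = joinable_sound[OF r j]
  have "{M \<in> elts Str_set. \<exists>\<gamma>\<in>elts \<Gamma>. \<exists>A\<in>V. pair \<gamma> A \<in> elts r \<and> M \<in> elts A} = (\<Union>\<gamma>\<in>elts \<Gamma>. elts (tapp r \<gamma>))"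
    using G(1,2) meas_subset[OF G(3)] unfolding elts_Str_set by auto
  then have o: "or_set r \<Gamma> = the_set (\<Union>\<gamma>\<in>elts \<Gamma>. elts (tapp r \<gamma>))" unfolding or_set_def by simp
  then show e: "elts (or_set r \<Gamma>) = (\<Union>\<gamma>\<in>elts \<Gamma>. elts (tapp r \<gamma>))" and "or_set r \<Gamma> \<in> Sig"
    using G(3) unfolding meas_def by auto
  have k: "kappa_indexed V \<kappa> \<Gamma>" using j unfolding joinable_def by blast
  show "interp (Or_code \<Gamma>) (elts (or_set r \<Gamma>))" unfolding e
    by (rule interprets.Or[OF k]) (use G(2) in \<open>auto simp: sound_pair\<close>)
  show "Or_code \<Gamma> \<in> Codes" by (rule borel_codes.Or[OF k]) (use G(2) in \<open>auto simp: sound_pair\<close>)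
qed

lemma and_set_eq:
  assumes r: "r \<in> V" "\<forall>p\<in>elts r. sound p" and j: "joinable r \<Gamma>"
  shows "elts (and_set r \<Gamma>) = (\<Inter>\<gamma>\<in>elts \<Gamma>. elts (tapp r \<gamma>))" "and_set r \<Gamma> \<in> Sig"
    "interp (And_code \<Gamma>) (elts (and_set r \<Gamma>))" "And_code \<Gamma> \<in> Codes"
proof -
  note G = joinable_sound[OF r j]
  have "{M \<in> elts Str_set. \<forall>\<gamma>\<in>elts \<Gamma>. \<forall>A\<in>V. pair \<gamma> A \<in> elts r \<longrightarrow> M \<in> elts A} = (\<Inter>\<gamma>\<in>elts \<Gamma>. elts (tapp r \<gamma>))"
    using G(1,2) meas_subset[OF G(4)] unfolding elts_Str_set by auto
  then have o: "and_set r \<Gamma> = the_set (\<Inter>\<gamma>\<in>elts \<Gamma>. elts (tapp r \<gamma>))" unfolding and_set_def by simp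
  then show e: "elts (and_set r \<Gamma>) = (\<Inter>\<gamma>\<in>elts \<Gamma>. elts (tapp r \<gamma>))" and "and_set r \<Gamma> \<in> Sig"
    using G(4) unfolding meas_def by auto
  have k: "kappa_indexed V \<kappa> \<Gamma>" using j unfolding joinable_def by blast
  show "interp (And_code \<Gamma>) (elts (and_set r \<Gamma>))" unfolding e
    by (rule interprets.And[OF k]) (use G(2) in \<open>auto simp: sound_pair\<close>)
  show "And_code \<Gamma> \<in> Codes" by (rule borel_codes.And[OF k]) (use G(2) in \<open>auto simp: sound_pair\<close>)
qed

lemma basic_sound: assumes ok: "basic_ok \<phi> a" shows "sound (pair (basic_code \<phi> a) (conj_set a \<phi>))"
proof -
  have e: "elts (conj_set a \<phi>) = {M \<in> Strs. \<forall>l\<in>set \<phi>. sat_lit M a l}" and "conj_set a \<phi> \<in> Sig"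
    using meas_conj[OF ok] unfolding meas_def by auto
  moreover have "interp (basic_code \<phi> a) (elts (conj_set a \<phi>))" unfolding e
    by (rule interprets.basic) (use ok in \<open>auto simp: basic_ok_def\<close>)
  moreover have "basic_code \<phi> a \<in> Codes"
    by (rule borel_codes.basic) (use ok in \<open>auto simp: basic_ok_def\<close>)
  ultimately show ?thesis unfolding sound_pair by blast
qed

lemma neg_sound: assumes "sound (pair \<gamma> A)"
  shows "sound (pair (neg_code \<gamma>) (the_set (elts Str_set - elts A)))"
    "elts (the_set (elts Str_set - elts A)) = Strs - elts A"
proof -
  have g: "\<gamma> \<in> Codes" "A \<in> Sig" "interp \<gamma> (elts A)" using assms unfolding sound_pair by auto
  have m: "meas (elts Str_set - elts A)" unfolding elts_Str_set by (rule meas_compl[OF meas_elts[OF g(2)]])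
  show e: "elts (the_set (elts Str_set - elts A)) = Strs - elts A"
    using vset_elts_the_set[OF meas_vset[OF m]] unfolding elts_Str_set .
  show "sound (pair (neg_code \<gamma>) (the_set (elts Str_set - elts A)))"
    unfolding sound_pair e using m borel_codes.neg[OF g(1)] interprets.neg[OF g(1,3)] unfolding meas_def by blast
qed

lemma stage_set_sound:
  assumes r: "r \<in> V" "\<forall>p\<in>elts r. sound p" and p: "p \<in> stage_set r"
  shows "sound p"
proof -
  consider "p \<in> elts basic_entries" | q where "q \<in> elts r" "neg_rel q p"
    | \<Gamma> where "joinable r \<Gamma>" "p = pair (pair (num 2) \<Gamma>) (or_set r \<Gamma>)"
    | \<Gamma> where "joinable r \<Gamma>" "p = pair (pair (num 3) \<Gamma>) (and_set r \<Gamma>)"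
    using p unfolding stage_set_def by blast
  then show ?thesis
  proof cases
    case 1 then show ?thesis unfolding basic_entries(2) using basic_sound by blast
  next
    case 2 then show ?thesis using r(2) neg_sound(1) unfolding neg_rel_def neg_code_def by blast
  next
    case 3 then show ?thesis using or_set_eq(2,3,4)[OF r 3(1)] unfolding Or_code_def by (simp add: sound_pair)
  next
    case 4 then show ?thesis using and_set_eq(2,3,4)[OF r 4(1)] unfolding And_code_def by (simp add: sound_pair)
  qed
qed

text \<open>The input of stage a. \<open>stage_set\<close> does not retain all of its argument;
  accumulation comes from this union over all earlier stages.\<close>

definition below :: "'u \<Rightarrow> 'u" where
  "below a = the_set (\<Union>b\<in>elts a. elts (orec stage b))"

lemma elts_below: "a \<in> V \<Longrightarrow> ordinal a \<Longrightarrow> elts (below a) = (\<Union>b\<in>elts a. elts (orec stage b))"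
  unfolding below_def by (rule elts_UN_orec[OF dterm_stage])

lemma below_in_V: "a \<in> V \<Longrightarrow> ordinal a \<Longrightarrow> below a \<in> V"
proof -
  assume a: "a \<in> V" "ordinal a"
  have v: "vset ((\<lambda>b. pair b (orec stage b)) ` elts a)" by (rule vset_orec_graph[OF dterm_stage a])
  define g where "g = the_set ((\<lambda>b. pair b (orec stage b)) ` elts a)"
  have g: "g \<in> V" "elts g = (\<lambda>b. pair b (orec stage b)) ` elts a" unfolding g_def using v vset_in_V by auto
  have "tapp g b = orec stage b" if "b \<in> elts a" for b
    by (rule tapp_eqI[OF g(1)]) (use that in \<open>auto simp: g(2)\<close>)
  then have "below a = the_set (\<Union>b\<in>elts a. elts (tapp g b))" unfolding below_def by simp
  also have "\<dots> \<in> V" by (rule dterm_constD) (intro dterm_UN dterm_tapp dterm_const dterm_var g a)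
  finally show ?thesis .
qed

lemma elts_orec: "a \<in> V \<Longrightarrow> ordinal a \<Longrightarrow> elts (orec stage a) = stage_set (below a)"
  unfolding orec.simps[of stage a] below_def[symmetric] by (intro elts_stage below_in_V)

lemma orec_sound: "a \<in> V \<Longrightarrow> ordinal a \<Longrightarrow> \<forall>p\<in>elts (orec stage a). sound p"
proof (induction a rule: elem_induct)
  case (step a)
  have "\<forall>p\<in>elts (below a). sound p"
    unfolding elts_below[OF step.prems] using step.IH in_V_elts[OF step.prems(1)] ordinal_elem[OF step.prems(2)]
    by fastforce
  then show ?case unfolding elts_orec[OF step.prems] using stage_set_sound[OF below_in_V[OF step.prems]] by blast
qed

lemma below_sound: "a \<in> V \<Longrightarrow> ordinal a \<Longrightarrow> \<forall>p\<in>elts (below a). sound p"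
  unfolding elts_below using orec_sound in_V_elts ordinal_elem by (metis (no_types, lifting) UN_E)

section \<open>All codes and all measurable sets appear in the hierarchy\<close>

definition coded :: "'u \<Rightarrow> bool" where
  "coded p \<longleftrightarrow> (\<exists>a\<in>V. ordinal a \<and> p \<in> elts (orec stage a))"

lemma coded_sound: "coded p \<Longrightarrow> sound p"
  unfolding coded_def using orec_sound by blast

text \<open>\<open>orec_bound\<close> for the property of a stage to contain a witness. It gathers
  set-many codes of unknown rank below a single ordinal, where they can be joined.\<close>

lemma coded_bound:
  assumes d: "definable (\<lambda>e. P (e 1) (e 0))" and F: "F \<in> V"
    and ex: "\<And>x. x \<in> elts F \<Longrightarrow> \<exists>p. coded p \<and> P x p"
  obtains a where "a \<in> V" "ordinal a" "\<And>x. x \<in> elts F \<Longrightarrow> \<exists>p\<in>elts (below a). P x p"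
proof -
  have "definable (\<lambda>e. \<exists>p\<in>elts (e 0). P (e 1) p)"
  proof (rule definable_bex[OF dterm_var])
    show "definable (\<lambda>e. P (e (Suc 1)) (e 0))"
      using definable_reindex[OF d, of "case_nat 0 (\<lambda>_. 2)"] by (simp add: numeral_2_eq_2)
  qed
  from orec_bound[OF dterm_stage this F]
  obtain a where a: "a \<in> V" "ordinal a" "\<And>x. x \<in> elts F \<Longrightarrow> \<exists>b\<in>elts a. \<exists>p\<in>elts (orec stage b). P x p"
    using ex unfolding coded_def by (metis (no_types, lifting))
  show thesis by (rule that[OF a(1,2)]) (use a(3) elts_below[OF a(1,2)] in blast)
qed

lemma coded_basic: "basic_ok \<phi> a \<Longrightarrow> coded (pair (basic_code \<phi> a) (conj_set a \<phi>))"
  unfolding coded_def using elts_orec[OF num_in_V ordinal_num, of 0] num_in_V[of 0] ordinal_num[of 0]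
  unfolding stage_set_def basic_entries(2) by blast

lemma coded_stage: "a \<in> V \<Longrightarrow> ordinal a \<Longrightarrow> p \<in> stage_set (below a) \<Longrightarrow> coded p"
  unfolding coded_def using elts_orec by blast

lemma coded_in_V: assumes "coded (pair \<gamma> A)" shows "\<gamma> \<in> V" "A \<in> V"
proof -
  obtain a where "a \<in> V" "ordinal a" "pair \<gamma> A \<in> elts (orec stage a)" using assms unfolding coded_def by blast
  then have "pair \<gamma> A \<in> V" using orec_in_V[OF dterm_stage] in_V_elts by blast
  then show "\<gamma> \<in> V" "A \<in> V" by auto
qed

lemma coded_neg:
  assumes "coded (pair \<gamma> A)" shows "coded (pair (neg_code \<gamma>) (the_set (elts Str_set - elts A)))"
proof -
  have V: "\<gamma> \<in> V" "A \<in> V" by (rule coded_in_V[OF assms])+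
  \<comment> \<open>The bound for a singleton yields an ordinal strictly above some stage containing
    this pair.\<close>
  obtain a where a: "a \<in> V" "ordinal a" "\<And>x. x \<in> elts (the_set {\<gamma>}) \<Longrightarrow> \<exists>p\<in>elts (below a). p = pair \<gamma> A"
    by (rule coded_bound[where P = "\<lambda>x p. p = pair \<gamma> A" and F = "the_set {\<gamma>}"])
      (use assms V in \<open>auto intro!: definable_intros dterm_var dterm_const vset_in_V vset_sing\<close>)
  have "pair \<gamma> A \<in> elts (below a)" using a(3)[of \<gamma>] by simp
  then have "neg_rel (pair \<gamma> A) (pair (neg_code \<gamma>) (the_set (elts Str_set - elts A)))"
    unfolding neg_rel_def neg_code_def using V by blast
  moreover have "the_set (elts Str_set - elts A) \<in> V"
    using neg_sound(1)[OF coded_sound[OF assms]] sigma_in_V unfolding sound_pair by blast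
  then have "pair (neg_code \<gamma>) (the_set (elts Str_set - elts A)) \<in> V"
    using V num_in_V unfolding neg_code_def by simp
  ultimately have "pair (neg_code \<gamma>) (the_set (elts Str_set - elts A)) \<in> stage_set (below a)"
    unfolding stage_set_def using \<open>pair \<gamma> A \<in> elts (below a)\<close> by blast
  then show ?thesis by (rule coded_stage[OF a(1,2)])
qed

lemma coded_join:
  assumes a: "a \<in> V" "ordinal a" and j: "joinable (below a) \<Gamma>"
  shows "coded (pair (Or_code \<Gamma>) (or_set (below a) \<Gamma>))" "coded (pair (And_code \<Gamma>) (and_set (below a) \<Gamma>))"
proof -
  note below = below_in_V[OF a] below_sound[OF a]
  have GV: "\<Gamma> \<in> V" using j unfolding joinable_def kappa_indexed_def by blast
  have "\<gamma> \<in> elts (field_set (below a))" if "\<gamma> \<in> elts \<Gamma>" for \<gamma>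
    using j that field_setI1[OF below(1)] unfolding joinable_def by blast
  then have G: "\<Gamma> \<in> elts (code_sets (below a))" unfolding code_sets(2)[OF below(1)] using GV by blast
  have "or_set (below a) \<Gamma> \<in> V" "and_set (below a) \<Gamma> \<in> V"
    using or_set_eq(2)[OF below j] and_set_eq(2)[OF below j] sigma_in_V by blast+
  then have "pair (Or_code \<Gamma>) (or_set (below a) \<Gamma>) \<in> stage_set (below a)" "pair (And_code \<Gamma>) (and_set (below a) \<Gamma>) \<in> stage_set (below a)"
    unfolding stage_set_def Or_code_def And_code_def using G j GV num_in_V by auto
  then show "coded (pair (Or_code \<Gamma>) (or_set (below a) \<Gamma>))" "coded (pair (And_code \<Gamma>) (and_set (below a) \<Gamma>))"
    using coded_stage[OF a] by blast+
qed

lemma joinable_stage: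
  assumes k: "kappa_indexed V \<kappa> \<Gamma>" and c: "\<And>\<gamma>. \<gamma> \<in> elts \<Gamma> \<Longrightarrow> \<exists>A. coded (pair \<gamma> A)"
  obtains a where "a \<in> V" "ordinal a" "joinable (below a) \<Gamma>"
proof -
  have GV: "\<Gamma> \<in> V" using k unfolding kappa_indexed_def by blast
  have ex: "\<exists>p. coded p \<and> (\<exists>A\<in>V. p = pair \<gamma> A)" if "\<gamma> \<in> elts \<Gamma>" for \<gamma>
    using c[OF that] coded_in_V by blast
  have d: "definable (\<lambda>e. \<exists>A\<in>V. e 0 = pair (e 1) A)" by (intro definable_intros dterm_var dterm_pair)
  obtain a where a: "a \<in> V" "ordinal a" "\<And>x. x \<in> elts \<Gamma> \<Longrightarrow> \<exists>p\<in>elts (below a). \<exists>A\<in>V. p = pair x A"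
    using coded_bound[OF d GV ex] by blast
  show thesis by (rule that[OF a(1,2)]) (use a(3) k in \<open>auto simp: joinable_def; blast\<close>)
qed

lemma borel_code_coded: "\<gamma> \<in> Codes \<Longrightarrow> \<exists>A. coded (pair \<gamma> A)"
proof (induction rule: borel_codes.induct)
  case (basic \<phi> a)
  then have "basic_ok \<phi> a" unfolding basic_ok_def by blast
  then show ?case using coded_basic by blast
next
  case (neg \<gamma>)
  then show ?case using coded_neg by blast
next
  case (Or \<Gamma>)
  then have c: "\<exists>A. coded (pair \<gamma> A)" if "\<gamma> \<in> elts \<Gamma>" for \<gamma> using that by simp
  obtain a where "a \<in> V" "ordinal a" "joinable (below a) \<Gamma>" by (rule joinable_stage[OF Or(1) c])
  then show ?case using coded_join(1) by blast
next
  case (And \<Gamma>)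
  then have c: "\<exists>A. coded (pair \<gamma> A)" if "\<gamma> \<in> elts \<Gamma>" for \<gamma> using that by simp
  obtain a where "a \<in> V" "ordinal a" "joinable (below a) \<Gamma>" by (rule joinable_stage[OF And(1) c])
  then show ?case using coded_join(2) by blast
qed

text \<open>For a union, codes of the members must be selected inside V although the codes need not
  form a set. A common stage bounds them first, and Choice in V then picks one for each
  member.\<close>

lemma sigma_coded: "A \<in> Sig \<Longrightarrow> \<exists>\<gamma>. coded (pair \<gamma> A)"
proof (induction rule: sigma.induct)
  case (basic l a)
  have "basic_ok [l] a" unfolding basic_ok_def using basic unfolding instance_of_def by auto
  from coded_basic[OF this] show ?case by auto
next
  case (compl A)
  then show ?case using coded_neg unfolding elts_Str_set by blast
next
  case (union F)
  have FV: "A \<in> V" if "A \<in> elts F" for A using in_V_elts[OF union(1) that] .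
  show ?case
  proof (cases "elts F = {}")
    case True
    \<comment> \<open>Families indexed by kappa are nonempty, so the empty union gets its code as
      the negation of the empty conjunction.\<close>
    have "basic_ok [] []" unfolding basic_ok_def by simp
    from coded_neg[OF coded_basic[OF this]]
    have "\<exists>\<gamma>. coded (pair \<gamma> (the_set (elts Str_set - elts (conj_set [] []))))" by blast
    moreover have "elts (conj_set [] []) = elts Str_set" using vset_Str by (simp add: elts_Str_set)
    ultimately show ?thesis using True by simp
  next
    case False
    then obtain A0 where A0: "A0 \<in> elts F" by blast
    have ex: "\<exists>p. coded p \<and> (\<exists>\<gamma>\<in>V. p = pair \<gamma> A)" if "A \<in> elts F" for A
      using union(4)[of A] that coded_in_V by (metis mem_elts)
    have d: "definable (\<lambda>e. \<exists>\<gamma>\<in>V. e 0 = pair \<gamma> (e 1))" by (intro definable_intros dterm_var dterm_pair)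
    obtain a where a: "a \<in> V" "ordinal a" "\<And>A. A \<in> elts F \<Longrightarrow> \<exists>p\<in>elts (below a). \<exists>\<gamma>\<in>V. p = pair \<gamma> A"
      using coded_bound[OF d union(1) ex] by blast
    note below = below_in_V[OF a(1,2)] below_sound[OF a(1,2)]
    define D where "D = field_set (below a)"
    have DV: "D \<in> V" unfolding D_def by (rule field_set_in_V[OF below(1)])
    obtain c where c: "c \<in> V"
      "\<And>Y. Y \<in> V \<Longrightarrow> elts Y \<subseteq> elts D \<Longrightarrow> elts Y \<noteq> {} \<Longrightarrow> tapp c Y \<in> elts Y"
      using choice[OF DV] by metis
    define Y where "Y = (\<lambda>A. the_set {\<gamma> \<in> elts D. pair \<gamma> A \<in> elts (below a)})"
    have Y: "elts (Y A) = {\<gamma> \<in> elts D. pair \<gamma> A \<in> elts (below a)}" "Y A \<in> V" if "A \<in> V" for A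
    proof -
      have "vset {\<gamma> \<in> elts D. pair \<gamma> A \<in> elts (below a)}"
        by (rule vset_sep) (intro definable_intros dterm_var dterm_pair dterm_const that below(1) vset_elts DV)+
      then show "elts (Y A) = {\<gamma> \<in> elts D. pair \<gamma> A \<in> elts (below a)}" "Y A \<in> V"
        unfolding Y_def using vset_in_V by auto
    qed
    have tY: "dterm (\<lambda>e. Y (t e))" if "dterm t" for t
      by (rule dterm_comp1[of Y, OF _ that]) (unfold Y_def, intro dterm_sep definable_intros dterm_var dterm_pair dterm_const below(1) DV)
    define g where "g = (\<lambda>A. tapp c (Y A))"
    have tg: "dterm (\<lambda>e. g (t e))" if "dterm t" for t unfolding g_def by (intro dterm_tapp dterm_const c(1) tY that)
    have g: "pair (g A) A \<in> elts (below a)" if A: "A \<in> elts F" for A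
    proof -
      obtain \<gamma> where "pair \<gamma> A \<in> elts (below a)" using a(3)[OF A] by blast
      then have "elts (Y A) \<noteq> {}" unfolding Y(1)[OF FV[OF A]] D_def using field_setI1[OF below(1)] by blast
      then have "tapp c (Y A) \<in> elts (Y A)" using c(2)[OF Y(2)[OF FV[OF A]]] Y(1)[OF FV[OF A]] by blast
      then show ?thesis unfolding g_def Y(1)[OF FV[OF A]] by blast
    qed
    have vG: "vset (g ` elts F)" by (rule vset_image[OF tg[OF dterm_var] vset_elts[OF union(1)]])
    define \<Gamma> where "\<Gamma> = the_set (g ` elts F)"
    have G: "\<Gamma> \<in> V" "elts \<Gamma> = g ` elts F" unfolding \<Gamma>_def using vG vset_in_V by auto
    obtain k where k: "k \<in> V" "is_fun k (elts F) (elts \<kappa>)" "inj_on (app k) (elts F)"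
      using union(2) unfolding card_le_kappa_def by blast
    \<comment> \<open>Reverses the injection k to enumerate the chosen codes along kappa, with the
      code of A0 as default off its range. The union over a singleton picks out \<open>g A\<close>
      by a definable term.\<close>
    define s where "s = (\<lambda>i. if \<exists>A\<in>elts F. pair A i \<in> elts k
      then the_set (\<Union>A\<in>elts (the_set {A \<in> elts F. pair A i \<in> elts k}). elts (g A)) else g A0)"
    have ts: "dterm (\<lambda>e. s (e 0))" unfolding s_def
      by (intro dterm_If definable_intros dterm_UN dterm_sep tg dterm_pair dterm_var dterm_const k union(1) FV[OF A0])
    have sA: "s (app k A) = g A" if A: "A \<in> elts F" for A
    proof -
      have "{B \<in> elts F. pair B (app k A) \<in> elts k} = {A}"
        unfolding is_fun_mem_iff[OF k(2)] using k(3) A by (auto dest: inj_onD)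
      then show ?thesis unfolding s_def using is_fun_app(1)[OF k(2) A] A by auto
    qed
    have s0: "s i = g A0" if "\<not> (\<exists>A\<in>elts F. i = app k A)" for i
      unfolding s_def is_fun_mem_iff[OF k(2)] using that by auto
    have "s ` elts \<kappa> = elts \<Gamma>"
    proof (intro equalityI subsetI)
      fix \<gamma> assume "\<gamma> \<in> s ` elts \<kappa>"
      then obtain i where i: "\<gamma> = s i" by blast
      show "\<gamma> \<in> elts \<Gamma>"
      proof (cases "\<exists>A\<in>elts F. i = app k A")
        case True
        then show ?thesis unfolding G(2) i using sA by auto
      next
        case False
        then show ?thesis unfolding G(2) i s0[OF False] using A0 by blast
      qed
    next
      fix \<gamma> assume "\<gamma> \<in> elts \<Gamma>"
      then obtain A where "A \<in> elts F" "\<gamma> = g A" unfolding G(2) by blast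
      then show "\<gamma> \<in> s ` elts \<kappa>" using sA is_fun_app(2)[OF k(2)] by (metis imageI)
    qed
    moreover obtain f where "f \<in> V" "is_fun f (elts \<kappa>) (s ` elts \<kappa>)" "\<And>i. i \<in> elts \<kappa> \<Longrightarrow> app f i = s i"
      using fun_in_V[OF ts vset_elts[OF kappa(1)] subset_refl] by blast
    ultimately have "kappa_indexed V \<kappa> \<Gamma>" unfolding kappa_indexed_def using G(1) by (metis image_cong)
    then have j: "joinable (below a) \<Gamma>" unfolding joinable_def G(2) using g FV by blast
    have "tapp (below a) (g A) = A" if "A \<in> elts F" for A
      using joinable_sound(1)[OF below j, of "g A" A] g[OF that] that unfolding G(2) by (metis imageI)
    then have "elts (or_set (below a) \<Gamma>) = (\<Union>A\<in>elts F. elts A)"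
      unfolding or_set_eq(1)[OF below j] G(2) by simp
    then have "or_set (below a) \<Gamma> = the_set (\<Union>A\<in>elts F. elts A)" by (metis the_set_elts)
    then show ?thesis using coded_join(1)[OF a(1,2) j] by metis
  qed
qed

lemma Int_code_eq: "interp \<gamma> (elts A) \<Longrightarrow> Int_code V \<kappa> X L \<gamma> = A"
proof -
  assume i: "interp \<gamma> (elts A)"
  have "(THE S. interp \<gamma> S) = elts A"
    by (rule the_equality) (rule i, rule interprets_unique[OF _ i])
  then show ?thesis unfolding Int_code_def by simp
qed

text \<open>Index 0 goes to the first code and all other indices to the second. The order on
  conditions is defined through such a two-member conjunction.\<close>

lemma kappa_indexed_pair:
  assumes V: "\<gamma> \<in> V" "\<zeta> \<in> V" shows "kappa_indexed V \<kappa> (the_set {\<gamma>, \<zeta>})"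
proof -
  have ne: "(num 0 :: 'u) \<noteq> num 1" by simp
  have n: "num 0 \<in> elts \<kappa>" "num 1 \<in> elts \<kappa>" using num_in_infinite_ordinal[OF kappa(2,3)] by auto
  define s where "s = (\<lambda>i::'u. if i = num 0 then \<gamma> else \<zeta>)"
  have t: "dterm (\<lambda>e. s (e 0))" unfolding s_def by (intro dterm_If definable_intros dterm_var dterm_const V num_in_V)
  have im: "s ` elts \<kappa> = {\<gamma>, \<zeta>}" unfolding s_def using n ne by (auto simp: image_iff)
  obtain f where "f \<in> V" "is_fun f (elts \<kappa>) (s ` elts \<kappa>)" "\<And>i. i \<in> elts \<kappa> \<Longrightarrow> app f i = s i"
    using fun_in_V[OF t vset_elts[OF kappa(1)] subset_refl] by blast
  then show ?thesis unfolding kappa_indexed_def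
    using im vset_in_V[OF vset_upair[OF V]] by (intro conjI bexI[of _ f]) auto
qed

lemma interp_And_neg:
  assumes g: "sound (pair \<delta> D)" "sound (pair \<gamma> A)" and V: "\<delta> \<in> V" "\<gamma> \<in> V"
  shows "interp (And_code (the_set {\<delta>, neg_code \<gamma>})) (elts D - elts A)"
proof -
  have n: "sound (pair (neg_code \<gamma>) (the_set (elts Str_set - elts A)))"
    "elts (the_set (elts Str_set - elts A)) = Strs - elts A" by (rule neg_sound[OF g(2)])+
  have nV: "neg_code \<gamma> \<in> V" unfolding neg_code_def using V num_in_V by simp
  \<comment> \<open>\<open>interprets.And\<close> wants the interpretations as one function of the
    code; the description avoids a case split on whether the two conjuncts coincide.\<close>
  define S where "S = (\<lambda>x. THE S. interp x S)"
  have S: "S x = T'" if i: "interp x T'" for x T'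
    unfolding S_def by (rule the_equality) (rule i, rule interprets_unique[OF _ i])
  have ip1: "interp \<delta> (elts D)" using g(1) unfolding sound_pair by (elim conjE)
  have "interp (neg_code \<gamma>) (elts (the_set (elts Str_set - elts A)))"
    using n(1) unfolding sound_pair by (elim conjE)
  then have ip2: "interp (neg_code \<gamma>) (Strs - elts A)" unfolding n(2) .
  have Sd: "S \<delta> = elts D" "S (neg_code \<gamma>) = Strs - elts A"
    using S[OF ip1] S[OF ip2] .
  have "interp (And_code (the_set {\<delta>, neg_code \<gamma>})) (\<Inter>\<gamma>\<in>elts (the_set {\<delta>, neg_code \<gamma>}). S \<gamma>)"
    by (rule interprets.And[OF kappa_indexed_pair[OF V(1) nV]])
      (use Sd ip1 ip2 g(1) n(1) in \<open>auto simp: sound_pair\<close>)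
  moreover have "(\<Inter>\<gamma>\<in>elts (the_set {\<delta>, neg_code \<gamma>}). S \<gamma>) = elts D - elts A"
    using Sd sigma_in_V[of D] g(1) unfolding sound_pair by auto
  ultimately show ?thesis by simp
qed

end

theorem corollary7p7:
  fixes V :: "'u::set_universe set"
    and \<kappa> X L \<mu>\<^sub>0 \<mu>\<^sub>1 :: 'u
    and G :: "'u set"
  assumes "model_of_set_theory V"
    and "\<kappa> \<in> V" and "ordinal \<kappa>" and "infinite (elts \<kappa>)"
    and "X \<in> V" and "infinite (elts X)"
    and "relational_language V L"
    and "invariant_measure V \<kappa> X L \<mu>\<^sub>0" and "ergodic V \<kappa> X L \<mu>\<^sub>0"
    and "invariant_measure V \<kappa> X L \<mu>\<^sub>1" and "ergodic V \<kappa> X L \<mu>\<^sub>1"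
    and "\<mu>\<^sub>0 \<noteq> \<mu>\<^sub>1"
    and "random_generic V \<kappa> X L \<mu>\<^sub>0 G"
  shows "\<not> random_generic V \<kappa> X L \<mu>\<^sub>1 G"
proof
  assume generic1: "random_generic V \<kappa> X L \<mu>\<^sub>1 G"
  interpret structures V \<kappa> X L by unfold_locales (use assms in auto)
  interpret M: kmeasure V \<kappa> X L \<mu>\<^sub>0
    by unfold_locales (use assms(8) in \<open>unfold invariant_measure_def, blast\<close>)
  interpret N: kmeasure V \<kappa> X L \<mu>\<^sub>1
    by unfold_locales (use assms(10) in \<open>unfold invariant_measure_def, blast\<close>)
  interpret two_measures V \<kappa> X L \<mu>\<^sub>0 \<mu>\<^sub>1 by unfold_locales
  obtain P where P: "P \<in> Sig" "val \<mu>\<^sub>0 P = 1" "val \<mu>\<^sub>1 P = 0"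
    by (rule mutually_singular[OF assms(8,10,9,11,12)])
  obtain \<gamma> where \<gamma>: "coded (pair \<gamma> P)" using sigma_coded[OF P(1)] by blast
  have gg: "sound (pair \<gamma> P)" by (rule coded_sound[OF \<gamma>])
  have I: "Int_code V \<kappa> X L \<gamma> = P" using gg Int_code_eq unfolding sound_pair by blast
  have cond: "\<gamma> \<in> random_conditions V \<kappa> X L \<mu>\<^sub>0"
    using gg P(2) I unfolding random_conditions_def code_measure_def sound_pair by simp
  obtain \<delta> where \<delta>: "\<delta> \<in> G" using assms(13) unfolding random_generic_def random_filter_def by blast
  have "\<delta> \<in> Codes"
    using assms(13) \<delta> unfolding random_generic_def random_filter_def random_conditions_def by blast
  then obtain D where D: "coded (pair \<delta> D)" using borel_code_coded by blast
  have gD: "sound (pair \<delta> D)" by (rule coded_sound[OF D])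
  have mD: "meas (elts D)" and mP: "meas (elts P)" using gD gg meas_elts unfolding sound_pair by auto
  have mDP: "meas (elts D - elts P)" by (rule meas_Diff[OF mD mP])
  \<comment> \<open>The order is given by the measure of a code, so that code is interpreted first;
    its set lies in the complement of P, which is null.\<close>
  have i: "interp (And_code (the_set {\<delta>, neg_code \<gamma>})) (elts (the_set (elts D - elts P)))"
    unfolding vset_elts_the_set[OF meas_vset[OF mDP]]
    by (rule interp_And_neg[OF gD gg coded_in_V(1)[OF D] coded_in_V(1)[OF \<gamma>]])
  have "M.mu (elts D - elts P) \<le> M.mu (Strs - elts P)"
    by (rule M.mu_mono[OF meas_compl[OF mP] mDP]) (use meas_subset[OF mD] in blast)
  also have "\<dots> = 0" using M.mu_Diff[OF meas_Str mP meas_subset[OF mP]] M.mu_Str P(2) by simp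
  finally have "M.mu (elts D - elts P) = 0" using M.mu_nonneg[OF mDP] by simp
  then have "random_le V \<kappa> X L \<mu>\<^sub>0 \<delta> \<gamma>"
    unfolding random_le_def code_measure_def Int_code_eq[OF i] M.mu_def .
  then have "\<gamma> \<in> G"
    using assms(13) \<delta> cond unfolding random_generic_def random_filter_def by blast
  then have "0 < code_measure V \<kappa> X L \<mu>\<^sub>1 \<gamma>"
    using generic1 unfolding random_generic_def random_filter_def random_conditions_def by blast
  then show False unfolding code_measure_def I P(3) by simp
qed

end
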